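(* For every $w\in\tilde S_n$, \[\tilde F_w(x_1,x_2,\dots,y_1,y_2,\dots)=\sum_{\substack{u,v\in\tilde S_n,\ uv=w\\ l(u)+l(v)=l(w)}}\tilde F_v(x_1,x_2,\dots)\,\tilde F_u(y_1,y_2,\dots).\] In particular $s_1^\perp\tilde F_w=\sum_{v}\tilde F_v$, the sum over all $v\in\tilde S_n$ such that $w=s_iv$ for some $i$ and $l(w)=l(v)+1$.
   Context: Fix $n\ge3$; indices mod $n$. $\tilde S_n$ is the affine symmetric group with Coxeter generators $s_0,\dots,s_{n-1}$, length $l$. $\mathcal U_n$ is the $\mathbb C$-algebra generated by $u_0,\dots,u_{n-1}$ with $u_i^2=0$, $u_iu_{i+1}u_i=u_{i+1}u_iu_{i+1}$, $u_iu_j=u_ju_i$ for $|i-j|\ge2$. For $A\subsetneq\{0,\dots,n-1\}$, $u_A$ is the product of the $u_a$, $a\in A$, in any order where $u_{i+1}$ precedes $u_i$ whenever $i,i+1\in A$; $h_k(\mathbf u)=\sum_{|A|=k}u_A$ for $0\le k\le n-1$. $\mathcal U_n$ acts on $\mathbb C[\tilde S_n]$ by $u_i\cdot w=s_iw$ if $l(s_iw)>l(w)$, else $0$; $\langle w,v\rangle=\delta_{wv}$. $\tilde F_w(X)$ is the formal power series whose coefficient of $x_1^{a_1}\cdots x_t^{a_t}$ (sequences with entries in $[0,n-1]$) is $\langle h_{a_t}(\mathbf u)\cdots h_{a_1}(\mathbf u)\cdot1,w\rangle$; it is a symmetric function. $s_1^\perp$ is the linear operator on symmetric functions adjoint, with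 respect to the Hall inner product ($\langle s_\lambda,s_\mu\rangle=\delta_{\lambda\mu}$), to multiplication by the Schur function $s_1=x_1+x_2+\cdots$. *)

theory Defs
  imports Complex_Main "HOL-Library.Poly_Mapping" "HOL-Library.Nat_Bijection"
    "HOL-Library.FuncSet" "HOL-Algebra.QuotRing"
begin

section \<open>The affine symmetric group\<close>

text \<open>The group is realised by its affine permutations; the product of \<open>u\<close> and \<open>v\<close> is
  \<open>u \<circ> v\<close>.\<close>

definition affine_sym :: "nat \<Rightarrow> (int \<Rightarrow> int) set" where
  "affine_sym n = {w. bij w \<and> (\<forall>k. w (k + int n) = w k + int n) \<and>
     (\<Sum>k=1..int n. w k) = (\<Sum>k=1..int n. k)}"

definition simple_refl :: "nat \<Rightarrow> nat \<Rightarrow> int \<Rightarrow> int" where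
  "simple_refl n i k =
     (if k mod int n = int i mod int n then k + 1
      else if k mod int n = (int i + 1) mod int n then k - 1
      else k)"

definition word_prod :: "nat \<Rightarrow> nat list \<Rightarrow> int \<Rightarrow> int" where
  "word_prod n is = foldr (\<circ>) (map (simple_refl n) is) id"

definition len :: "nat \<Rightarrow> (int \<Rightarrow> int) \<Rightarrow> nat" where
  "len n w = (LEAST k. \<exists>is. length is = k \<and> set is \<subseteq> {..<n} \<and> w = word_prod n is)"


section \<open>The affine nilCoxeter algebra\<close>

text \<open>Words form a monoid under concatenation, written additively so that the ring
  \<^typ>\<open>nat list \<Rightarrow>\<^sub>0 complex\<close> with its convolution product is the free associative
  algebra on noncommuting generators indexed by \<^typ>\<open>nat\<close>.\<close>

instantiation list :: (type) monoid_add
begin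

definition zero_list :: "'a list" where "zero_list = []"

definition plus_list :: "'a list \<Rightarrow> 'a list \<Rightarrow> 'a list" where "plus_list xs ys = xs @ ys"

instance by standard (simp_all add: zero_list_def plus_list_def)

end

type_synonym word_alg = "nat list \<Rightarrow>\<^sub>0 complex"

definition free_alg :: "nat \<Rightarrow> word_alg ring" where
  "free_alg n =
     \<lparr>carrier = {a. Poly_Mapping.keys a \<subseteq> lists {..<n}}, mult = (*), one = 1, zero = 0, add = (+)\<rparr>"

definition gen :: "nat \<Rightarrow> word_alg" where
  "gen i = Poly_Mapping.single [i] 1"

definition nil_rels :: "nat \<Rightarrow> word_alg set" where
  "nil_rels n =
     {gen i * gen i | i. i < n} \<union>
     {gen i * gen j * gen i - gen j * gen i * gen j | i j. i < n \<and> j = (i + 1) mod n} \<union>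
     {gen i * gen j - gen j * gen i | i j. i < n \<and> j < n \<and> i \<noteq> j \<and>
        j \<noteq> (i + 1) mod n \<and> i \<noteq> (j + 1) mod n}"

definition nil_ideal :: "nat \<Rightarrow> word_alg set" where
  "nil_ideal n = Idl\<^bsub>free_alg n\<^esub> (nil_rels n)"

definition U_alg :: "nat \<Rightarrow> word_alg set ring" where
  "U_alg n = free_alg n Quot nil_ideal n"

definition U_gen :: "nat \<Rightarrow> nat \<Rightarrow> word_alg set" where
  "U_gen n i = nil_ideal n +>\<^bsub>free_alg n\<^esub> gen i"

definition U_prod :: "nat \<Rightarrow> word_alg set list \<Rightarrow> word_alg set" where
  "U_prod n Xs = foldr (\<lambda>X Y. X \<otimes>\<^bsub>U_alg n\<^esub> Y) Xs \<one>\<^bsub>U_alg n\<^esub>"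

definition admissible_order :: "nat \<Rightarrow> nat set \<Rightarrow> nat list \<Rightarrow> bool" where
  "admissible_order n A xs \<longleftrightarrow> distinct xs \<and> set xs = A \<and>
     (\<forall>p < length xs. \<forall>q < length xs. xs ! p = (xs ! q + 1) mod n \<longrightarrow> p < q)"

text \<open>All admissible orders of a proper subset of \<open>{..<n}\<close> give the same product, so the choice
  is immaterial.\<close>

definition u_set :: "nat \<Rightarrow> nat set \<Rightarrow> word_alg set" where
  "u_set n A = U_prod n (map (U_gen n) (SOME xs. admissible_order n A xs))"

text \<open>For \<open>k \<ge> n\<close> the sum is empty, so \<open>h_u n k\<close> is zero.\<close>

definition h_u :: "nat \<Rightarrow> nat \<Rightarrow> word_alg set" where
  "h_u n k = (\<Oplus>\<^bsub>U_alg n\<^esub>A\<in>{A. A \<subset> {..<n} \<and> card A = k}. u_set n A)"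


section \<open>The action on the group algebra\<close>

type_synonym group_alg = "(int \<Rightarrow> int) \<Rightarrow>\<^sub>0 complex"

text \<open>The pairing of \<open>x :: group_alg\<close> with a group element \<open>w\<close> is \<open>Poly_Mapping.lookup x w\<close>.\<close>

definition act_gen :: "nat \<Rightarrow> nat \<Rightarrow> group_alg \<Rightarrow> group_alg" where
  "act_gen n i x = (\<Sum>w\<in>Poly_Mapping.keys x.
     if len n (simple_refl n i \<circ> w) > len n w
     then Poly_Mapping.single (simple_refl n i \<circ> w) (Poly_Mapping.lookup x w) else 0)"

definition act_free :: "nat \<Rightarrow> word_alg \<Rightarrow> group_alg \<Rightarrow> group_alg" where
  "act_free n a x = (\<Sum>is\<in>Poly_Mapping.keys a.
     Poly_Mapping.map ((*) (Poly_Mapping.lookup a is)) (foldr (act_gen n) is x))"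

text \<open>The relations act as zero, so any representative of the coset may be used.\<close>

definition act :: "nat \<Rightarrow> word_alg set \<Rightarrow> group_alg \<Rightarrow> group_alg" where
  "act n X x = act_free n (SOME a. a \<in> X) x"


section \<open>Formal power series in arbitrarily many variables\<close>

text \<open>A series in variables indexed by \<open>'v\<close> is its coefficient function on monomials
  (finitely supported exponent vectors). The variable \<open>x\<^sub>i\<close>, \<open>i \<ge> 1\<close>, has index \<open>i - 1\<close>.\<close>

type_synonym 'v series = "('v \<Rightarrow>\<^sub>0 nat) \<Rightarrow> complex"

definition series_mult :: "'v series \<Rightarrow> 'v series \<Rightarrow> 'v series" where
  "series_mult f g m = (\<Sum>(a, b)\<in>{(a, b). a + b = m}. f a * g b)"

text \<open>Substitution of the variable \<open>\<iota> k\<close> for the variable \<open>k\<close>, for injective \<open>\<iota>\<close>.\<close>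

definition rename :: "('v \<Rightarrow> 'w) \<Rightarrow> 'v series \<Rightarrow> 'w series" where
  "rename \<iota> f m =
     (if Poly_Mapping.keys m \<subseteq> range \<iota> then f (Poly_Mapping.map_key \<iota> m) else 0)"

definition symmetric :: "nat series \<Rightarrow> bool" where
  "symmetric f \<longleftrightarrow> (\<forall>\<sigma>. bij \<sigma> \<longrightarrow> rename \<sigma> f = f)"

definition mono_degree :: "('v \<Rightarrow>\<^sub>0 nat) \<Rightarrow> nat" where
  "mono_degree m = (\<Sum>k\<in>Poly_Mapping.keys m. Poly_Mapping.lookup m k)"

definition Sym :: "nat series set" where
  "Sym = {f. symmetric f \<and> (\<exists>d. \<forall>m. f m \<noteq> 0 \<longrightarrow> mono_degree m \<le> d)}"

text \<open>The variable \<open>Inl k\<close> is \<open>x\<^sub>k\<^sub>+\<^sub>1\<close> and \<open>Inr k\<close> is \<open>y\<^sub>k\<^sub>+\<^sub>1\<close>.\<close>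

definition in_x :: "nat series \<Rightarrow> (nat + nat) series" where
  "in_x f = rename Inl f"

definition in_y :: "nat series \<Rightarrow> (nat + nat) series" where
  "in_y f = rename Inr f"

text \<open>The symmetric function \<open>f\<close> in the joint alphabet \<open>x\<^sub>1, x\<^sub>2, \<dots>, y\<^sub>1, y\<^sub>2, \<dots>\<close>. The joint alphabet is
  enumerated by \<^const>\<open>sum_decode\<close>; by symmetry every enumeration gives the same series
  (lemma \<open>in_xy_enumeration\<close>).\<close>

definition in_xy :: "nat series \<Rightarrow> (nat + nat) series" where
  "in_xy f = rename sum_decode f"

lemma in_xy_enumeration:
  fixes \<phi> :: "nat \<Rightarrow> nat + nat"
  assumes "symmetric f" "bij \<phi>"
  shows "rename \<phi> f = in_xy f"
proof
  fix m :: "nat + nat \<Rightarrow>\<^sub>0 nat"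
  define \<sigma> where "\<sigma> = sum_encode \<circ> \<phi>"
  have bij: "bij \<sigma>"
    unfolding \<sigma>_def using assms(2) bij_sum_encode by (rule bij_comp)
  then have inj: "inj \<sigma>" "inj \<phi>" "inj sum_decode"
    using assms(2) bij_sum_decode by (auto simp: bij_is_inj)
  have "in_xy f m = rename \<sigma> f (Poly_Mapping.map_key sum_decode m)"
    using assms(1) bij surj_sum_decode by (simp add: in_xy_def rename_def symmetric_def)
  also have "\<dots> = f (Poly_Mapping.map_key (sum_decode \<circ> \<sigma>) m)"
    using bij inj by (simp add: rename_def bij_is_surj map_key_compose)
  also have "sum_decode \<circ> \<sigma> = \<phi>"
    by (auto simp: \<sigma>_def)
  also have "f (Poly_Mapping.map_key \<phi> m) = rename \<phi> f m"
    using assms(2) by (simp add: rename_def bij_is_surj)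
  finally show "rename \<phi> f m = in_xy f m" by simp
qed


section \<open>Affine Stanley symmetric functions\<close>

text \<open>All exponents from \<open>Poly_Mapping.degree m\<close> on are zero, and \<open>h_u n 0\<close> is the unit; a
  monomial with an exponent \<open>\<ge> n\<close> has coefficient 0.\<close>

definition affine_stanley :: "nat \<Rightarrow> (int \<Rightarrow> int) \<Rightarrow> nat series" where
  "affine_stanley n w m = Poly_Mapping.lookup
     (act n
       (U_prod n (map (\<lambda>k. h_u n (Poly_Mapping.lookup m k)) (rev [0..<Poly_Mapping.degree m])))
       (Poly_Mapping.single id 1)) w"


section \<open>Schur functions and the Hall inner product\<close>

definition partitions :: "nat list set" where
  "partitions = {ls. sorted_wrt (\<ge>) ls \<and> 0 \<notin> set ls}"

definition cells :: "nat list \<Rightarrow> (nat \<times> nat) set" where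
  "cells ls = {(r, c). r < length ls \<and> c < ls ! r}"

definition ssyt :: "nat list \<Rightarrow> (nat \<times> nat \<Rightarrow> nat) set" where
  "ssyt ls = {T \<in> cells ls \<rightarrow>\<^sub>E UNIV.
     (\<forall>r c. (r, c) \<in> cells ls \<longrightarrow> (r, c + 1) \<in> cells ls \<longrightarrow> T (r, c) \<le> T (r, c + 1)) \<and>
     (\<forall>r c. (r, c) \<in> cells ls \<longrightarrow> (r + 1, c) \<in> cells ls \<longrightarrow> T (r, c) < T (r + 1, c))}"

definition schur :: "nat list \<Rightarrow> nat series" where
  "schur ls m = of_nat (card {T \<in> ssyt ls.
     \<forall>k. Poly_Mapping.lookup m k = card {p \<in> cells ls. T p = k}})"

definition is_hall_form :: "(nat series \<Rightarrow> nat series \<Rightarrow> complex) \<Rightarrow> bool" where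
  "is_hall_form B \<longleftrightarrow>
     (\<forall>f\<in>Sym. \<forall>g\<in>Sym. \<forall>h\<in>Sym. \<forall>c.
        B (\<lambda>m. f m + c * g m) h = B f h + c * B g h \<and>
        B h (\<lambda>m. f m + c * g m) = B h f + c * B h g) \<and>
     (\<forall>ls\<in>partitions. \<forall>ms\<in>partitions. B (schur ls) (schur ms) = (if ls = ms then 1 else 0))"

text \<open>The Schur functions are a basis of \<^const>\<open>Sym\<close>, so the form exists and is
  determined on \<^const>\<open>Sym\<close>.\<close>

definition hall :: "nat series \<Rightarrow> nat series \<Rightarrow> complex" where
  "hall = (SOME B. is_hall_form B)"

definition s1_perp :: "nat series \<Rightarrow> nat series" where
  "s1_perp f = (THE g. g \<in> Sym \<and> (\<forall>h\<in>Sym. hall g h = hall f (series_mult (schur [1]) h)))"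

end

(* For words in the u_i, applying a word to a group element is multiplication by a group element or
   zero, and the product survives exactly when the lengths add. Hence the coefficient of w in a b 1
   is the sum of the products of coefficients of u in a 1 and v in b 1 over the length-additive
   factorisations w = u v, which is the coproduct formula once the variables x can be moved in front
   of the variables y, that is, once the h_k are known to commute.

   Commutation is proved by a periodic transfer matrix argument. On the window notation of the
   inverse of w, the generating function of the u_A is the trace of a row operator: a line travels
   once around the window, carrying a value which it may exchange with the values it meets. The trace
   over the carried value, which must come back decreased by n, leaves exactly the proper subsets A.
   The exchanges satisfy the Yang-Baxter equation of the nilCoxeter algebra, so two lines can be
   pulled through each other, and the cyclicity of the trace exchanges their parameters.

   For the second formula, the operator "coefficient of one extra variable in degree one" is adjoint
   to multiplication by the first Schur function. On Schur functions it removes a box, as one sees on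
   tableaux, while multiplication adds a box, by the local rule comparing the addition of a box with
   the removal of a horizontal strip. The Schur functions are a basis of the symmetric functions by
   unitriangularity, which also provides the Hall inner product and its nondegeneracy. *)

theory Submission
  imports Defs "HOL-Library.Multiset"
begin

text \<open>For a finite symmetric group the sum of all \<open>x ^ card A\<close> u_A is one linear
  product (1 + x u_{n-1}) ... (1 + x u_1), and the Yang-Baxter equation alone makes two such
  products commute. Here the generators form a cycle: every arc of A is read from its own top index,
  next to an index missing from A, and no fixed linear product yields all u_A. Closing the row of
  sites into a loop by a trace restores a uniform description, at two prices. The carried value
  ranges over all integers; for given \<open>w\<close> only finitely many values contribute, so the
  trace is cut off at a finite set, enlarged until it serves both lines. And each line moves the
  window by one position. Commutation is established for the operators of the action, which is where
  the coefficients live. On the side of symmetric functions, bijections of infinitely many variables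
  are traded for exponent vectors: symmetry becomes dependence on the multiset of nonzero exponents,
  and a tableau is peeled by its largest letter, which leaves a pair of interlacing vectors.\<close>

abbreviation "lookup \<equiv> Poly_Mapping.lookup"
abbreviation "keys \<equiv> Poly_Mapping.keys"
abbreviation "single \<equiv> Poly_Mapping.single"
abbreviation "map_key \<equiv> Poly_Mapping.map_key"
abbreviation "degree \<equiv> Poly_Mapping.degree"

section \<open>Affine permutations\<close>

abbreviation pinv :: "('a \<Rightarrow> 'b) \<Rightarrow> 'b \<Rightarrow> 'a" where "pinv \<equiv> inv_into UNIV"

lemma simple_refl_alt:
  "simple_refl n i k = (if int n dvd k - int i then k + 1 else if int n dvd k - int i - 1 then k - 1 else k)"
  unfolding simple_refl_def by (simp add: mod_eq_dvd_iff algebra_simps)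

lemma simple_refl_eqs:
  assumes "int n dvd k - int i" "2 \<le> n"
  shows "simple_refl n i k = k + 1" "simple_refl n i (k + 1) = k"
proof -
  have "\<not> int n dvd k + 1 - int i"
  proof
    assume "int n dvd k + 1 - int i"
    then have "int n dvd (k + 1 - int i) - (k - int i)" using assms(1) dvd_diff by blast
    then show False using assms(2) by simp
  qed
  then show "simple_refl n i k = k + 1" "simple_refl n i (k + 1) = k"
    using assms unfolding simple_refl_alt by (auto simp: algebra_simps)
qed

lemma simple_refl_other:
  assumes "\<not> int n dvd k - int i" "\<not> int n dvd k - int i - 1"
  shows "simple_refl n i k = k"
  using assms by (simp add: simple_refl_alt)

lemma simple_refl_cases:
  assumes "2 \<le> n"
  obtains (up) "int n dvd k - int i" "\<not> int n dvd k - int i - 1" "simple_refl n i k = k + 1" "simple_refl n i (k + 1) = k"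
  | (down) "int n dvd k - int i - 1" "\<not> int n dvd k - int i" "simple_refl n i k = k - 1" "simple_refl n i (k - 1) = k"
  | (other) "\<not> int n dvd k - int i" "\<not> int n dvd k - int i - 1" "simple_refl n i k = k"
proof -
  have *: "\<not> (int n dvd a \<and> int n dvd a - 1)" for a
  proof
    assume "int n dvd a \<and> int n dvd a - 1"
    then have "int n dvd a - (a - 1)" using dvd_diff by blast
    then show False using assms by simp
  qed
  consider "int n dvd k - int i" | "int n dvd k - int i - 1" | "\<not> int n dvd k - int i" "\<not> int n dvd k - int i - 1" by blast
  then show ?thesis
  proof cases
    case 1
    then have "\<not> int n dvd k - int i - 1" using *[of "k - int i"] by blast
    then show ?thesis using that(1) 1 simple_refl_eqs[OF 1 assms] by metis
  next
    case 2
    then have "\<not> int n dvd k - int i" using *[of "k - int i"] by blast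
    moreover have "simple_refl n i (k - 1) = k" "simple_refl n i k = k - 1"
      using simple_refl_eqs[of n "k - 1" i] 2 assms by (simp_all add: algebra_simps)
    ultimately show ?thesis using that(2) 2 by metis
  next
    case 3
    then show ?thesis using that(3) simple_refl_other by blast
  qed
qed

lemma simple_refl_invol:
  assumes "2 \<le> n" shows "simple_refl n i (simple_refl n i k) = k"
  by (rule simple_refl_cases[OF assms, of k i]) auto

lemma simple_refl_comp_invol:
  assumes "2 \<le> n" shows "simple_refl n i \<circ> simple_refl n i = id" "simple_refl n i \<circ> (simple_refl n i \<circ> w) = w"
  using simple_refl_invol[OF assms] by (auto simp: fun_eq_iff)

lemma bij_simple_refl: "2 \<le> n \<Longrightarrow> bij (simple_refl n i)"
  using o_bij simple_refl_comp_invol(1) by blast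

lemma inv_simple_refl: "2 \<le> n \<Longrightarrow> pinv (simple_refl n i) = simple_refl n i"
  using inv_unique_comp simple_refl_comp_invol(1) by blast

lemma simple_refl_shift: "simple_refl n i (k + int n) = simple_refl n i k + int n"
proof -
  have "int n dvd k + int n - int i \<longleftrightarrow> int n dvd k - int i" for k
    by (metis add_diff_eq add.commute dvd_add_triv_left_iff)
  from this[of k] this[of "k - 1"] show ?thesis by (simp add: simple_refl_alt algebra_simps)
qed

lemma periodic_shift:
  fixes w :: "int \<Rightarrow> int"
  assumes "\<And>k. w (k + int n) = w k + int n"
  shows "w (k + int n * q) = w k + int n * q"
proof (induction q arbitrary: k rule: int_induct[of _ 0])
  case base show ?case by simp
next
  case (step1 q)
  have "w (k + int n * (q + 1)) = w ((k + int n) + int n * q)" by (simp add: algebra_simps)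
  also have "\<dots> = w (k + int n) + int n * q" by (rule step1)
  finally show ?case by (simp add: assms algebra_simps)
next
  case (step2 q)
  have "w (k - int n) = w k - int n" using assms[of "k - int n"] by simp
  moreover have "w (k + int n * (q - 1)) = w ((k - int n) + int n * q)" by (simp add: algebra_simps)
  ultimately show ?case using step2(2)[of "k - int n"] by (simp add: algebra_simps)
qed

text \<open>Lets a sum over the window from 1 to n be moved to the window starting at i, where
  \<open>simple_refl n i\<close> affects the first two entries only.\<close>

lemma sum_periodic_window:
  fixes f :: "int \<Rightarrow> int"
  assumes "\<And>k. f (k + int n) = f k"
  shows "(\<Sum>k=a..a + int n - 1. f k) = (\<Sum>k=b..b + int n - 1. f k)"
proof -
  have step: "(\<Sum>k=a..a + int n - 1. f k) = (\<Sum>k=a+1..(a+1) + int n - 1. f k)" for a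
  proof (cases "n = 0")
    case False
    have "{a..a + int n - 1} = insert a {a+1..a+int n-1}"
      "{a+1..(a+1) + int n - 1} = insert (a + int n) {a+1..a+int n-1}" using False by auto
    then show ?thesis by (simp add: assms)
  qed simp
  have "(\<Sum>k=a+q..a + q + int n - 1. f k) = (\<Sum>k=a..a + int n - 1. f k)" for q
  proof (induction q rule: int_induct[of _ 0])
    case base show ?case by simp
  next
    case (step1 q) then show ?case using step[of "a + q"] by (simp add: algebra_simps)
  next
    case (step2 q) then show ?case using step[of "a + q - 1"] by (simp add: algebra_simps)
  qed
  from this[of "b - a"] show ?thesis by simp
qed

text \<open>The normalisation is put as a sum of \<open>w k - k\<close>, which is periodic in
  \<open>k\<close>, unlike \<open>w k\<close> itself; this form survives moving the window.\<close>

lemma affine_symD: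
  assumes "w \<in> affine_sym n"
  shows "bij w" "\<And>k. w (k + int n) = w k + int n" "(\<Sum>k=1..int n. w k - k) = 0"
  using assms by (auto simp: affine_sym_def sum_subtractf)

lemma affine_symI:
  assumes "bij w" "\<And>k. w (k + int n) = w k + int n" "(\<Sum>k=1..int n. w k - k) = 0"
  shows "w \<in> affine_sym n"
  using assms by (auto simp: affine_sym_def sum_subtractf)

lemma inv_periodic:
  assumes "bij w" "\<And>k. w (k + int n) = w k + int n"
  shows "pinv w (k + int n) = pinv w k + int n"
  by (metis assms bij_inv_eq_iff)

lemma affine_sym_id: "id \<in> affine_sym n"
  by (rule affine_symI) auto

lemma simple_refl_window_sum:
  assumes "2 \<le> n"
  shows "(\<Sum>k=a..a + int n - 1. simple_refl n i k - k) = 0"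
proof -
  have "(\<Sum>k=a..a + int n - 1. simple_refl n i k - k) = (\<Sum>k=int i..int i + int n - 1. simple_refl n i k - k)"
    by (rule sum_periodic_window) (simp add: simple_refl_shift)
  also have "\<dots> = (\<Sum>k\<in>{int i, int i + 1}. simple_refl n i k - k)"
  proof (rule sum.mono_neutral_right)
    show "\<forall>k\<in>{int i..int i + int n - 1} - {int i, int i + 1}. simple_refl n i k - k = 0"
    proof
      fix k assume k: "k \<in> {int i..int i + int n - 1} - {int i, int i + 1}"
      then have "0 < k - int i" "k - int i < int n" "0 < k - int i - 1" "k - int i - 1 < int n" by auto
      then have "\<not> int n dvd k - int i" "\<not> int n dvd k - int i - 1" using zdvd_not_zless by blast+
      then show "simple_refl n i k - k = 0" by (simp add: simple_refl_other)
    qed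
  qed (use assms in auto)
  also have "\<dots> = 0" using simple_refl_eqs[of n "int i" i] assms by simp
  finally show ?thesis .
qed

lemma simple_refl_affine: "2 \<le> n \<Longrightarrow> simple_refl n i \<in> affine_sym n"
  using simple_refl_window_sum[of n i 1] by (intro affine_symI) (auto simp: bij_simple_refl simple_refl_shift)

lemma bij_betw_mod_window:
  assumes "bij v" "\<And>k. v (k + int n) = v k + int n" "0 < n"
  shows "bij_betw (\<lambda>k. v k mod int n) {1..int n} {0..<int n}"
proof -
  have "inj_on (\<lambda>k. v k mod int n) {1..int n}"
  proof (rule inj_onI)
    fix j k assume jk: "j \<in> {1..int n}" "k \<in> {1..int n}" "v j mod int n = v k mod int n"
    then obtain q where "v j = v k + int n * q"
      by (metis mod_eqE)
    then have "v j = v (k + int n * q)" using periodic_shift[of v n k q] assms(2) by auto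
    then have eq: "j = k + int n * q" using assms(1) by (simp add: bij_is_inj inj_eq)
    then have "int n dvd j - k" by simp
    moreover have "\<bar>j - k\<bar> < int n" using jk by auto
    ultimately show "j = k" by (metis dvd_imp_le_int eq_iff_diff_eq_0 abs_of_nat leD)
  qed
  moreover have "(\<lambda>k. v k mod int n) ` {1..int n} \<subseteq> {0..<int n}" using assms(3) by auto
  moreover have "card ((\<lambda>k. v k mod int n) ` {1..int n}) = card {0..<int n}"
    using card_image[OF calculation(1)] by simp
  ultimately show ?thesis unfolding bij_betw_def by (meson card_subset_eq finite_atLeastLessThan_int)
qed

lemma affine_sym_comp:
  assumes "u \<in> affine_sym n" "v \<in> affine_sym n"
  shows "u \<circ> v \<in> affine_sym n"
proof (cases "n = 0")
  case True
  then show ?thesis using affine_symD(1)[OF assms(1)] affine_symD(1)[OF assms(2)]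
     by (intro affine_symI) (auto intro: bij_comp)
next
  case False
  note u = affine_symD[OF assms(1)] note v = affine_symD[OF assms(2)]
  \<comment> \<open>The displacement of \<open>u\<close> depends only on the residue class, and
    \<open>v\<close> permutes the residue classes, so its sum over \<open>v k\<close> equals its sum
    over \<open>k\<close>.\<close>
  let ?g = "\<lambda>r. u r - r"
  have g: "?g k = ?g (k mod int n)" for k
  proof -
    have k: "k mod int n + int n * (k div int n) = k" by simp
    have "u k = u (k mod int n) + int n * (k div int n)"
      using periodic_shift[of u n "k mod int n" "k div int n"] u(2) unfolding k by blast
    then show ?thesis using k by linarith
  qed
  have sum_g: "(\<Sum>k=1..int n. ?g (w k)) = (\<Sum>r\<in>{0..<int n}. ?g r)"
    if "bij w" "\<And>k. w (k + int n) = w k + int n" for w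
  proof -
    have "(\<Sum>k=1..int n. ?g (w k)) = (\<Sum>k=1..int n. ?g (w k mod int n))" using g by simp
    also have "\<dots> = (\<Sum>r\<in>{0..<int n}. ?g r)"
      using sum.reindex_bij_betw[OF bij_betw_mod_window[OF that], of ?g] False by simp
    finally show ?thesis .
  qed
  have "(\<Sum>k=1..int n. u (v k) - k) = (\<Sum>k=1..int n. ?g (v k)) + (\<Sum>k=1..int n. v k - k)"
    by (simp add: sum_subtractf)
  also have "\<dots> = 0" using sum_g[of v] sum_g[of id] v u by simp
  finally show ?thesis using u v by (intro affine_symI) (auto intro: bij_comp)
qed

lemma simple_refl_comp_affine_iff:
  assumes "2 \<le> n"
  shows "simple_refl n i \<circ> w \<in> affine_sym n \<longleftrightarrow> w \<in> affine_sym n"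
  using affine_sym_comp[OF simple_refl_affine[OF assms]] simple_refl_comp_invol(2)[OF assms] by metis

lemma inv_simple_refl_comp:
  assumes "2 \<le> n" "bij w"
  shows "pinv (simple_refl n i \<circ> w) = pinv w \<circ> simple_refl n i"
  using assms by (simp add: o_inv_distrib bij_simple_refl inv_simple_refl)

lemma word_prod_simps [simp]:
  "word_prod n [] = id" "word_prod n (i # is) = simple_refl n i \<circ> word_prod n is"
  by (simp_all add: word_prod_def)

lemma word_prod_append: "word_prod n (is @ js) = word_prod n is \<circ> word_prod n js"
  by (induction "is") (auto simp: comp_assoc)

lemma word_prod_affine: "2 \<le> n \<Longrightarrow> word_prod n is \<in> affine_sym n"
  by (induction "is") (auto simp: affine_sym_id simple_refl_comp_affine_iff)

section \<open>Descents and the length function\<close>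

definition is_desc :: "nat \<Rightarrow> nat \<Rightarrow> (int \<Rightarrow> int) \<Rightarrow> bool" where
  "is_desc n i w \<longleftrightarrow> w \<in> affine_sym n \<and> pinv w (int i) > pinv w (int i + 1)"

text \<open>A quadratic potential for the induction that writes \<open>w\<close> as a word. Left
  multiplication by a simple reflection exchanges two neighbouring values of the inverse in every
  period, which changes the potential by twice their difference; so it drops strictly at a
  descent.\<close>

definition displacement :: "nat \<Rightarrow> (int \<Rightarrow> int) \<Rightarrow> int" where
  "displacement n w = (\<Sum>k=1..int n. (pinv w k - k)\<^sup>2)"

lemma displacement_simple_refl:
  assumes "2 \<le> n" "w \<in> affine_sym n"
  shows "displacement n (simple_refl n i \<circ> w) = displacement n w + 2 * (pinv w (int i + 1) - pinv w (int i))"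
proof -
  note w = affine_symD[OF assms(2)]
  let ?p = "pinv w"
  let ?s = "simple_refl n i"
  have per: "?p (k + int n) = ?p k + int n" for k by (rule inv_periodic[OF w(1,2)])
  have "displacement n (?s \<circ> w) = (\<Sum>k=1..int n. (?p (?s k) - k)\<^sup>2)"
    using inv_simple_refl_comp[OF assms(1) w(1)] by (simp add: displacement_def)
  also have "\<dots> = (\<Sum>k=int i..int i+int n-1. (?p (?s k) - k)\<^sup>2)"
    using sum_periodic_window[of "\<lambda>k. (?p (?s k) - k)\<^sup>2" n 1 "int i"] by (simp add: per simple_refl_shift)
  also have "{int i..int i+int n-1} = insert (int i) (insert (int i + 1) {int i+2..int i+int n-1})" using assms(1) by auto
  also have "(\<Sum>k\<in>\<dots>. (?p (?s k) - k)\<^sup>2) = (?p (int i + 1) - int i)\<^sup>2 + (?p (int i) - (int i + 1))\<^sup>2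
      + (\<Sum>k\<in>{int i+2..int i+int n-1}. (?p (?s k) - k)\<^sup>2)"
    using simple_refl_eqs[of n "int i" i] assms(1) by simp
  also have "(\<Sum>k\<in>{int i+2..int i+int n-1}. (?p (?s k) - k)\<^sup>2) = (\<Sum>k\<in>{int i+2..int i+int n-1}. (?p k - k)\<^sup>2)"
  proof (rule sum.cong[OF refl])
    fix k assume k: "k \<in> {int i+2..int i+int n-1}"
    then have "0 < k - int i" "k - int i < int n" "0 < k - int i - 1" "k - int i - 1 < int n" by auto
    then have "\<not> int n dvd k - int i" "\<not> int n dvd k - int i - 1" using zdvd_not_zless by blast+
    then show "(?p (?s k) - k)\<^sup>2 = (?p k - k)\<^sup>2" by (simp add: simple_refl_other)
  qed
  finally have 1: "displacement n (?s \<circ> w) = (?p (int i + 1) - int i)\<^sup>2 + (?p (int i) - (int i + 1))\<^sup>2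
      + (\<Sum>k\<in>{int i+2..int i+int n-1}. (?p k - k)\<^sup>2)" .
  have "displacement n w = (\<Sum>k=int i..int i+int n-1. (?p k - k)\<^sup>2)"
    using sum_periodic_window[of "\<lambda>k. (?p k - k)\<^sup>2" n 1 "int i"] by (simp add: per displacement_def)
  also have "{int i..int i+int n-1} = insert (int i) (insert (int i + 1) {int i+2..int i+int n-1})" using assms(1) by auto
  finally have 2: "displacement n w = (?p (int i) - int i)\<^sup>2 + (?p (int i + 1) - (int i + 1))\<^sup>2
      + (\<Sum>k\<in>{int i+2..int i+int n-1}. (?p k - k)\<^sup>2)" by simp
  show ?thesis unfolding 1 2 by (simp add: power2_eq_square algebra_simps)
qed

text \<open>By periodicity the inverse is strictly increasing on all integers; being onto it has no
  gaps, so it is a translation, and the normalisation of the sum leaves only the translation by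
  0.\<close>

lemma increasing_affine_id:
  assumes "2 \<le> n" "w \<in> affine_sym n" "\<And>i. i < n \<Longrightarrow> pinv w (int i) \<le> pinv w (int i + 1)"
  shows "w = id"
proof -
  note w = affine_symD[OF assms(2)]
  let ?p = "pinv w"
  have per: "?p (k + int n * q) = ?p k + int n * q" for k q
    by (rule periodic_shift) (rule inv_periodic[OF w(1,2)])
  have bijp: "bij ?p" using w(1) by (simp add: bij_imp_bij_inv)
  have le: "?p k < ?p (k + 1)" for k
  proof -
    define i where "i = nat (k mod int n)"
    have i: "int i = k mod int n" "i < n" using assms(1) by (simp_all add: i_def nat_less_iff)
    have "?p k = ?p (int i) + int n * (k div int n)" "?p (k + 1) = ?p (int i + 1) + int n * (k div int n)"
      using per[of "int i" "k div int n"] per[of "int i + 1" "k div int n"] i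
      by (simp_all add: algebra_simps)
    then have "?p k \<le> ?p (k + 1)" using assms(3)[OF i(2)] by simp
    moreover have "?p k \<noteq> ?p (k + 1)" using bijp by (simp add: bij_is_inj inj_eq)
    ultimately show ?thesis by simp
  qed
  have sm: "?p j < ?p k" if "j < k" for j k using that
    by (induction k rule: int_gr_induct) (use le less_trans in blast)+
  have step: "?p (k + 1) = ?p k + 1" for k
  proof (rule ccontr)
    assume "?p (k + 1) \<noteq> ?p k + 1"
    then have gap: "?p k < ?p k + 1" "?p k + 1 < ?p (k + 1)" using le[of k] by auto
    obtain j where j: "?p j = ?p k + 1" using bijp by (metis bij_pointE)
    have "j \<le> k \<or> k + 1 \<le> j" by auto
    then show False using sm[of j k] sm[of "k+1" j] gap j by (cases "j = k"; cases "j = k + 1"; force)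
  qed
  have shift: "?p k = ?p 0 + k" for k
  proof (induction k rule: int_induct[of _ 0])
    case (step2 i) then show ?case using step[of "i - 1"] by simp
  qed (auto simp: step)
  have wk: "w k = k - ?p 0" for k
    using shift[of "w k"] w(1) by (simp add: bij_is_inj)
  have "(\<Sum>k=1..int n. w k - k) = - (int n * ?p 0)" by (simp add: wk)
  then have "?p 0 = 0" using w(3) assms(1) by simp
  then show ?thesis using wk by (auto simp: fun_eq_iff)
qed

lemma affine_sym_word:
  assumes "2 \<le> n" "w \<in> affine_sym n"
  shows "\<exists>is. set is \<subseteq> {..<n} \<and> w = word_prod n is"
  using assms(2)
proof (induction "nat (displacement n w)" arbitrary: w rule: less_induct)
  case less
  show ?case
  proof (cases "\<exists>i<n. pinv w (int i) > pinv w (int i + 1)")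
    case False
    then have "w = word_prod n []" using increasing_affine_id[OF assms(1) less.prems] by force
    then show ?thesis by (intro exI[of _ "[]"]) auto
  next
    case True
    then obtain i where i: "i < n" "pinv w (int i) > pinv w (int i + 1)" by blast
    have aff: "simple_refl n i \<circ> w \<in> affine_sym n"
      using less.prems assms(1) by (simp add: simple_refl_comp_affine_iff)
    have "displacement n (simple_refl n i \<circ> w) < displacement n w"
      using displacement_simple_refl[OF assms(1) less.prems, of i] i by simp
    moreover have "displacement n (simple_refl n i \<circ> w) \<ge> 0" unfolding displacement_def by (simp add: sum_nonneg)
    ultimately have "nat (displacement n (simple_refl n i \<circ> w)) < nat (displacement n w)" by linarith
    from less.hyps[OF this aff] obtain js where "set js \<subseteq> {..<n}" "simple_refl n i \<circ> w = word_prod n js" by blast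
    then have "set (i # js) \<subseteq> {..<n}" "w = word_prod n (i # js)"
      using i(1) simple_refl_comp_invol(2)[OF assms(1)] by (simp, metis word_prod_simps(2))
    then show ?thesis by blast
  qed
qed

lemma len_word:
  assumes "2 \<le> n" "w \<in> affine_sym n"
  obtains "is" where "length is = len n w" "set is \<subseteq> {..<n}" "w = word_prod n is"
proof -
  have "\<exists>k is. length is = k \<and> set is \<subseteq> {..<n} \<and> w = word_prod n is"
    using affine_sym_word[OF assms] by blast
  then have "\<exists>is. length is = len n w \<and> set is \<subseteq> {..<n} \<and> w = word_prod n is"
    unfolding len_def by (rule LeastI_ex)
  then show ?thesis using that by blast
qed

lemma len_le: "set is \<subseteq> {..<n} \<Longrightarrow> len n (word_prod n is) \<le> length is"
  unfolding len_def by (rule Least_le) blast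

lemma len_comp_le:
  assumes "2 \<le> n" "u \<in> affine_sym n" "v \<in> affine_sym n"
  shows "len n (u \<circ> v) \<le> len n u + len n v"
proof -
  obtain us where us: "length us = len n u" "set us \<subseteq> {..<n}" "u = word_prod n us" using len_word[OF assms(1,2)] .
  obtain vs where vs: "length vs = len n v" "set vs \<subseteq> {..<n}" "v = word_prod n vs" using len_word[OF assms(1,3)] .
  show ?thesis using len_le[of "us @ vs" n] us vs by (simp add: word_prod_append)
qed

lemma len_id [simp]: "len n id = 0"
  using len_le[of "[]" n] by simp

text \<open>Follow the pair \<open>(i, i + 1)\<close> through the letters of the word: the letter at which its order
  is reversed can be deleted.\<close>

lemma exchange:
  assumes "2 \<le> n" "a < b" "set is \<subseteq> {..<n}" "pinv (word_prod n is) a > pinv (word_prod n is) b"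
    "\<And>x. r x = (if \<exists>q. x = a + int n * q then x + (b - a) else if \<exists>q. x = b + int n * q then x + (a - b) else x)"
  shows "\<exists>js. set js \<subseteq> {..<n} \<and> length is = Suc (length js) \<and> r \<circ> word_prod n is = word_prod n js"
  using assms(2-)
proof (induction "is" arbitrary: a b r)
  case Nil
  then show ?case by simp
next
  case (Cons i js)
  let ?s = "simple_refl n i"
  have bij: "bij (word_prod n js)" using affine_symD(1)[OF word_prod_affine[OF assms(1)]] .
  have inv_step: "pinv (word_prod n (i # js)) x = pinv (word_prod n js) (?s x)" for x
    using inv_simple_refl_comp[OF assms(1) bij] by simp
  have sper: "?s (x + int n * q) = ?s x + int n * q" for x q
    by (rule periodic_shift) (simp add: simple_refl_shift)
  show ?case
  proof (cases "?s a < ?s b")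
    case True
    \<comment> \<open>\<open>r\<close> is the reflection exchanging \<open>a\<close> and
      \<open>b\<close> together with their translates by multiples of n. Conjugation by the first
      letter turns it into the reflection for \<open>?s a\<close> and \<open>?s b\<close>, the pair
      that the remaining word sees.\<close>
    let ?r = "?s \<circ> r \<circ> ?s"
    have fwd: "(\<exists>q. ?s x = c + int n * q) \<longleftrightarrow> (\<exists>q. x = ?s c + int n * q)" for x c
      by (metis sper simple_refl_invol[OF assms(1)])
    have r': "?r x = (if \<exists>q. x = ?s a + int n * q then x + (?s b - ?s a) else if \<exists>q. x = ?s b + int n * q then x + (?s a - ?s b) else x)" for x
    proof -
      consider q where "x = ?s a + int n * q" | q where "\<not> (\<exists>q. x = ?s a + int n * q)" "x = ?s b + int n * q"
        | "\<not> (\<exists>q. x = ?s a + int n * q)" "\<not> (\<exists>q. x = ?s b + int n * q)" by blast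
      then show ?thesis
      proof cases
        case 1
        then have "?s x = a + int n * q" by (simp add: sper simple_refl_invol[OF assms(1)])
        then have "r (?s x) = b + int n * q" using Cons.prems(4)[of "?s x"] by auto
        then show ?thesis using 1 by (auto simp: sper)
      next
        case 2
        then have "?s x = b + int n * q" by (simp add: sper simple_refl_invol[OF assms(1)])
        moreover have "\<not> (\<exists>q. ?s x = a + int n * q)" using 2(1) fwd by blast
        ultimately
have "r (?s x) = a + int n * q" using Cons.prems(4)[of "?s x"] by auto
        then show ?thesis using 2 by (auto simp: sper)
      next
        case 3
        then show ?thesis using Cons.prems(4)[of "?s x"] by (simp add: fwd simple_refl_invol[OF assms(1)])
      qed
    qed
    have "\<exists>ks. set ks \<subseteq> {..<n} \<and> length js = Suc (length ks) \<and> ?r \<circ> word_prod n js = word_prod n ks"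
      by (rule Cons.IH[OF True]) (use Cons.prems(2,3) r' in \<open>simp_all only: inv_step list.set insert_subset\<close>)
    then obtain ks where ks: "set ks \<subseteq> {..<n}" "length js = Suc (length ks)" "?r \<circ> word_prod n js = word_prod n ks" by blast
    then have "r \<circ> word_prod n (i # js) = word_prod n (i # ks)"
      using ks(3)[symmetric] by (simp add: comp_assoc simple_refl_comp_invol[OF assms(1)])
    moreover have "set (i # ks) \<subseteq> {..<n}" "length (i # js) = Suc (length (i # ks))" using ks(1,2) Cons.prems(2) by auto
    ultimately show ?thesis by blast
  next
    case False
    \<comment> \<open>A simple reflection moves each integer by at most one, so it can reverse
      \<open>a < b\<close> only if these are neighbours that it exchanges. Then \<open>r\<close> is
      the letter itself and cancels it.\<close>
    have "int n dvd a - int i \<and> b = a + 1"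
    proof (cases rule: simple_refl_cases[OF assms(1), of a i, case_names up down other])
      case up
      show ?thesis
        by (cases rule: simple_refl_cases[OF assms(1), of b i]) (use False Cons.prems(1) up in \<open>smt (verit)\<close>)+
    next
      case down
      show ?thesis
        by (cases rule: simple_refl_cases[OF assms(1), of b i]) (use False Cons.prems(1) down in \<open>smt (verit)\<close>)+
    next
      case other
      show ?thesis
        by (cases rule: simple_refl_cases[OF assms(1), of b i]) (use False Cons.prems(1) other in \<open>smt (verit)\<close>)+
    qed
    then have ab: "int n dvd a - int i" "b = a + 1" by auto
    have "r = ?s"
    proof
      fix x
      have 1: "(\<exists>q. x = a + int n * q) \<longleftrightarrow> int n dvd x - int i"
      proof -
        have "int n dvd x - int i \<longleftrightarrow> int n dvd (x - int i) - (a - int i)" using ab(1) by (metis diff_add_cancel dvd_add_left_iff)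
        then show ?thesis by (auto simp: dvd_def algebra_simps)
      qed
      have 2: "(\<exists>q. x = b + int n * q) \<longleftrightarrow> int n dvd x - int i - 1"
      proof -
        have "int n dvd x - int i - 1 \<longleftrightarrow> int n dvd (x - int i - 1) - (a - int i)" using ab(1) by (metis diff_add_cancel dvd_add_left_iff)
        then show ?thesis using ab(2) by (auto simp: dvd_def algebra_simps)
      qed
      show "r x = ?s x" using Cons.prems(4)[of x] unfolding 1 2 using ab(2) by (simp add: simple_refl_alt)
    qed
    then have "r \<circ> word_prod n (i # js) = word_prod n js" using simple_refl_comp_invol(2)[OF assms(1)] by simp
    moreover have "set js \<subseteq> {..<n}" "length (i # js) = Suc (length js)" using Cons.prems(2) by auto
    ultimately show ?thesis by blast
  qed
qed

text \<open>The exchange property deletes a letter of a reduced word, so the length drops;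
  subadditivity prevents a drop by more than one.\<close>

lemma len_desc:
  assumes "2 \<le> n" "i < n" "w \<in> affine_sym n" "pinv w (int i) > pinv w (int i + 1)"
  shows "len n w = Suc (len n (simple_refl n i \<circ> w))"
proof -
  let ?s = "simple_refl n i"
  obtain "is" where "is": "length is = len n w" "set is \<subseteq> {..<n}" "w = word_prod n is" using len_word[OF assms(1,3)] .
  have "\<exists>js. set js \<subseteq> {..<n} \<and> length is = Suc (length js) \<and> ?s \<circ> word_prod n is = word_prod n js"
  proof (rule exchange[OF assms(1), of "int i" "int i + 1"])
    fix x
    have 1: "(\<exists>q. x = int i + int n * q) \<longleftrightarrow> int n dvd x - int i" by (auto simp: dvd_def algebra_simps)
    have 2: "(\<exists>q. x = int i + 1 + int n * q) \<longleftrightarrow> int n dvd x - int i - 1" by (auto simp: dvd_def algebra_simps)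
    show "?s x = (if \<exists>q. x = int i + int n * q then x + (int i + 1 - int i)
      else if \<exists>q. x = int i + 1 + int n * q then x + (int i - (int i + 1)) else x)"
      unfolding 1 2 by (simp add: simple_refl_alt)
  qed (use "is" assms in auto)
  then have "len n (?s \<circ> w) < len n w" using "is" len_le
    by (metis less_Suc_eq_le)
  moreover have "len n w \<le> 1 + len n (?s \<circ> w)"
    using len_comp_le[OF assms(1) simple_refl_affine[OF assms(1), of i], of "?s \<circ> w"]
      len_le[of "[i]" n] assms
    by (simp add: simple_refl_comp_affine_iff simple_refl_comp_invol(2))
  ultimately show ?thesis by simp
qed

lemma is_desc_refl:
  assumes "2 \<le> n" "w \<in> affine_sym n"
  shows "is_desc n i (simple_refl n i \<circ> w) \<longleftrightarrow> \<not> is_desc n i w"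
proof -
  note w = affine_symD[OF assms(2)]
  have "pinv w (int i) \<noteq> pinv w (int i + 1)" using w(1) by (metis bij_inv_eq_iff less_add_one less_irrefl)
  then show ?thesis
    using assms simple_refl_eqs[of n "int i" i] inv_simple_refl_comp[OF assms(1) w(1)]
    by (auto simp: is_desc_def simple_refl_comp_affine_iff)
qed

lemma len_simple_refl:
  assumes "2 \<le> n" "i < n" "w \<in> affine_sym n"
  shows "len n (simple_refl n i \<circ> w) = (if is_desc n i w then len n w - 1 else Suc (len n w))"
    "is_desc n i w \<Longrightarrow> 0 < len n w"
proof -
  show "len n (simple_refl n i \<circ> w) = (if is_desc n i w then len n w - 1 else Suc (len n w))"
  proof (cases "is_desc n i w")
    case True
    then show ?thesis using len_desc[OF assms] by (simp add: is_desc_def)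
  next
    case False
    then have "is_desc n i (simple_refl n i \<circ> w)" using is_desc_refl assms by blast
    then show ?thesis using len_desc[OF assms(1,2), of "simple_refl n i \<circ> w"] False assms(3)
      by (simp add: is_desc_def simple_refl_comp_invol(2)[OF assms(1)])
  qed
  show "is_desc n i w \<Longrightarrow> 0 < len n w" using len_desc[OF assms] by (simp add: is_desc_def)
qed

text \<open>Outside the group no word qualifies in the definition of \<open>len\<close>, so the
  length is one fixed default value. Multiplication by a simple reflection stays outside, hence the
  length never decreases there, and \<open>len_less_iff\<close> can be stated for every function
  \<open>w\<close>.\<close>

lemma len_not_affine:
  assumes "2 \<le> n" "w \<notin> affine_sym n"
  shows "len n w = (LEAST k. False)"
  unfolding len_def using word_prod_affine[OF assms(1)] assms(2) by metis

lemma len_less_iff: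
  assumes "2 \<le> n" "i < n"
  shows "len n (simple_refl n i \<circ> w) < len n w \<longleftrightarrow> is_desc n i w"
proof (cases "w \<in> affine_sym n")
  case True
  then show ?thesis using len_simple_refl[OF assms True] by auto
next
  case False
  then show ?thesis using len_not_affine[OF assms(1)] assms by (simp add: is_desc_def simple_refl_comp_affine_iff)
qed

section \<open>Length-additive factorisations\<close>

definition factorizations :: "nat \<Rightarrow> (int \<Rightarrow> int) \<Rightarrow> ((int \<Rightarrow> int) \<times> (int \<Rightarrow> int)) set" where
  "factorizations n w = {(u, v). u \<in> affine_sym n \<and> v \<in> affine_sym n \<and> u \<circ> v = w \<and> len n u + len n v = len n w}"

lemma finite_affine_len_le:
  assumes "2 \<le> n"
  shows "finite {w \<in> affine_sym n. len n w \<le> l}"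
proof (rule finite_subset)
  show "{w \<in> affine_sym n. len n w \<le> l} \<subseteq> word_prod n ` {is. set is \<subseteq> {..<n} \<and> length is \<le> l}"
  proof
    fix w assume w: "w \<in> {w \<in> affine_sym n. len n w \<le> l}"
    then obtain "is" where "length is = len n w" "set is \<subseteq> {..<n}" "w = word_prod n is" using len_word[OF assms] by blast
    then show "w \<in> word_prod n ` {is. set is \<subseteq> {..<n} \<and> length is \<le> l}" using w by auto
  qed
  show "finite (word_prod n ` {is. set is \<subseteq> {..<n} \<and> length is \<le> l})"
    by (intro finite_imageI finite_lists_length_le) simp
qed

lemma finite_factorizations:
  assumes "2 \<le> n"
  shows "finite (factorizations n w)"
proof (rule finite_subset)
  show "factorizations n w \<subseteq> {u \<in> affine_sym n. len n u \<le> len n w} \<times> {u \<in> affine_sym n. len n u \<le> len n w}"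
    by (auto simp: factorizations_def)
qed (simp add: finite_affine_len_le[OF assms])

lemma factorizations_id:
  assumes "2 \<le> n" "w \<in> affine_sym n"
  shows "(id, v) \<in> factorizations n w \<longleftrightarrow> v = w"
  using assms by (auto simp: factorizations_def affine_sym_id)

section \<open>The action of words\<close>

text \<open>The transposed view of the action: a simple reflection is an involution, so a single
  basis vector can contribute to the coefficient of \<open>w\<close>. Peeling a letter off a word
  thereby becomes a test for a descent.\<close>

lemma lookup_act_gen:
  assumes "2 \<le> n"
  shows "lookup (act_gen n i X) w =
    (if len n (simple_refl n i \<circ> w) < len n w then lookup X (simple_refl n i \<circ> w) else 0)"
proof -
  let ?s = "simple_refl n i"
  have eq: "?s \<circ> v = w \<longleftrightarrow> v = ?s \<circ> w" for v using simple_refl_comp_invol(2)[OF assms] by metis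
  have "lookup (act_gen n i X) w = (\<Sum>v\<in>keys X.
      if v = ?s \<circ> w then (if len n (?s \<circ> w) < len n w then lookup X v else 0) else 0)"
    unfolding act_gen_def lookup_sum
    by (rule sum.cong) (auto simp: lookup_single when_def eq simple_refl_comp_invol(2)[OF assms])
  then show ?thesis by (auto simp: in_keys_iff)
qed

abbreviation word_act :: "nat \<Rightarrow> nat list \<Rightarrow> group_alg \<Rightarrow> group_alg" where
  "word_act n \<equiv> foldr (act_gen n)"

lemma lookup_word_act_Cons:
  assumes "2 \<le> n" "i < n"
  shows "lookup (word_act n (i # is) X) w =
    (if is_desc n i w then lookup (word_act n is X) (simple_refl n i \<circ> w) else 0)"
  using assms by (simp add: lookup_act_gen len_less_iff)

lemma lookup_act_free:
  "lookup (act_free n a X) w =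
    (\<Sum>is\<in>keys a. lookup a is * lookup (word_act n is X) w)"
  unfolding act_free_def lookup_sum by (rule sum.cong) (auto simp: map.rep_eq when_def)

lemma lookup_act_free_superset:
  assumes "finite S" "keys a \<subseteq> S"
  shows "lookup (act_free n a X) w =
    (\<Sum>is\<in>S. lookup a is * lookup (word_act n is X) w)"
  unfolding lookup_act_free by (rule sum.mono_neutral_left) (use assms in \<open>auto simp: in_keys_iff\<close>)

lemma act_free_zero [simp]: "act_free n 0 X = 0"
  by (simp add: act_free_def)

lemma act_free_add: "act_free n (a + b) X = act_free n a X + act_free n b X"
proof (rule poly_mapping_eqI)
  fix w
  let ?S = "keys a \<union> keys b"
  have "keys (a + b) \<subseteq> ?S" by (rule Poly_Mapping.keys_add)
  then show "lookup (act_free n (a + b) X) w = lookup (act_free n a X + act_free n b X) w"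
    by (simp add: lookup_add lookup_act_free_superset[of ?S] sum.distrib algebra_simps)
qed

lemma act_free_single: "act_free n (single is 1) X = word_act n is X"
  by (rule poly_mapping_eqI) (simp add: lookup_act_free)

lemma act_free_one [simp]: "act_free n 1 X = X"
  using act_free_single[of n 0 X] unfolding single_one by (simp add: zero_list_def)

lemma act_free_uminus: "act_free n (- a) X = - act_free n a X"
  using act_free_add[of n a "- a" X] by (simp add: eq_neg_iff_add_eq_0 add.commute)

lemma act_free_diff: "act_free n (a - b) X = act_free n a X - act_free n b X"
  using act_free_add[of n a "- b" X] by (simp add: act_free_uminus)

lemma act_free_sum: "act_free n (\<Sum>k\<in>K. f k) X = (\<Sum>k\<in>K. act_free n (f k) X)"
  by (induction K rule: infinite_finite_induct) (auto simp: act_free_add)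

lemma poly_mapping_sum_single: "a = (\<Sum>k\<in>keys a. single k (lookup a k))"
  by (rule poly_mapping_eqI) (simp add: lookup_sum lookup_single when_def in_keys_iff)

text \<open>Linearity expressed through coefficients, for any family expanding \<open>Y\<close>; it
  serves both the product rule \<open>act_free_mult\<close> and the expansion of nested generating
  series.\<close>

lemma lookup_word_act_sum:
  assumes "2 \<le> n" "finite S" "\<And>w. lookup Y w = (\<Sum>k\<in>S. c k * lookup (f k) w)"
  shows "lookup (word_act n is Y) w = (\<Sum>k\<in>S. c k * lookup (word_act n is (f k)) w)"
  by (induction "is" arbitrary: w) (auto simp: assms lookup_act_gen)

lemma word_act_zero:
  assumes "2 \<le> n" shows "word_act n is 0 = 0"
  by (rule poly_mapping_eqI) (use lookup_word_act_sum[OF assms, of "{}" 0] in simp)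

lemma act_free_zero_right: "2 \<le> n \<Longrightarrow> act_free n a 0 = 0"
  by (rule poly_mapping_eqI) (simp add: lookup_act_free word_act_zero)

lemma lookup_act_free_single:
  "lookup (act_free n (single is c) X) w = c * lookup (word_act n is X) w"
  by (simp add: lookup_act_free)

lemma act_free_mult:
  assumes "2 \<le> n"
  shows "act_free n (a * b) X = act_free n a (act_free n b X)"
proof (rule poly_mapping_eqI)
  fix w
  let ?A = "keys a" let ?B = "keys b"
  have "a * b = (\<Sum>is\<in>?A. \<Sum>js\<in>?B. single (is @ js) (lookup a is * lookup b js))"
    by (subst poly_mapping_sum_single[of a], subst poly_mapping_sum_single[of b])
       (simp add: sum_product mult_single plus_list_def)
  then have "lookup (act_free n (a * b) X) w = (\<Sum>is\<in>?A. \<Sum>js\<in>?B.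
      lookup a is * lookup b js * lookup (word_act n (is @ js) X) w)"
    by (simp add: act_free_sum lookup_sum lookup_act_free_single)
  also have "\<dots> = (\<Sum>is\<in>?A. lookup a is * lookup (word_act n is (act_free n b X)) w)"
  proof (rule sum.cong[OF refl])
    fix "is"
    have "lookup (word_act n is (act_free n b X)) w
        = (\<Sum>js\<in>?B. lookup b js * lookup (word_act n is (word_act n js X)) w)"
      by (rule lookup_word_act_sum[OF assms]) (auto simp: lookup_act_free)
    then show "(\<Sum>js\<in>?B. lookup a is * lookup b js * lookup (word_act n (is @ js) X) w)
      = lookup a is * lookup (word_act n is (act_free n b X)) w"
      by (simp add: sum_distrib_left mult.assoc)
  qed
  finally show "lookup (act_free n (a * b) X) w = lookup (act_free n a (act_free n b X)) w"
    by (simp add: lookup_act_free)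
qed

section \<open>The nilCoxeter relations for the action\<close>

lemma word_act_nil:
  assumes "2 \<le> n" "i < n"
  shows "word_act n [i, i] X = 0"
proof (rule poly_mapping_eqI)
  fix w
  show "lookup (word_act n [i, i] X) w = lookup 0 w"
    using is_desc_refl[OF assms(1), of w i] lookup_word_act_Cons[OF assms, of _ X]
    by (auto simp: is_desc_def simp del: foldr.simps)
qed

text \<open>Handles the wrap from n - 1 to 0: for j = (i + 1) mod n the descent can be read at the
  position i + 1 next to i.\<close>

lemma is_desc_cong:
  assumes "2 \<le> n" "int j mod n = x mod n"
  shows "is_desc n j w \<longleftrightarrow> w \<in> affine_sym n \<and> pinv w x > pinv w (x + 1)"
proof (cases "w \<in> affine_sym n")
  case True
  note w = affine_symD[OF True]
  obtain q where q: "int j = x + int n * q" using assms(2) by (metis mod_eqE)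
  have per: "pinv w (k + int n * q) = pinv w k + int n * q" for k
    by (rule periodic_shift) (rule inv_periodic[OF w(1,2)])
  then show ?thesis using per[of x] per[of "x + 1"] q True by (simp add: is_desc_def algebra_simps)
qed (simp add: is_desc_def)

lemma is_desc_simple_refl:
  assumes "2 \<le> n"
  shows "is_desc n j (simple_refl n i \<circ> w) \<longleftrightarrow> w \<in> affine_sym n \<and>
    pinv w (simple_refl n i (int j)) > pinv w (simple_refl n i (int j + 1))"
  using inv_simple_refl_comp[OF assms, of w i] affine_symD(1)[of w n]
  by (auto simp: is_desc_def simple_refl_comp_affine_iff[OF assms])

lemma simple_refl_mod: "simple_refl n (i mod n) = simple_refl n i"
  by (auto simp: simple_refl_def fun_eq_iff zmod_int mod_add_left_eq)

lemma adjacent_refl: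
  assumes "3 \<le> n" "int n dvd x - int i"
  shows "simple_refl n i x = x + 1" "simple_refl n i (x + 1) = x" "simple_refl n i (x + 2) = x + 2"
    "simple_refl n (Suc i) x = x" "simple_refl n (Suc i) (x + 1) = x + 2" "simple_refl n (Suc i) (x + 2) = x + 1"
proof -
  have no: "\<not> int n dvd x - int i + d" if "0 < d" "d < int n" for d
  proof
    assume "int n dvd x - int i + d"
    then have "int n dvd d" using assms(2) by (simp add: dvd_add_right_iff)
    then show False using that zdvd_not_zless by blast
  qed
  have no': "\<not> int n dvd x - int i - d" if "0 < d" "d < int n" for d
  proof
    assume "int n dvd x - int i - d"
    then have "int n dvd d" using assms(2) by (simp add: dvd_diff_right_iff)
    then show False using that zdvd_not_zless by blast
  qed
  show "simple_refl n i x = x + 1" "simple_refl n i (x + 1) = x" "simple_refl n i (x + 2) = x + 2"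
    "simple_refl n (Suc i) x = x" "simple_refl n (Suc i) (x + 1) = x + 2" "simple_refl n (Suc i) (x + 2) = x + 1"
    using assms no[of 1] no[of 2] no'[of 1] no'[of 2] by (auto simp: simple_refl_alt algebra_simps)
qed

lemma simple_refl_braid:
  assumes "3 \<le> n"
  shows "simple_refl n i \<circ> (simple_refl n (Suc i) \<circ> simple_refl n i)
    = simple_refl n (Suc i) \<circ> (simple_refl n i \<circ> simple_refl n (Suc i))"
proof
  fix x
  let ?s = "simple_refl n i" let ?t = "simple_refl n (Suc i)"
  consider "int n dvd x - int i" | "int n dvd (x - 1) - int i" | "int n dvd (x - 2) - int i"
    | "\<not> int n dvd x - int i" "\<not> int n dvd x - int i - 1" "\<not> int n dvd x - int (Suc i)" "\<not> int n dvd x - int (Suc i) - 1"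
    by (auto simp: algebra_simps)
  then show "(?s \<circ> (?t \<circ> ?s)) x = (?t \<circ> (?s \<circ> ?t)) x"
  proof cases
    case 1 then show ?thesis using adjacent_refl[OF assms 1] by simp
  next
    case 2
    define y where "y = x - 1"
    then have "x = y + 1" "int n dvd y - int i" using 2 by simp_all
    then show ?thesis using adjacent_refl[OF assms, of y i] by simp
  next
    case 3
    define y where "y = x - 2"
    then have "x = y + 2" "int n dvd y - int i" using 3 by simp_all
    then show ?thesis using adjacent_refl[OF assms, of y i] by simp
  next
    case 4 then show ?thesis by (simp add: simple_refl_other del: of_nat_Suc)
  qed
qed

lemma word_act_braid:
  assumes "3 \<le> n" "i < n" "j = (i + 1) mod n"
  shows "word_act n [i, j, i] X = word_act n [j, i, j] X"
proof (rule poly_mapping_eqI)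
  fix w :: "int \<Rightarrow> int"
  let ?s = "simple_refl n i" let ?t = "simple_refl n j"
  have n2: "2 \<le> n" and jn: "j < n" using assms by auto
  have t: "?t = simple_refl n (Suc i)" using assms(3) simple_refl_mod[of n "i + 1"] by simp
  have jm: "int j mod n = (int i + 1) mod n" using assms(3) by (simp add: zmod_int algebra_simps)
  note dj = is_desc_cong[OF n2 jm] note di = is_desc_cong[OF n2 refl, of "i"]
  have vals: "?s (int i) = int i + 1" "?s (int i + 1) = int i" "?s (int i + 2) = int i + 2"
     "?t (int i) = int i" "?t (int i + 1) = int i + 2" "?t (int i + 2) = int i + 1"
    using adjacent_refl[OF assms(1), of "int i" i] unfolding t by auto
  have pinv_s: "pinv (?s \<circ> v) x = pinv v (?s x)" "pinv (?t \<circ> v) x = pinv v (?t x)" if "v \<in> affine_sym n" for v x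
    using inv_simple_refl_comp[OF n2 affine_symD(1)[OF that]] by auto
  have br: "?s \<circ> (?t \<circ> (?s \<circ> w)) = ?t \<circ> (?s \<circ> (?t \<circ> w))"
    using simple_refl_braid[OF assms(1), of i] unfolding t by (metis comp_assoc)
  \<comment> \<open>With p the inverse of \<open>w\<close>, both words survive exactly when p(i) >
    p(i + 1) > p(i + 2): each side asks for the same three comparisons, in a different
    order.\<close>
  show "lookup (word_act n [i, j, i] X) w = lookup (word_act n [j, i, j] X) w"
    unfolding lookup_word_act_Cons[OF n2 assms(2)] lookup_word_act_Cons[OF n2 jn] di dj
    by (cases "w \<in> affine_sym n") (simp_all add: pinv_s simple_refl_comp_affine_iff[OF n2] vals br add.assoc del: o_apply)
qed

lemma word_act_commute:
  assumes "3 \<le> n" "i < n" "j < n" "i \<noteq> j" "j \<noteq> (i + 1) mod n" "i \<noteq> (j + 1) mod n"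
  shows "word_act n [i, j] X = word_act n [j, i] X"
proof (rule poly_mapping_eqI)
  fix w :: "int \<Rightarrow> int"
  have n2: "2 \<le> n" using assms by auto
  \<comment> \<open>The residue classes i, i + 1 are disjoint from j, j + 1, so each reflection
    fixes the positions that the other one moves.\<close>
  have *: "\<not> (int n dvd x - int i \<and> int n dvd x - int j)"
     "\<not> (int n dvd x - int i \<and> int n dvd x - int j - 1)" "\<not> (int n dvd x - int i - 1 \<and> int n dvd x - int j)" for x
  proof -
    have ij: "\<not> int n dvd int i - int j"
      using assms by (metis mod_eq_dvd_iff mod_less of_nat_eq_iff zmod_int)
    have ij1: "\<not> int n dvd int i - (int j + 1)"
      using assms by (metis mod_eq_dvd_iff mod_less of_nat_eq_iff zmod_int of_nat_add of_nat_1)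
    have ji1: "\<not> int n dvd int j - (int i + 1)"
      using assms by (metis mod_eq_dvd_iff mod_less of_nat_eq_iff zmod_int of_nat_add of_nat_1)
    show "\<not> (int n dvd x - int i \<and> int n dvd x - int j)"
      using dvd_diff[of "int n" "x - int j" "x - int i"] ij by (auto simp: algebra_simps)
    show "\<not> (int n dvd x - int i \<and> int n dvd x - int j - 1)"
      using dvd_diff[of "int n" "x - int j - 1" "x - int i"] ij1 by (auto simp: algebra_simps)
    show "\<not> (int n dvd x - int i - 1 \<and> int n dvd x - int j)"
      using dvd_diff[of "int n" "x - int i - 1" "x - int j"] ji1 by (auto simp: algebra_simps)
  qed
  have fixj: "simple_refl n j x = x" "simple_refl n j (x + 1) = x + 1" if "int n dvd x - int i" for x
    using *[of x] *[of "x + 1"] that by (auto intro!: simple_refl_other simp: algebra_simps)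
  have fixi: "simple_refl n i x = x" "simple_refl n i (x + 1) = x + 1" if "int n dvd x - int j" for x
    using *[of x] *[of "x + 1"] that by (auto intro!: simple_refl_other simp: algebra_simps)
  have comm: "simple_refl n i (simple_refl n j x) = simple_refl n j (simple_refl n i x)" for x
  proof -
    consider "int n dvd x - int i" | "int n dvd (x - 1) - int i" | "int n dvd x - int j" | "int n dvd (x - 1) - int j"
      | "\<not> int n dvd x - int i" "\<not> int n dvd x - int i - 1" "\<not> int n dvd x - int j" "\<not> int n dvd x - int j - 1"
      by (auto simp: algebra_simps)
    then show ?thesis
    proof cases
      case 1 then show ?thesis using fixj[OF 1] simple_refl_eqs[OF 1 n2] by simp
    next
      case 2 then show ?thesis using fixj[OF 2] simple_refl_eqs[OF 2 n2] by simp
    next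
      case 3 then show ?thesis using fixi[OF 3] simple_refl_eqs[OF 3 n2] by simp
    next
      case 4 then show ?thesis using fixi[OF 4] simple_refl_eqs[OF 4 n2] by simp
    next
      case 5 then show ?thesis by (simp add: simple_refl_other)
    qed
  qed
  have "simple_refl n i \<circ> (simple_refl n j \<circ> w) = simple_refl n j \<circ> (simple_refl n i \<circ> w)"
    using comm by (simp add: fun_eq_iff)
  moreover have "is_desc n j (simple_refl n i \<circ> w) \<longleftrightarrow> is_desc n j w"
    unfolding is_desc_simple_refl[OF n2] using fixi[of "int j"] by (simp add: is_desc_def)
  moreover have "is_desc n i (simple_refl n j \<circ> w) \<longleftrightarrow> is_desc n i w"
    unfolding is_desc_simple_refl[OF n2] using fixj[of "int i"] by (simp add: is_desc_def)
  ultimately show "lookup (word_act n [i, j] X) w = lookup (word_act n [j, i] X) w"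
    unfolding lookup_word_act_Cons[OF n2 assms(2)] lookup_word_act_Cons[OF n2 assms(3)] by simp
qed

text \<open>Coefficients of \<open>a \<cdot> Y\<close> only involve the length-additive factorisations, since a word acts on
  a group element by left multiplication with a group element or as zero.\<close>

lemma lookup_word_act_factorizations:
  assumes "2 \<le> n" "set is \<subseteq> {..<n}" "w \<in> affine_sym n"
  shows "lookup (word_act n is Y) w = (\<Sum>(u, v)\<in>factorizations n w.
     lookup (word_act n is (single id 1)) u * lookup Y v)"
  using assms(2,3)
proof (induction "is" arbitrary: w)
  case Nil
  have "(\<Sum>(u :: int \<Rightarrow> int, v)\<in>factorizations n w. lookup (single id 1) u * lookup Y v)
    = (\<Sum>(u :: int \<Rightarrow> int, v)\<in>{(id, w)}. lookup (single id 1) u * lookup Y v)"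
    by (rule sum.mono_neutral_right) (use finite_factorizations[OF assms(1)] factorizations_id[OF assms(1) Nil(2)]
       in \<open>auto simp: lookup_single when_def split: if_splits\<close>)
  also have "\<dots> = lookup Y w" by simp
  moreover have "word_act n [] Z = Z" for Z by simp
  ultimately show ?case by metis
next
  case (Cons i "is")
  let ?s = "simple_refl n i"
  let ?\<delta> = "single id 1 :: group_alg"
  have i: "i < n" using Cons.prems by simp
  note lk = lookup_word_act_Cons[OF assms(1) i]
  have rhs: "(\<Sum>(u, v)\<in>factorizations n w. lookup (word_act n (i # is) ?\<delta>) u * lookup Y v)
    = (\<Sum>(u, v)\<in>{(u, v)\<in>factorizations n w. is_desc n i u}.
       lookup (word_act n is ?\<delta>) (?s \<circ> u) * lookup Y v)"
    unfolding lk by (rule sum.mono_neutral_cong_right) (use finite_factorizations[OF assms(1)] in \<open>auto split: if_splits\<close>)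
  have sw: "?s \<circ> w \<in> affine_sym n" using Cons.prems assms(1) by (simp add: simple_refl_comp_affine_iff)
  note invol = simple_refl_comp_invol(2)[OF assms(1)]
  \<comment> \<open>Strip the letter from the first factor. By subadditivity the length of
    \<open>w\<close> drops as well, so i is a descent of \<open>w\<close>, and the drop by exactly
    one keeps the lengths additive.\<close>
  have fw: "(?s \<circ> u, v) \<in> factorizations n (?s \<circ> w)" "is_desc n i w" if uv: "(u, v) \<in> factorizations n w" "is_desc n i u" for u v
  proof -
    have a: "u \<in> affine_sym n" "v \<in> affine_sym n" "u \<circ> v = w" "len n u + len n v = len n w" using uv(1) by (auto simp: factorizations_def)
    have su: "?s \<circ> u \<in> affine_sym n" using a assms(1) by (simp add: simple_refl_comp_affine_iff)
    have sw': "?s \<circ> w = (?s \<circ> u) \<circ> v" using a by (simp add: comp_assoc)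
    have lu: "Suc (len n (?s \<circ> u)) = len n u" using len_simple_refl[OF assms(1) i a(1)] uv(2) by simp
    have le: "len n (?s \<circ> w) \<le> len n (?s \<circ> u) + len n v" unfolding sw' by (rule len_comp_le[OF assms(1) su a(2)])
    then have lt: "len n (?s \<circ> w) < len n w" using lu a(4) by simp
    then show d: "is_desc n i w" using len_less_iff[OF assms(1) i] by simp
    have "Suc (len n (?s \<circ> w)) = len n w" using len_simple_refl[OF assms(1) i Cons.prems(2)] d by simp
    then show "(?s \<circ> u, v) \<in> factorizations n (?s \<circ> w)" using a su lu sw' by (auto simp: factorizations_def)
  qed
  \<comment> \<open>Conversely, prepending the letter must lengthen the first factor, since
    otherwise subadditivity would make \<open>w\<close> too short.\<close>
  have bw: "(?s \<circ> u, v) \<in> factorizations n w \<and> is_desc n i (?s \<circ> u)" if uv: "(u, v) \<in> factorizations n (?s \<circ> w)" "is_desc n i w" for u v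
  proof -
    have a: "u \<in> affine_sym n" "v \<in> affine_sym n" "u \<circ> v = ?s \<circ> w" "len n u + len n v = len n (?s \<circ> w)" using uv(1) by (auto simp: factorizations_def)
    have su: "?s \<circ> u \<in> affine_sym n" using a assms(1) by (simp add: simple_refl_comp_affine_iff)
    have w: "(?s \<circ> u) \<circ> v = w" using a(3) invol[of i w] by (simp add: comp_assoc)
    have lw: "Suc (len n (?s \<circ> w)) = len n w" using len_simple_refl[OF assms(1) i Cons.prems(2)] uv(2) by simp
    have "len n w \<le> len n (?s \<circ> u) + len n v" using len_comp_le[OF assms(1) su a(2)] w by simp
    then have "len n u < len n (?s \<circ> u)" using lw a(4) by simp
    then have d: "is_desc n i (?s \<circ> u)" using len_less_iff[OF assms(1) i, of "?s \<circ> u"] by (simp add: invol)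
    then have "len n (?s \<circ> u) = Suc (len n u)" using len_simple_refl[OF assms(1) i su] by (simp add: invol)
    then show ?thesis using d w su a lw by (auto simp: factorizations_def)
  qed
  show ?case
  proof (cases "is_desc n i w")
    case True
    have "lookup (word_act n (i # is) Y) w = (\<Sum>(u, v)\<in>factorizations n (?s \<circ> w).
        lookup (word_act n is ?\<delta>) u * lookup Y v)"
      unfolding lk if_P[OF True] by (rule Cons.IH[OF _ sw]) (use Cons.prems in simp)
    also have "\<dots> = (\<Sum>(u, v)\<in>{(u, v)\<in>factorizations n w. is_desc n i u}.
       lookup (word_act n is ?\<delta>) (?s \<circ> u) * lookup Y v)"
      by (rule sum.reindex_bij_witness[of _ "\<lambda>(u, v). (?s \<circ> u, v)" "\<lambda>(u, v). (?s \<circ> u, v)"])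
         (use fw bw True in \<open>auto simp: invol simp del: o_apply\<close>)
    finally show ?thesis unfolding rhs .
  next
    case False
    then have "{(u, v)\<in>factorizations n w. is_desc n i u} = {}" using fw by blast
    then have "(\<Sum>(u, v)\<in>factorizations n w. lookup (word_act n (i # is) ?\<delta>) u * lookup Y v) = 0"
      unfolding rhs by (simp only: sum.empty)
    moreover have "lookup (word_act n (i # is) Y) w = 0" unfolding lk if_not_P[OF False] ..
    ultimately show ?thesis by metis
  qed
qed

lemma lookup_act_free_factorizations:
  assumes "2 \<le> n" "a \<in> carrier (free_alg n)" "w \<in> affine_sym n"
  shows "lookup (act_free n a Y) w = (\<Sum>(u, v)\<in>factorizations n w.
     lookup (act_free n a (single id 1)) u * lookup Y v)"
proof -
  have "set is \<subseteq> {..<n}" if "is \<in> keys a" for "is"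
    using assms(2) that by (auto simp: free_alg_def lists_eq_set)
  then have "lookup (act_free n a Y) w = (\<Sum>is\<in>keys a. lookup a is *
     (\<Sum>(u, v)\<in>factorizations n w. lookup (word_act n is (single id 1)) u * lookup Y v))"
    unfolding lookup_act_free by (intro sum.cong refl) (simp add: lookup_word_act_factorizations[OF assms(1) _ assms(3), of _ Y])
  also have "\<dots> = (\<Sum>is\<in>keys a. \<Sum>(u, v)\<in>factorizations n w. lookup a is *
     lookup (word_act n is (single id 1)) u * lookup Y v)"
    by (simp add: sum_distrib_left case_prod_unfold mult.assoc)
  also have "\<dots> = (\<Sum>(u, v)\<in>factorizations n w. \<Sum>is\<in>keys a. lookup a is *
     lookup (word_act n is (single id 1)) u * lookup Y v)"
    by (subst sum.swap) (simp add: case_prod_unfold)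
  finally show ?thesis by (simp add: lookup_act_free sum_distrib_right case_prod_unfold)
qed


section \<open>The affine nilCoxeter algebra\<close>

lemma free_alg_simps [simp]:
  "monoid.mult (free_alg n) = (*)" "ring.add (free_alg n) = (+)" "one (free_alg n) = 1" "zero (free_alg n) = 0"
  by (simp_all add: free_alg_def)

lemma free_alg_carrier: "a \<in> carrier (free_alg n) \<longleftrightarrow> keys a \<subseteq> lists {..<n}"
  by (simp add: free_alg_def)

lemma ring_free_alg: "ring (free_alg n)"
proof (rule ringI)
  show "abelian_group (free_alg n)"
  proof (rule abelian_groupI)
    fix x assume "x \<in> carrier (free_alg n)"
    then have "- x \<in> carrier (free_alg n)" by (simp add: free_alg_carrier Poly_Mapping.keys_def)
    then show "\<exists>y\<in>carrier (free_alg n). y \<oplus>\<^bsub>free_alg n\<^esub> x = \<zero>\<^bsub>free_alg n\<^esub>" by (intro bexI[of _ "- x"]) auto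
  qed (use Poly_Mapping.keys_add in \<open>fastforce simp: free_alg_carrier algebra_simps\<close>)+
  show "Group.monoid (free_alg n)"
  proof (rule monoidI)
    fix x y assume "x \<in> carrier (free_alg n)" "y \<in> carrier (free_alg n)"
    then show "x \<otimes>\<^bsub>free_alg n\<^esub> y \<in> carrier (free_alg n)"
      using keys_mult[of x y] by (fastforce simp: free_alg_carrier plus_list_def)
  qed (auto simp: free_alg_carrier zero_list_def mult.assoc)
qed (auto simp: algebra_simps)

lemma gen_carrier: "i < n \<Longrightarrow> gen i \<in> carrier (free_alg n)"
  by (simp add: free_alg_carrier gen_def)

lemma single_carrier: "set is \<subseteq> {..<n} \<Longrightarrow> single is c \<in> carrier (free_alg n)"
  by (auto simp: free_alg_carrier)

lemma diff_carrier:
  assumes "a \<in> carrier (free_alg n)" "b \<in> carrier (free_alg n)"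
  shows "a - b \<in> carrier (free_alg n)"
  using keys_diff[of a b] assms by (auto simp: free_alg_carrier)

lemma gen_mult: "gen i * gen j = single [i, j] 1" "single [i, j] 1 * gen k = single [i, j, k] 1"
  by (simp_all add: gen_def mult_single plus_list_def)

lemma nil_rels_carrier: "nil_rels n \<subseteq> carrier (free_alg n)"
  unfolding nil_rels_def by (auto simp: gen_mult intro!: single_carrier diff_carrier)

lemma ideal_nil_ideal: "ideal (nil_ideal n) (free_alg n)"
  unfolding nil_ideal_def by (rule ring.genideal_ideal[OF ring_free_alg nil_rels_carrier])

text \<open>The annihilator of a module is a two-sided ideal, so that checking the defining
  relations settles the whole of \<open>nil_ideal n\<close>.\<close>

lemma ideal_annihilator:
  assumes "2 \<le> n"
  shows "ideal {a \<in> carrier (free_alg n). \<forall>X. act_free n a X = 0} (free_alg n)" (is "ideal ?K _")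
proof -
  interpret ring "free_alg n" by (rule ring_free_alg)
  show ?thesis
  proof (rule idealI[OF ring_free_alg])
    show "subgroup ?K (add_monoid (free_alg n))"
    proof (rule add.subgroupI)
      fix a assume a: "a \<in> ?K"
      have ac: "a \<in> carrier (free_alg n)" using a by simp
      have "- a \<in> carrier (free_alg n)" using diff_carrier[of 0 n a] ac zero_closed by simp
      then have "\<ominus>\<^bsub>free_alg n\<^esub> a = - a" using minus_equality[of "- a" a] ac by simp
      then show "\<ominus>\<^bsub>free_alg n\<^esub> a \<in> ?K" using a \<open>- a \<in> carrier (free_alg n)\<close> by (simp add: act_free_uminus)
    next
      fix a b assume "a \<in> ?K" "b \<in> ?K"
      then show "a \<oplus>\<^bsub>free_alg n\<^esub> b \<in> ?K" using add.m_closed[of a b] by (simp add: act_free_add)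
    qed (use zero_closed in auto)
  next
    fix a x assume "a \<in> ?K" "x \<in> carrier (free_alg n)"
    then show "x \<otimes>\<^bsub>free_alg n\<^esub> a \<in> ?K" "a \<otimes>\<^bsub>free_alg n\<^esub> x \<in> ?K"
      using m_closed[of a x] m_closed[of x a] by (simp_all add: act_free_mult[OF assms] act_free_zero_right[OF assms])
  qed
qed

lemma act_nil_ideal:
  assumes "3 \<le> n" "a \<in> nil_ideal n"
  shows "act_free n a X = 0"
proof -
  have n2: "2 \<le> n" using assms by simp
  have "nil_rels n \<subseteq> {a \<in> carrier (free_alg n). \<forall>X. act_free n a X = 0}"
  proof
    fix a assume a: "a \<in> nil_rels n"
    have "act_free n a X = 0" for X
      using a unfolding nil_rels_def gen_mult
      using word_act_nil[OF n2] word_act_braid[OF assms(1)] word_act_commute[OF assms(1)]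
      by (auto simp: act_free_single act_free_diff simp del: foldr.simps)
    then show "a \<in> {a \<in> carrier (free_alg n). \<forall>X. act_free n a X = 0}" using a nil_rels_carrier by blast
  qed
  then have "nil_ideal n \<subseteq> {a \<in> carrier (free_alg n). \<forall>X. act_free n a X = 0}"
    unfolding nil_ideal_def by (rule ring.genideal_minimal[OF ring_free_alg ideal_annihilator[OF n2]])
  then show ?thesis using assms(2) by blast
qed

section \<open>From the free algebra to the quotient\<close>

definition U_proj :: "nat \<Rightarrow> word_alg \<Rightarrow> word_alg set" where
  "U_proj n a = nil_ideal n +>\<^bsub>free_alg n\<^esub> a"

lemma U_proj_hom: "U_proj n \<in> ring_hom (free_alg n) (U_alg n)"
  unfolding U_alg_def using ideal.rcos_ring_hom[OF ideal_nil_ideal] by (simp add: U_proj_def[abs_def])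

lemma ring_U_alg: "ring (U_alg n)"
  unfolding U_alg_def by (rule ideal.quotient_is_ring[OF ideal_nil_ideal])

text \<open>The choice in \<open>act\<close> picks some element of the coset; it differs from
  \<open>a\<close> by an element of the ideal, which acts as zero.\<close>

lemma act_U_proj:
  assumes "3 \<le> n" "a \<in> carrier (free_alg n)"
  shows "act n (U_proj n a) X = act_free n a X"
proof -
  interpret ideal "nil_ideal n" "free_alg n" by (rule ideal_nil_ideal)
  have "a \<in> U_proj n a" unfolding U_proj_def a_r_coset_def' using additive_subgroup.zero_closed[OF is_additive_subgroup] by force
  then have "(SOME b. b \<in> U_proj n a) \<in> U_proj n a" by (rule someI)
  then obtain h where "h \<in> nil_ideal n" "(SOME b. b \<in> U_proj n a) = h + a" unfolding U_proj_def a_r_coset_def' by auto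
  then show ?thesis by (simp add: act_def act_free_add act_nil_ideal[OF assms(1)])
qed

lemma U_prod_U_proj:
  assumes "set as \<subseteq> carrier (free_alg n)"
  shows "U_prod n (map (U_proj n) as) = U_proj n (foldr (*) as 1) \<and> foldr (*) as 1 \<in> carrier (free_alg n)"
  using assms
proof (induction as)
  case Nil
  show ?case using ring_hom_one[OF U_proj_hom, of n] ring.ring_simprules(6)[OF ring_free_alg, of n] by (simp add: U_prod_def)
next
  case (Cons a as)
  then show ?case using ring_hom_mult[OF U_proj_hom, of a n "foldr (*) as 1"] ring.ring_simprules(5)[OF ring_free_alg, of a n "foldr (*) as 1"]
    by (simp add: U_prod_def)
qed

lemma finsum_U_proj:
  assumes "finite S" "\<And>s. s \<in> S \<Longrightarrow> f s \<in> carrier (free_alg n)"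
  shows "finsum (U_alg n) (\<lambda>s. U_proj n (f s)) S = U_proj n (\<Sum>s\<in>S. f s) \<and> (\<Sum>s\<in>S. f s) \<in> carrier (free_alg n)"
  using assms
proof (induction S rule: finite_induct)
  case empty
  interpret ring "U_alg n" by (rule ring_U_alg)
  show ?case using ring_hom_zero[OF U_proj_hom ring_free_alg ring_U_alg, of n] ring.ring_simprules(2)[OF ring_free_alg, of n] by simp
next
  case (insert s S)
  interpret ring "U_alg n" by (rule ring_U_alg)
  show ?case using insert ring_hom_closed[OF U_proj_hom, of _ n]
     ring_hom_add[OF U_proj_hom, of "f s" n "\<Sum>s\<in>S. f s"] ring.ring_simprules(1)[OF ring_free_alg, of "f s" n "\<Sum>s\<in>S. f s"]
    by (simp add: finsum_insert Pi_def)
qed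

section \<open>Cyclically ordered words and the operators h_k\<close>

lemma admissible_Nil [simp]: "admissible_order n A [] \<longleftrightarrow> A = {}"
  by (auto simp: admissible_order_def)

text \<open>An admissible word may start with any index of the set whose successor is missing from
  it. This recursion carries the inductions on words, whichever admissible order has been
  chosen.\<close>

lemma admissible_Cons:
  assumes "2 \<le> n" "a < n"
  shows "admissible_order n A (a # xs) \<longleftrightarrow> a \<in> A \<and> (a + 1) mod n \<notin> A \<and> admissible_order n (A - {a}) xs" (is "?L \<longleftrightarrow> ?R")
proof -
  have ne: "(a + 1) mod n \<noteq> a" using assms by (cases "Suc a = n") auto
  show ?thesis
  proof
    assume L: ?L
    then have d: "distinct (a # xs)" "insert a (set xs) = A"
      and o: "\<And>p q. p < length (a # xs) \<Longrightarrow> q < length (a # xs) \<Longrightarrow> (a # xs) ! p = ((a # xs) ! q + 1) mod n \<Longrightarrow> p < q"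
      unfolding admissible_order_def list.set by blast+
    have "(a + 1) mod n \<notin> A"
    proof
      assume "(a + 1) mod n \<in> A"
      then obtain p where "p < length (a # xs)" "(a # xs) ! p = (a + 1) mod n" using d(2) by (metis in_set_conv_nth list.simps(15))
      then show False using o[of p 0] by simp
    qed
    moreover have "admissible_order n (A - {a}) xs" unfolding admissible_order_def
    proof (intro conjI allI impI)
      fix p q assume "p < length xs" "q < length xs" "xs ! p = (xs ! q + 1) mod n"
      then show "p < q" using o[of "Suc p" "Suc q"] by simp
    qed (use d in auto)
    ultimately show ?R using d by auto
  next
    assume R: ?R
    then have d: "distinct xs" "set xs = A - {a}"
      and o: "\<And>p q. p < length xs \<Longrightarrow> q < length xs \<Longrightarrow> xs ! p = (xs ! q + 1) mod n \<Longrightarrow> p < q"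
      unfolding admissible_order_def by blast+
    show ?L unfolding admissible_order_def
    proof (intro conjI allI impI)
      fix p q assume pq: "p < length (a # xs)" "q < length (a # xs)" "(a # xs) ! p = ((a # xs) ! q + 1) mod n"
      have mem: "(a # xs) ! p \<in> A" using pq(1) d R by (metis insert_Diff nth_mem list.simps(15))
      have q: "q \<noteq> 0"
      proof
        assume "q = 0"
        then show False using mem pq(3) R by simp
      qed
      show "p < q"
      proof (cases p)
        case (Suc p')
        then show ?thesis using q pq o[of p' "q - 1"] by (cases q) auto
      qed (use q in simp)
    qed (use d R in auto)
  qed
qed

lemma admissible_exists:
  assumes "2 \<le> n" "A \<subset> {..<n}"
  shows "\<exists>xs. admissible_order n A xs"
  using assms(2)
proof (induction "card A" arbitrary: A)
  case 0
  then have "A = {}" using finite_subset[of A "{..<n}"] by auto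
  then show ?case by (intro exI[of _ "[]"]) simp
next
  case (Suc k)
  have fin: "finite A" using Suc.prems finite_subset[of A "{..<n}"] by auto
  \<comment> \<open>Otherwise \<open>A\<close> is closed under the successor modulo n and contains
    every residue.\<close>
  have "\<exists>a\<in>A. (a + 1) mod n \<notin> A"
  proof (rule ccontr)
    assume "\<not> ?thesis"
    then have cl: "(a + 1) mod n \<in> A" if "a \<in> A" for a using that by blast
    obtain a where a: "a \<in> A" using Suc.hyps(2) by fastforce
    have all: "(a + k) mod n \<in> A" for k
    proof (induction k)
      case 0 then show ?case using a Suc.prems by (metis add_0_right lessThan_iff mod_less psubsetE subset_iff)
    next
      case (Suc k) then show ?case using cl[OF Suc] by (simp add: mod_Suc_eq)
    qed
    have "b \<in> A" if "b < n" for b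
      using all[of "n - a + b"] that a Suc.prems by auto
    then show False using Suc.prems by auto
  qed
  then obtain a where a: "a \<in> A" "(a + 1) mod n \<notin> A" by blast
  have "k = card (A - {a})" using Suc.hyps(2) a fin by simp
  moreover have "A - {a} \<subset> {..<n}" using Suc.prems by auto
  ultimately obtain xs where "admissible_order n (A - {a}) xs" using Suc.hyps(1) by blast
  then have "admissible_order n A (a # xs)" using admissible_Cons[OF assms(1), of a A xs] a Suc.prems by auto
  then show ?case by blast
qed

text \<open>The same choice that \<open>u_set\<close> makes, named so that the word itself can be
  handled.\<close>

definition cyc_order :: "nat \<Rightarrow> nat set \<Rightarrow> nat list" where
  "cyc_order n A = (SOME xs. admissible_order n A xs)"

lemma admissible_cyc_order:
  assumes "2 \<le> n" "A \<subset> {..<n}"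
  shows "admissible_order n A (cyc_order n A)"
  unfolding cyc_order_def using someI_ex[OF admissible_exists[OF assms]] .

lemma set_cyc_order:
  assumes "2 \<le> n" "A \<subset> {..<n}"
  shows "set (cyc_order n A) = A"
  using admissible_cyc_order[OF assms] by (simp add: admissible_order_def)

definition h_rep :: "nat \<Rightarrow> nat \<Rightarrow> word_alg" where
  "h_rep n k = (\<Sum>A\<in>{A. A \<subset> {..<n} \<and> card A = k}. single (cyc_order n A) 1)"

definition h_act :: "nat \<Rightarrow> nat \<Rightarrow> group_alg \<Rightarrow> group_alg" where
  "h_act n k X = (\<Sum>A\<in>{A. A \<subset> {..<n} \<and> card A = k}. word_act n (cyc_order n A) X)"

lemma finite_proper_subsets: "finite {A. A \<subset> {..<n::nat} \<and> card A = k}" "finite {A. A \<subset> {..<n::nat}}"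
  by (auto intro: finite_subset[of _ "Pow {..<n}"])

lemma foldr_mult_gen: "foldr (*) (map gen xs) 1 = single xs 1"
proof (induction xs)
  case Nil
  show ?case using single_one[where ?'a = "nat list" and ?'b = complex] unfolding zero_list_def by simp
qed (simp add: gen_def mult_single plus_list_def)

lemma h_u_eq:
  assumes "2 \<le> n"
  shows "h_u n k = U_proj n (h_rep n k)" "h_rep n k \<in> carrier (free_alg n)"
proof -
  have u: "u_set n A = U_proj n (single (cyc_order n A) 1)"
    "single (cyc_order n A) 1 \<in> carrier (free_alg n)" if "A \<subset> {..<n}" for A
  proof -
    have s: "set (cyc_order n A) \<subseteq> {..<n}" using set_cyc_order[OF assms that] that by auto
    then show "single (cyc_order n A) 1 \<in> carrier (free_alg n)" by (rule single_carrier)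
    have "set (map gen (cyc_order n A)) \<subseteq> carrier (free_alg n)" using s gen_carrier by auto
    from U_prod_U_proj[OF this] show "u_set n A = U_proj n (single (cyc_order n A) 1)"
      by (simp add: u_set_def cyc_order_def foldr_mult_gen comp_def U_gen_def[abs_def] U_proj_def[abs_def])
  qed
  interpret ring "U_alg n" by (rule ring_U_alg)
  have "h_u n k = finsum (U_alg n) (\<lambda>A. U_proj n (single (cyc_order n A) 1)) {A. A \<subset> {..<n} \<and> card A = k}"
    unfolding h_u_def by (rule finsum_cong') (use u ring_hom_closed[OF U_proj_hom] in auto)
  then show "h_u n k = U_proj n (h_rep n k)" "h_rep n k \<in> carrier (free_alg n)"
    using finsum_U_proj[OF finite_proper_subsets(1), of n k "\<lambda>A. single (cyc_order n A) 1" n] u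
    by (auto simp: h_rep_def)
qed

lemma act_free_h_rep: "act_free n (h_rep n k) X = h_act n k X"
  by (simp add: h_rep_def h_act_def act_free_sum act_free_single)

text \<open>The head of the list acts first: the list follows the order of the variables, while the
  product in the algebra carries it reversed.\<close>

definition h_prod :: "nat \<Rightarrow> nat list \<Rightarrow> group_alg \<Rightarrow> group_alg" where
  "h_prod n ks X = fold (h_act n) ks X"

lemma h_prod_rep:
  assumes "2 \<le> n"
  shows "act_free n (foldr (*) (map (h_rep n) (rev ks)) 1) X = h_prod n ks X"
  by (induction ks rule: rev_induct)
     (simp_all add: h_prod_def act_free_mult[OF assms] act_free_h_rep)

lemma h_prod_carrier:
  assumes "2 \<le> n"
  shows "foldr (*) (map (h_rep n) (rev ks)) 1 \<in> carrier (free_alg n)"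
  using U_prod_U_proj[of "map (h_rep n) (rev ks)" n] h_u_eq(2)[OF assms] by auto

lemma affine_stanley_h_prod:
  assumes "3 \<le> n"
  shows "affine_stanley n w m = lookup
    (h_prod n (map (lookup m) [0..<degree m]) (single id 1)) w"
proof -
  have n2: "2 \<le> n" using assms by simp
  let ?ks = "map (lookup m) [0..<degree m]"
  have "map (\<lambda>k. h_u n (lookup m k)) (rev [0..<degree m]) = map (U_proj n) (map (h_rep n) (rev ?ks))"
    by (simp add: h_u_eq(1)[OF n2] rev_map comp_def)
  moreover have "set (map (h_rep n) (rev ?ks)) \<subseteq> carrier (free_alg n)" using h_u_eq(2)[OF n2] by auto
  ultimately show ?thesis
    unfolding affine_stanley_def
    using U_prod_U_proj[of "map (h_rep n) (rev ?ks)" n] act_U_proj[OF assms h_prod_carrier[OF n2, of ?ks]] h_prod_rep[OF n2, of ?ks]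
    by simp
qed

text \<open>The entries of \<open>ys\<close> act after those of \<open>xs\<close> and so produce the
  left factor \<open>u\<close>; this decides which alphabet goes with which factor in the
  coproduct.\<close>

lemma h_prod_append_factorizations:
  assumes "2 \<le> n" "w \<in> affine_sym n"
  shows "lookup (h_prod n (xs @ ys) (single id 1)) w = (\<Sum>(u, v)\<in>factorizations n w.
     lookup (h_prod n ys (single id 1)) u * lookup (h_prod n xs (single id 1)) v)"
proof -
  have "h_prod n (xs @ ys) X = h_prod n ys (h_prod n xs X)" for X by (simp add: h_prod_def)
  then show ?thesis
    using lookup_act_free_factorizations[OF assms(1) h_prod_carrier[OF assms(1), of ys] assms(2)] h_prod_rep[OF assms(1)] by simp
qed

lemma h_act_0:
  assumes "2 \<le> n" shows "h_act n 0 X = X"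
proof -
  have "{} \<noteq> {..<n}" using assms lessThan_empty_iff[of n] by (metis bot_nat_0.not_eq_extremum not_numeral_le_zero)
  then have "{} \<subset> {..<n}" by blast
  then have *: "{A. A \<subset> {..<n} \<and> card A = 0} = {{}}" using finite_subset[of _ "{..<n}"] by (auto simp: card_eq_0_iff)
  then show ?thesis unfolding h_act_def * using set_cyc_order[OF assms \<open>{} \<subset> {..<n}\<close>] by simp
qed

lemma h_act_1:
  assumes "2 \<le> n" shows "h_act n 1 X = (\<Sum>i<n. act_gen n i X)"
proof -
  have *: "{A. A \<subset> {..<n} \<and> card A = 1} = (\<lambda>i. {i}) ` {..<n}"
  proof -
    have "{i} \<noteq> {..<n}" for i
    proof
      assume "{i} = {..<n}"
      then have "card {..<n} = 1" by (metis card_1_singleton_iff One_nat_def)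
      then show False using assms by simp
    qed
    then show ?thesis by (auto simp: card_1_singleton_iff psubset_eq)
  qed
  have "cyc_order n {i} = [i]" if "i < n" for i
  proof -
    have "{i} \<subset> {..<n}" using * that by blast
    then have "distinct (cyc_order n {i})" "set (cyc_order n {i}) = {i}" using admissible_cyc_order[OF assms] by (auto simp: admissible_order_def)
    moreover from this have "length (cyc_order n {i}) = 1" using distinct_card by fastforce
    then obtain x where "cyc_order n {i} = [x]" by (auto simp: length_Suc_conv)
    ultimately show ?thesis by simp
  qed
  then show ?thesis unfolding h_act_def * by (subst sum.reindex) (auto simp: inj_on_def)
qed

section \<open>Commutation of the complete homogeneous elements\<close>

text \<open>A line carries the value \<open>c\<close> past the values of the list, weight \<open>x\<close> for each value it passes;
  it may only pass larger values, and at each site it can be exchanged for the value met there.\<close>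

fun line :: "complex \<Rightarrow> int list \<Rightarrow> int \<Rightarrow> (int list \<Rightarrow> int \<Rightarrow> complex) \<Rightarrow> complex" where
  "line x [] c G = G [] c"
| "line x (q # qs) c G = line x qs q (\<lambda>os. G (c # os)) + (if c < q then x * line x qs c (\<lambda>os. G (q # os)) else 0)"

text \<open>Rows are handled through continuations, which receive the emitted row and the values
  left on the lines. The line with weight \<open>x\<close> and value \<open>c\<close> runs first;
  the line with weight \<open>y\<close> and value \<open>d\<close> reads the row that the first one
  emits.\<close>

definition two_lines :: "complex \<Rightarrow> complex \<Rightarrow> int list \<Rightarrow> int \<Rightarrow> int \<Rightarrow> (int list \<Rightarrow> int \<Rightarrow> int \<Rightarrow> complex) \<Rightarrow> complex" where
  "two_lines x y qs d c G = line x qs c (\<lambda>os c'. line y os d (\<lambda>os' d'. G os' d' c'))"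

text \<open>The operator 1 + z T, where T exchanges the first two arguments if they increase and
  gives 0 otherwise. So T T = 0, and T is a nilCoxeter generator acting on functions of three
  values.\<close>

definition swap01 :: "complex \<Rightarrow> (int \<Rightarrow> int \<Rightarrow> int \<Rightarrow> complex) \<Rightarrow> int \<Rightarrow> int \<Rightarrow> int \<Rightarrow> complex" where
  "swap01 z K a b c = K a b c + (if a < b then z * K b a c else 0)"

definition swap12 :: "complex \<Rightarrow> (int \<Rightarrow> int \<Rightarrow> int \<Rightarrow> complex) \<Rightarrow> int \<Rightarrow> int \<Rightarrow> int \<Rightarrow> complex" where
  "swap12 z K a b c = K a b c + (if b < c then z * K a c b else 0)"

text \<open>The Yang-Baxter equation with additive parameters for the factors 1 + z T; here it is a
  case check on the order of \<open>a\<close>, \<open>b\<close>, \<open>c\<close>.\<close>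

lemma yang_baxter: "swap01 z (swap12 (y + z) (swap01 y K)) a b c = swap12 y (swap01 (y + z) (swap12 z K)) a b c"
  unfolding swap01_def swap12_def by (auto simp: algebra_simps)

lemma line_add: "line x qs c (\<lambda>os c'. G os c' + z * H os c') = line x qs c G + z * line x qs c H"
  by (induction qs arbitrary: c G H) (auto simp: algebra_simps)

lemma line_zero: "line x qs c (\<lambda>os c'. 0) = 0"
  by (induction qs arbitrary: c) auto

lemma line_sum: "line x qs c (\<lambda>os c'. \<Sum>d\<in>D. G d os c') = (\<Sum>d\<in>D. line x qs c (G d))"
proof (induction D rule: infinite_finite_induct)
  case (insert d D)
  then show ?case using line_add[of x qs c "G d" 1 "\<lambda>os c'. \<Sum>d\<in>D. G d os c'"] by simp
qed (auto simp: line_zero)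

lemma two_lines_Nil: "two_lines x y [] d c G = G [] d c"
  by (simp add: two_lines_def)

text \<open>On the triple (d, c, q) of one site the first line acts on the last two entries, the
  second on the first two. Of the resulting triple the first entry is emitted and the other two
  travel on.\<close>

lemma two_lines_Cons:
  "two_lines x y (q # qs) d c G = swap12 x (swap01 y (\<lambda>e d' c'. two_lines x y qs d' c' (\<lambda>os. G (e # os)))) d c q"
proof -
  have "line x qs c0 (\<lambda>os c'. line y (e # os) d (\<lambda>os' d'. G os' d' c')) =
     line x qs c0 (\<lambda>os c'. line y os e (\<lambda>os' d'. G (d # os') d' c')) +
      (if d < e then y * line x qs c0 (\<lambda>os c'. line y os d (\<lambda>os' d'. G (e # os') d' c')) else 0)" for c0 e
  proof (cases "d < e")
    case True
    then show ?thesis using line_add[of x qs c0 "\<lambda>os c'. line y os e (\<lambda>os' d'. G (d # os') d' c')" y] by simp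
  qed simp
  then show ?thesis unfolding two_lines_def swap12_def swap01_def by (auto simp: algebra_simps)
qed

lemma two_lines_add:
  "two_lines x y qs d c (\<lambda>os d' c'. G os d' c' + z * H os d' c') = two_lines x y qs d c G + z * two_lines x y qs d c H"
  unfolding two_lines_def line_add ..

text \<open>The exchange 1 + z T of the two carried values, with z the difference of the weights,
  enters on one side of the row and is moved through one site at a time by the Yang-Baxter
  equation.\<close>

lemma two_lines_exchange:
  "two_lines (y + z) y qs d c G + (if d < c then z * two_lines (y + z) y qs c d G else 0)
   = two_lines y (y + z) qs d c (\<lambda>os d' c'. G os d' c' + (if d' < c' then z * G os c' d' else 0))"
proof (induction qs arbitrary: d c G)
  case Nil
  show ?case by (simp add: two_lines_Nil)
next
  case (Cons q qs)
  define K where "K = (\<lambda>e d' c'. two_lines (y + z) y qs d' c' (\<lambda>os. G (e # os)))"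
  have IH: "(\<lambda>e d' c'. two_lines y (y + z) qs d' c' (\<lambda>os d' c'. G (e # os) d' c' + (if d' < c' then z * G (e # os) c' d' else 0)))
    = swap12 z K"
    unfolding Cons.IH[symmetric] K_def swap12_def by (simp add: fun_eq_iff)
  have "two_lines (y + z) y (q # qs) d c G + (if d < c then z * two_lines (y + z) y (q # qs) c d G else 0)
    = swap01 z (swap12 (y + z) (swap01 y K)) d c q"
    by (simp add: two_lines_Cons K_def swap01_def)
  also have "\<dots> = swap12 y (swap01 (y + z) (swap12 z K)) d c q" by (rule yang_baxter)
  finally show ?case by (simp add: two_lines_Cons IH)
qed

text \<open>The values have to return lowered by \<open>N\<close> because the sites will run
  downwards through one period of an inverse permutation. Both sums run over the same finite set
  \<open>C\<close>, which stands for all integers, so exchanging the two lines stays inside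
  it.\<close>

definition line_trace :: "int \<Rightarrow> int set \<Rightarrow> complex \<Rightarrow> complex \<Rightarrow> int list \<Rightarrow> (int list \<Rightarrow> complex) \<Rightarrow> complex" where
  "line_trace N C x y qs g =
     (\<Sum>d\<in>C. \<Sum>c\<in>C. two_lines x y qs d c (\<lambda>os d' c'. if d' = d - N \<and> c' = c - N then g os else 0))"

text \<open>Conjugating by the exchange of the two lines, whose inverse has the opposite parameter,
  does not change the trace.\<close>

lemma line_trace_commute:
  assumes "finite C"
  shows "line_trace N C x y qs g = line_trace N C y x qs g"
proof -
  define z where "z = x - y"
  have x: "x = y + z" by (simp add: z_def)
  define L where "L = two_lines x y qs"
  define M where "M = two_lines y x qs"
  define G where "G d c = (\<lambda>os d' c'. if d' = d - N \<and> c' = c - N then g os else 0)" for d c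
  define R where "R d c = (\<lambda>os d' c'. G d c os d' c' + (if d' < c' then z * G d c os c' d' else 0))" for d c
  have ex: "L d c (G d0 c0) + (if d < c then z * L c d (G d0 c0) else 0) = M d c (R d0 c0)" for d c d0 c0
    unfolding L_def M_def R_def x by (rule two_lines_exchange)
  have L: "L d c (G d0 c0) = M d c (R d0 c0) - (if d < c then z * M c d (R d0 c0) else 0)" for d c d0 c0
    using ex[of d c d0 c0] ex[of c d d0 c0] by (auto simp: eq_diff_eq)
  \<comment> \<open>Swapping the returned values amounts to swapping the prescribed ones; as both
    are lowered by the same \<open>N\<close>, the order test becomes \<open>c0 < d0\<close>.\<close>
  have MR: "M d c (R d0 c0) = M d c (G d0 c0) + (if c0 < d0 then z * M d c (G c0 d0) else 0)" for d c d0 c0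
  proof (cases "c0 < d0")
    case True
    then have "R d0 c0 = (\<lambda>os d' c'. G d0 c0 os d' c' + z * G c0 d0 os d' c')"
      by (auto simp: R_def G_def fun_eq_iff)
    then show ?thesis using True by (simp add: M_def two_lines_add)
  next
    case False
    then have "R d0 c0 = G d0 c0" by (auto simp: R_def G_def fun_eq_iff)
    then show ?thesis using False by simp
  qed
  have "line_trace N C x y qs g = (\<Sum>d\<in>C. \<Sum>c\<in>C. L d c (G d c))" by (simp add: line_trace_def L_def G_def)
  also have "\<dots> = (\<Sum>d\<in>C. \<Sum>c\<in>C. M d c (G d c)) + (\<Sum>d\<in>C. \<Sum>c\<in>C. if c < d then z * M d c (G c d) else 0)
     - (\<Sum>d\<in>C. \<Sum>c\<in>C. if d < c then z * M c d (G d c) else 0)"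
    unfolding sum.distrib[symmetric] sum_subtractf[symmetric] L MR by (intro sum.cong refl) auto
  also have "(\<Sum>d\<in>C. \<Sum>c\<in>C. if c < d then z * M d c (G c d) else 0) = (\<Sum>d\<in>C. \<Sum>c\<in>C. if d < c then z * M c d (G d c) else 0)"
    by (rule sum.swap)
  finally show ?thesis by (simp add: line_trace_def M_def G_def)
qed

section \<open>Expanding a line over the records of its exchanges\<close>

fun carry :: "bool list \<Rightarrow> int list \<Rightarrow> int \<Rightarrow> int" where
  "carry (b # bs) (q # qs) c = carry bs qs (if b then c else q)"
| "carry _ _ c = c"

fun outs :: "bool list \<Rightarrow> int list \<Rightarrow> int \<Rightarrow> int list" where
  "outs (b # bs) (q # qs) c = (if b then q else c) # outs bs qs (if b then c else q)"
| "outs _ _ c = []"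

fun legal :: "bool list \<Rightarrow> int list \<Rightarrow> int \<Rightarrow> bool" where
  "legal (b # bs) (q # qs) c \<longleftrightarrow> (b \<longrightarrow> c < q) \<and> legal bs qs (if b then c else q)"
| "legal _ _ c \<longleftrightarrow> True"

lemma finite_bool_lists: "finite {bs :: bool list. length bs = m}"
  using finite_lists_length_eq[of "UNIV :: bool set" m] by simp

text \<open>\<open>True\<close> in a record means that the carried value passes the site,
  \<open>False\<close> that it is exchanged there. The records will be the indicator lists of the
  subsets A, so that \<open>x\<close> counts the elements of A.\<close>

lemma line_expand:
  "line x qs c G = (\<Sum>bs\<in>{bs. length bs = length qs}.
     x ^ count_list bs True * (if legal bs qs c then G (outs bs qs c) (carry bs qs c) else 0))"
proof (induction qs arbitrary: c G)
  case Nil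
  have "{bs :: bool list. length bs = 0} = {[]}" by auto
  then show ?case by simp
next
  case (Cons q qs)
  let ?S = "{bs :: bool list. length bs = length qs}"
  have S: "{bs. length bs = length (q # qs)} = (#) False ` ?S \<union> (#) True ` ?S"
    by (auto simp: length_Suc_conv image_iff)
  have inj: "inj_on ((#) b) ?S" for b by (simp add: inj_on_def)
  let ?f = "\<lambda>bs. x ^ count_list bs True * (if legal bs (q # qs) c then G (outs bs (q # qs) c) (carry bs (q # qs) c) else 0)"
  have "line x (q # qs) c G = (\<Sum>bs\<in>?S. ?f (False # bs)) + (\<Sum>bs\<in>?S. ?f (True # bs))"
    by (cases "c < q") (simp_all add: Cons sum_distrib_left mult.assoc cong: if_cong)
  also have "\<dots> = sum ?f ((#) False ` ?S) + sum ?f ((#) True ` ?S)"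
    unfolding sum.reindex[OF inj] comp_def ..
  also have "\<dots> = sum ?f {bs. length bs = length (q # qs)}"
    unfolding S by (rule sum.union_disjoint[symmetric]) (auto simp: finite_bool_lists)
  finally show ?case .
qed

text \<open>After one exchange the line has forgotten its initial value. In the trace a record
  containing \<open>False\<close> therefore fits exactly one starting value, while by
  \<open>carry_True\<close> the record of passes only cannot return a lowered value; this is why the
  full set does not occur.\<close>

lemma carry_False:
  assumes "False \<in> set bs" "length bs = length qs"
  shows "carry bs qs c = carry bs qs c'"
  using assms(2,1) by (induction bs qs arbitrary: c c' rule: list_induct2) auto

lemma carry_True:
  assumes "False \<notin> set bs" "length bs = length qs"
  shows "carry bs qs c = c"
  using assms(2,1) by (induction bs qs rule: list_induct2) auto

text \<open>A solution \<open>\<kappa>\<close> of the carrying recursion on all integers describes a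
  line that starts with \<open>\<kappa> (s + 1)\<close> and moves down from position
  \<open>s\<close>. What is emitted at position j becomes the entry of \<open>p'\<close> at j + 1,
  so the output is the window one place higher.\<close>

lemma window_run:
  assumes "\<And>j. \<kappa> j = (if B j then \<kappa> (j + 1) else p j)" "\<And>j. p' (j + 1) = (if B j then p j else \<kappa> (j + 1))"
  shows "legal (map (\<lambda>i. B (s - int i)) [0..<m]) (map (\<lambda>i. p (s - int i)) [0..<m]) (\<kappa> (s + 1))
      \<longleftrightarrow> (\<forall>i<m. B (s - int i) \<longrightarrow> \<kappa> (s - int i + 1) < p (s - int i))"
    "outs (map (\<lambda>i. B (s - int i)) [0..<m]) (map (\<lambda>i. p (s - int i)) [0..<m]) (\<kappa> (s + 1)) = map (\<lambda>i. p' (s + 1 - int i)) [0..<m]"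
    "carry (map (\<lambda>i. B (s - int i)) [0..<m]) (map (\<lambda>i. p (s - int i)) [0..<m]) (\<kappa> (s + 1)) = \<kappa> (s + 1 - int m)"
proof (induction m arbitrary: s)
  case (Suc m)
  have map_Suc: "map (\<lambda>i. f (a - int i)) [0..<Suc m] = f a # map (\<lambda>i. f (a - 1 - int i)) [0..<m]" for f :: "int \<Rightarrow> 'b" and a
    by (simp add: upt_conv_Cons map_Suc_upt[symmetric] comp_def algebra_simps del: upt_Suc)
  have all_Suc: "(\<forall>i<Suc m. P i) \<longleftrightarrow> P 0 \<and> (\<forall>i<m. P (Suc i))" for P by (rule All_less_Suc2)
  have c: "(if B s then \<kappa> (s + 1) else p s) = \<kappa> (s - 1 + 1)" for s using assms(1)[of s] by simp
  { case 1
    have "legal (map (\<lambda>i. B (s - int i)) [0..<Suc m]) (map (\<lambda>i. p (s - int i)) [0..<Suc m]) (\<kappa> (s + 1)) \<longleftrightarrow>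
      (B s \<longrightarrow> \<kappa> (s + 1) < p s) \<and> legal (map (\<lambda>i. B (s - 1 - int i)) [0..<m]) (map (\<lambda>i. p (s - 1 - int i)) [0..<m]) (\<kappa> (s - 1 + 1))"
      by (simp only: map_Suc legal.simps c[symmetric])
    then show ?case unfolding Suc.IH(1) all_Suc by (simp add: algebra_simps) }
  { case 2
    have "outs (map (\<lambda>i. B (s - int i)) [0..<Suc m]) (map (\<lambda>i. p (s - int i)) [0..<Suc m]) (\<kappa> (s + 1)) =
      p' (s + 1) # outs (map (\<lambda>i. B (s - 1 - int i)) [0..<m]) (map (\<lambda>i. p (s - 1 - int i)) [0..<m]) (\<kappa> (s - 1 + 1))"
      by (simp only: map_Suc outs.simps c[symmetric] assms(2))
    then show ?case unfolding Suc.IH(2) map_Suc by (simp add: algebra_simps) }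
  { case 3
    have "carry (map (\<lambda>i. B (s - int i)) [0..<Suc m]) (map (\<lambda>i. p (s - int i)) [0..<Suc m]) (\<kappa> (s + 1)) =
      carry (map (\<lambda>i. B (s - 1 - int i)) [0..<m]) (map (\<lambda>i. p (s - 1 - int i)) [0..<m]) (\<kappa> (s - 1 + 1))"
      by (simp only: map_Suc carry.simps c[symmetric])
    then show ?case unfolding Suc.IH(3) by (simp add: algebra_simps) }
qed auto

text \<open>The product \<open>u\<^sub>A\<close> moves values leftwards in the window of \<open>w\<^sup>-\<^sup>1\<close>; \<open>\<kappa> j\<close> is the value
  that is carried into position \<open>j\<close>.\<close>

definition carries :: "nat \<Rightarrow> nat set \<Rightarrow> nat list \<Rightarrow> (int \<Rightarrow> int) \<Rightarrow> (int \<Rightarrow> int) \<Rightarrow> (int \<Rightarrow> int) \<Rightarrow> bool" where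
  "carries n A xs w \<kappa> w' \<longleftrightarrow> w' \<in> affine_sym n \<and> (\<forall>j. \<kappa> (j + int n) = \<kappa> j + int n) \<and>
     (\<forall>j. \<kappa> j = (if nat (j mod int n) \<in> A then \<kappa> (j + 1) else pinv w j)) \<and>
     (\<forall>j. pinv w' (j + 1) = (if nat (j mod int n) \<in> A then pinv w j else \<kappa> (j + 1))) \<and>
     (\<forall>X. lookup (word_act n xs X) w =
        (if \<forall>j. nat (j mod int n) \<in> A \<longrightarrow> \<kappa> (j + 1) < pinv w j then lookup X w' else 0))"

lemma word_act_admissible:
  assumes "2 \<le> n" "A \<subset> {..<n}" "admissible_order n A xs" "w \<in> affine_sym n"
  shows "\<exists>\<kappa> w'. carries n A xs w \<kappa> w'"
  using assms(2-4)
proof (induction xs arbitrary: A w)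
  case Nil
  then have "A = {}" by simp
  moreover have "pinv w (j + int n) = pinv w j + int n" for j
    using inv_periodic affine_symD[OF Nil(3)] by blast
  ultimately show ?case using Nil unfolding carries_def by (intro exI[of _ "pinv w"] exI[of _ w]) auto
next
  case (Cons a ys)
  have "a \<in> A" using Cons.prems(2) by (auto simp: admissible_order_def)
  then have an: "a < n" using Cons.prems(1) by auto
  have adm: "(a + 1) mod n \<notin> A" "admissible_order n (A - {a}) ys"
    using Cons.prems(2) admissible_Cons[OF assms(1) an] by auto
  let ?w1 = "simple_refl n a \<circ> w" and ?p = "pinv w"
  let ?J = "\<lambda>j. nat (j mod int n)"
  have w1: "?w1 \<in> affine_sym n" using Cons.prems(3) assms(1) by (simp add: simple_refl_comp_affine_iff)
  have p1: "pinv ?w1 j = ?p (simple_refl n a j)" for j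
    using inv_simple_refl_comp[OF assms(1) affine_symD(1)[OF Cons.prems(3)]] by simp
  obtain \<kappa>1 w' where IH: "w' \<in> affine_sym n" "\<And>j. \<kappa>1 (j + int n) = \<kappa>1 j + int n"
    "\<And>j. \<kappa>1 j = (if ?J j \<in> A - {a} then \<kappa>1 (j + 1) else pinv ?w1 j)"
    "\<And>j. pinv w' (j + 1) = (if ?J j \<in> A - {a} then pinv ?w1 j else \<kappa>1 (j + 1))"
    "\<And>X. lookup (word_act n ys X) ?w1 =
        (if \<forall>j. ?J j \<in> A - {a} \<longrightarrow> \<kappa>1 (j + 1) < pinv ?w1 j then lookup X w' else 0)"
    using Cons.IH[OF _ adm(2) w1] Cons.prems(1) unfolding carries_def by blast
  define hit where "hit j \<longleftrightarrow> int n dvd j - int a" for j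
  have hit_J: "hit j \<longleftrightarrow> ?J j = a" for j
  proof -
    have "hit j \<longleftrightarrow> j mod int n = int a" using an by (simp add: hit_def mod_eq_dvd_iff[symmetric])
    then show ?thesis using assms(1) by auto
  qed
  have at1: "\<not> hit (j + 1)" if "hit j" for j
  proof
    assume "hit (j + 1)"
    then have "int n dvd (j + 1 - int a) - (j - int a)" using that unfolding hit_def by (rule dvd_diff)
    then show False using assms(1) by simp
  qed
  have J1: "?J (j + 1) \<notin> A" if "hit j" for j
  proof -
    have "j mod int n = int a" using that hit_J[of j] assms(1) by auto
    then have "(j + 1) mod int n = (int a + 1) mod int n" by (metis mod_add_left_eq)
    then have "?J (j + 1) = (a + 1) mod n" by (metis nat_int of_nat_1 of_nat_add zmod_int)
    then show ?thesis using adm(1) by simp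
  qed
  have s: "simple_refl n a j = j + 1" "simple_refl n a (j + 1) = j" if "hit j" for j
    using simple_refl_eqs[OF _ assms(1)] that by (auto simp: hit_def)
  have s': "simple_refl n a j = j" if "\<not> hit j" "\<not> hit (j - 1)" for j
    using that by (intro simple_refl_other) (auto simp: hit_def algebra_simps)
  \<comment> \<open>Between \<open>?w1\<close> and \<open>w\<close> the carried value differs only
    at the class of a + 1. That index is missing from A, so for \<open>w\<close> the value
    \<open>?p j\<close> is picked up there, whereas in \<open>?w1\<close> this value sits one place
    lower.\<close>
  define \<kappa> where "\<kappa> j = (if hit (j - 1) then ?p j else \<kappa>1 j)" for j
  have per: "\<kappa> (j + int n) = \<kappa> j + int n" for j
  proof -
    have "hit (j + int n - 1) \<longleftrightarrow> hit (j - 1)" unfolding hit_def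
      by (metis (no_types, lifting) add.commute add_diff_eq diff_diff_eq2 dvd_add_triv_left_iff)
    then show ?thesis using IH(2)[of j] inv_periodic affine_symD[OF Cons.prems(3)] by (auto simp: \<kappa>_def)
  qed
  have cases: "hit j \<or> hit (j - 1) \<or> (\<not> hit j \<and> \<not> hit (j - 1))" for j by blast
  have at_m: "\<not> hit j" if "hit (j - 1)" for j using at1[OF that] by simp
  have J_m: "?J j \<notin> A" if "hit (j - 1)" for j using J1[OF that] by simp
  have rec: "\<kappa> j = (if ?J j \<in> A then \<kappa> (j + 1) else ?p j)" for j
  proof (cases "hit j")
    case True
    then have "\<not> hit (j - 1)" using at_m by blast
    then have "\<kappa> j = ?p (j + 1)" using IH(3)[of j] True hit_J[of j] by (simp add: \<kappa>_def p1 s)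
    then show ?thesis using True hit_J[of j] \<open>a \<in> A\<close> by (simp add: \<kappa>_def)
  next
    case False
    show ?thesis
    proof (cases "hit (j - 1)")
      case True
      then show ?thesis using J_m by (simp add: \<kappa>_def)
    next
      case F: False
      then have "\<kappa> j = (if ?J j \<in> A then \<kappa>1 (j + 1) else ?p j)" using IH(3)[of j] False hit_J[of j] by (simp add: \<kappa>_def p1 s')
      then show ?thesis using False by (simp add: \<kappa>_def)
    qed
  qed
  have out: "pinv w' (j + 1) = (if ?J j \<in> A then ?p j else \<kappa> (j + 1))" for j
  proof (cases "hit j")
    case True
    then have "pinv w' (j + 1) = \<kappa>1 (j + 1)" using IH(4)[of j] hit_J[of j] by simp
    also have "\<dots> = ?p j" using IH(3)[of "j + 1"] J1[OF True] by (simp add: p1 s(2)[OF True])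
    finally show ?thesis using True hit_J[of j] \<open>a \<in> A\<close> by simp
  next
    case False
    show ?thesis
    proof (cases "hit (j - 1)")
      case True
      then show ?thesis using IH(4)[of j] J_m[OF True] False by (simp add: \<kappa>_def)
    next
      case F: False
      then show ?thesis using IH(4)[of j] hit_J[of j] False by (simp add: \<kappa>_def p1 s')
    qed
  qed
  have desc: "is_desc n a w \<longleftrightarrow> ?p (j + 1) < ?p j" if "hit j" for j
    using is_desc_cong[OF assms(1), of a j w] that Cons.prems(3) by (simp add: hit_def mod_eq_dvd_iff dvd_diff_commute)
  have at_a: "hit (int a)" by (simp add: hit_def)
  \<comment> \<open>At the class of a the comparison is the descent test for the first letter; at
    every other class it is the comparison belonging to the shorter word.\<close>
  have ok: "(\<forall>j. ?J j \<in> A \<longrightarrow> \<kappa> (j + 1) < ?p j) \<longleftrightarrow> is_desc n a w \<and> (\<forall>j. ?J j \<in> A - {a} \<longrightarrow> \<kappa>1 (j + 1) < pinv ?w1 j)"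
  proof -
    have 1: "(?J j \<in> A \<longrightarrow> \<kappa> (j + 1) < ?p j) \<longleftrightarrow> is_desc n a w" if "hit j" for j
      using that desc[OF that] hit_J[of j] \<open>a \<in> A\<close> by (simp add: \<kappa>_def)
    have 2: "(?J j \<in> A \<longrightarrow> \<kappa> (j + 1) < ?p j) \<longleftrightarrow> (?J j \<in> A - {a} \<longrightarrow> \<kappa>1 (j + 1) < pinv ?w1 j)" if "\<not> hit j" for j
      using that hit_J[of j] J_m[of j] by (cases "hit (j - 1)") (auto simp: \<kappa>_def p1 s')
    show ?thesis using 1 2 at_a hit_J by (metis Diff_iff insertI1)
  qed
  have "lookup (word_act n (a # ys) X) w =
        (if \<forall>j. ?J j \<in> A \<longrightarrow> \<kappa> (j + 1) < ?p j then lookup X w' else 0)" for X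
    unfolding lookup_word_act_Cons[OF assms(1) an] IH(5) ok
    by (cases "is_desc n a w") (simp_all only: if_True if_False simp_thms)
  then show ?case using IH(1) per rec out unfolding carries_def by (intro exI[of _ \<kappa>] exI[of _ w']) blast
qed

abbreviation window :: "nat \<Rightarrow> int \<Rightarrow> (int \<Rightarrow> int) \<Rightarrow> int list" where
  "window n s w \<equiv> map (\<lambda>i. pinv w (s - int i)) [0..<n]"

text \<open>Allows the coefficients of a vector to be viewed as a function of rows, which is what a
  line acts on.\<close>

lemma window_inj:
  assumes "2 \<le> n" "v \<in> affine_sym n" "w \<in> affine_sym n" "window n s v = window n s w"
  shows "v = w"
proof -
  have eq: "pinv v (s - int i) = pinv w (s - int i)" if "i < n" for i
    using assms(4) that by (auto dest: map_eq_conv[THEN iffD1])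
  have per: "pinv u (k + int n * q) = pinv u k + int n * q" if "u \<in> affine_sym n" for u k q
    by (rule periodic_shift) (use inv_periodic affine_symD[OF that] in blast)
  have "pinv v k = pinv w k" for k
  proof -
    define i where "i = nat ((s - k) mod int n)"
    have i: "i < n" "int i = (s - k) mod int n" using assms(1) by (simp_all add: i_def nat_less_iff)
    have "k = s - int i + int n * (- ((s - k) div int n))"
      using mult_div_mod_eq[of "int n" "s - k"] i(2) by (simp add: algebra_simps)
    then show ?thesis using per[OF assms(2)] per[OF assms(3)] eq[OF i(1)] by metis
  qed
  then have "pinv v = pinv w" by blast
  then show ?thesis using affine_symD(1)[OF assms(2)] affine_symD(1)[OF assms(3)] by (metis inv_inv_eq)
qed

text \<open>\<open>K\<close> collects the starting values of the finitely many subsets and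
  \<open>W\<close> the permutations they reach. Neither depends on \<open>x\<close>,
  \<open>X\<close> or \<open>C\<close>, and \<open>X\<close> has to agree with \<open>g\<close> on
  \<open>W\<close> only. Thus a second line, whose own bound varies with the permutation, can be
  substituted for \<open>g\<close> with one common \<open>C\<close>.\<close>

lemma line_sum_subsets:
  assumes "2 \<le> n" "w \<in> affine_sym n"
  shows "\<exists>W K. finite W \<and> W \<subseteq> affine_sym n \<and> finite K \<and> (\<forall>x g X C. finite C \<longrightarrow> K \<subseteq> C \<longrightarrow>
     (\<forall>v\<in>W. lookup X v = g (window n (s + 1) v)) \<longrightarrow>
     (\<Sum>A\<in>{A. A \<subset> {..<n}}. x ^ card A * lookup (word_act n (cyc_order n A) X) w) =
     (\<Sum>c\<in>C. line x (window n s w) c (\<lambda>os c'. if c' = c - int n then g os else 0)))"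
proof -
  let ?P = "{A. A \<subset> {..<n}}"
  let ?J = "\<lambda>j. nat (j mod int n)"
  have "\<forall>A\<in>?P. \<exists>\<kappa> w'. carries n A (cyc_order n A) w \<kappa> w'"
    using word_act_admissible[OF assms(1) _ admissible_cyc_order[OF assms(1)] assms(2)] by blast
  then obtain \<kappa> W where f: "\<And>A. A \<in> ?P \<Longrightarrow> carries n A (cyc_order n A) w (\<kappa> A) (W A)"
    by metis
  have W: "W A \<in> affine_sym n" and per: "\<And>j. \<kappa> A (j + int n) = \<kappa> A j + int n"
    and rec: "\<And>j. \<kappa> A j = (if ?J j \<in> A then \<kappa> A (j + 1) else pinv w j)"
    and out: "\<And>j. pinv (W A) (j + 1) = (if ?J j \<in> A then pinv w j else \<kappa> A (j + 1))"
    and act: "\<And>X. lookup (word_act n (cyc_order n A) X) w =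
        (if \<forall>j. ?J j \<in> A \<longrightarrow> \<kappa> A (j + 1) < pinv w j then lookup X (W A) else 0)" if "A \<in> ?P" for A
    using f[OF that] unfolding carries_def by blast+
  have perp: "pinv w (k + int n * q) = pinv w k + int n * q" for k q
    by (rule periodic_shift) (use inv_periodic affine_symD[OF assms(2)] in blast)
  \<comment> \<open>\<open>r\<close> turns a site number, counted downwards from \<open>s\<close>,
    into an index modulo n, and is its own inverse below n.\<close>
  define r where "r i = ?J (s - int i)" for i
  have rn: "r i < n" for i using assms(1) by (simp add: r_def nat_less_iff)
  have rr: "r (r i) = i" if "i < n" for i
  proof -
    have "int (r i) = (s - int i) mod int n" using assms(1) by (simp add: r_def)
    then have "(s - int (r i)) mod int n = (s - (s - int i)) mod int n" by (metis mod_diff_right_eq)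
    then show ?thesis using that by (simp add: r_def)
  qed
  let ?qs = "window n s w"
  define bs where "bs A = map (\<lambda>i. ?J (s - int i) \<in> A) [0..<n]" for A
  let ?B = "{bs :: bool list. length bs = n}"
  show ?thesis
  proof (intro exI[of _ "W ` ?P"] exI[of _ "(\<lambda>A. \<kappa> A (s + 1)) ` ?P"] conjI allI impI)
    show "finite (W ` ?P)" "finite ((\<lambda>A. \<kappa> A (s + 1)) ` ?P)" by (simp_all add: finite_proper_subsets)
    show "W ` ?P \<subseteq> affine_sym n" using W by blast
    fix x :: complex and g :: "int list \<Rightarrow> complex" and X and C :: "int set"
    assume C: "finite C" "(\<lambda>A. \<kappa> A (s + 1)) ` ?P \<subseteq> C" and g: "\<forall>v\<in>W ` ?P. lookup X v = g (window n (s + 1) v)"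
    define F where "F b = (\<Sum>c\<in>C. if carry b ?qs c = c - int n then (if legal b ?qs c then g (outs b ?qs c) else 0) else 0)" for b
    have "(\<Sum>c\<in>C. line x ?qs c (\<lambda>os c'. if c' = c - int n then g os else 0)) = (\<Sum>b\<in>?B. x ^ count_list b True * F b)"
      unfolding line_expand F_def sum_distrib_left by (subst sum.swap) (auto intro!: sum.cong)
    also have "\<dots> = (\<Sum>b\<in>{b\<in>?B. False \<in> set b}. x ^ count_list b True * F b)"
    proof (rule sum.mono_neutral_right[OF finite_bool_lists])
      show "\<forall>b\<in>?B - {b\<in>?B. False \<in> set b}. x ^ count_list b True * F b = 0"
        using carry_True[of _ ?qs] assms(1) by (auto simp: F_def)
    qed auto
    also have "\<dots> = (\<Sum>A\<in>?P. x ^ card A * lookup (word_act n (cyc_order n A) X) w)"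
    proof (rule sum.reindex_bij_witness[of _ bs "\<lambda>b. {a. a < n \<and> b ! r a}"])
      fix b assume b: "b \<in> {b\<in>?B. False \<in> set b}"
      have nth: "r i \<in> {a. a < n \<and> b ! r a} \<longleftrightarrow> b ! i" if "i < n" for i using that rn rr by simp
      show bs_b: "bs {a. a < n \<and> b ! r a} = b"
        by (rule nth_equalityI) (use b nth in \<open>auto simp: bs_def r_def\<close>)
      obtain i where "i < n" "\<not> b ! i" using b by (auto simp: in_set_conv_nth)
      then have "r i \<notin> {a. a < n \<and> b ! r a}" using nth by simp
      then show "{a. a < n \<and> b ! r a} \<in> ?P" using rn[of i] by blast
      moreover define A where "A = {a. a < n \<and> b ! r a}"
      ultimately have A: "A \<in> ?P" by simp
      have b_eq: "b = bs A" using bs_b A_def by simp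
      have len: "length b = length ?qs" using b by simp
      note run = window_run[of "\<kappa> A" "\<lambda>j. ?J j \<in> A" "pinv w" "pinv (W A)" s n, OF rec[OF A] out[OF A], folded bs_def, folded b_eq]
      have end_carry: "carry b ?qs c = \<kappa> A (s + 1) - int n" for c
        using carry_False[OF _ len, of c "\<kappa> A (s + 1)"] run(3) b per[OF A, of "s + 1 - int n"] by simp
      have "F b = (\<Sum>c\<in>C. if c = \<kappa> A (s + 1) then (if legal b ?qs c then g (outs b ?qs c) else 0) else 0)"
        unfolding F_def end_carry by (rule sum.cong) auto
      also have "\<dots> = (if legal b ?qs (\<kappa> A (s + 1)) then g (outs b ?qs (\<kappa> A (s + 1))) else 0)"
        using C A by auto
      also have "\<dots> = lookup (word_act n (cyc_order n A) X) w"
      proof -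
        have "(\<forall>j. ?J j \<in> A \<longrightarrow> \<kappa> A (j + 1) < pinv w j)" if L: "\<forall>i<n. ?J (s - int i) \<in> A \<longrightarrow> \<kappa> A (s - int i + 1) < pinv w (s - int i)"
        proof (intro allI impI)
          fix j assume j: "?J j \<in> A"
          define i where "i = nat ((s - j) mod int n)"
          define q where "q = - ((s - j) div int n)"
          have i: "i < n" "int i = (s - j) mod int n" using assms(1) by (simp_all add: i_def nat_less_iff)
          have jq: "j = s - int i + int n * q"
            using mult_div_mod_eq[of "int n" "s - j"] i(2) by (simp add: q_def algebra_simps)
          have kq: "\<kappa> A (k + int n * q) = \<kappa> A k + int n * q" for k by (rule periodic_shift) (rule per[OF A])
          have "?J (s - int i) \<in> A" using j unfolding jq by simp
          then have "\<kappa> A (s - int i + 1) < pinv w (s - int i)" using L i(1) by blast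
          then show "\<kappa> A (j + 1) < pinv w j" using kq[of "s - int i + 1"] perp[of "s - int i" q]
            by (simp add: jq add.assoc add.commute[of 1] del: of_nat_mult)
        qed
        then show ?thesis unfolding run(1,2) act[OF A] using g A by auto
      qed
      finally have Fb: "F b = lookup (word_act n (cyc_order n A) X) w" .
      have "count_list b True = card A"
      proof -
        have "count_list b True = length (filter (\<lambda>i. r i \<in> A) [0..<n])"
          unfolding b_eq bs_def r_def by (simp add: count_list_eq_length_filter filter_map comp_def)
        also have "\<dots> = card {i. i < n \<and> r i \<in> A}" using distinct_length_filter[of "[0..<n]" "\<lambda>i. r i \<in> A"] by (simp add: Int_def conj_commute)
        also have "\<dots> = card A"
          by (rule bij_betw_same_card[of r], rule bij_betw_byWitness[of _ r]) (use A rn rr in auto)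
        finally show ?thesis .
      qed
      then show "x ^ card {a. a < n \<and> b ! r a} * lookup (word_act n (cyc_order n {a. a < n \<and> b ! r a}) X) w
         = x ^ count_list b True * F b" using Fb A_def by simp
    next
      fix A assume A: "A \<in> ?P"
      have nth: "bs A ! r a \<longleftrightarrow> a \<in> A" if "a < n" for a using rn rr that by (simp add: bs_def r_def[symmetric])
      then show "{a. a < n \<and> bs A ! r a} = A" using A by auto
      obtain a where "a < n" "a \<notin> A" using A by blast
      then have "r a < length (bs A)" "\<not> bs A ! r a" using nth rn by (auto simp: bs_def)
      then show "bs A \<in> {b\<in>?B. False \<in> set b}" by (auto simp: bs_def in_set_conv_nth)
    qed
    finally show "(\<Sum>A\<in>?P. x ^ card A * lookup (word_act n (cyc_order n A) X) w) =
     (\<Sum>c\<in>C. line x ?qs c (\<lambda>os c'. if c' = c - int n then g os else 0))" by simp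
  qed
qed

section \<open>Generating series and their commutation\<close>

definition h_series :: "nat \<Rightarrow> complex \<Rightarrow> group_alg \<Rightarrow> group_alg" where
  "h_series n x X = act_free n (\<Sum>A\<in>{A. A \<subset> {..<n}}. single (cyc_order n A) (x ^ card A)) X"

lemma lookup_h_series:
  "lookup (h_series n x X) w =
    (\<Sum>A\<in>{A. A \<subset> {..<n}}. x ^ card A * lookup (word_act n (cyc_order n A) X) w)"
  by (simp add: h_series_def act_free_sum lookup_sum lookup_act_free_single)

lemma h_series_trace:
  assumes "2 \<le> n" "w \<in> affine_sym n"
  shows "\<exists>K. finite K \<and> (\<forall>C x y. finite C \<longrightarrow> K \<subseteq> C \<longrightarrow>
    lookup (h_series n x (h_series n y X)) w =
    line_trace (int n) C x y (window n 0 w) (\<lambda>os. lookup X (THE v. v \<in> affine_sym n \<and> window n 2 v = os)))"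
proof -
  \<comment> \<open>Each line raises the window by one place, so starting from window 0 the vector
    is finally read at windows with top position 2.\<close>
  define g where "g = (\<lambda>os. lookup X (THE v. v \<in> affine_sym n \<and> window n 2 v = os))"
  have g: "lookup X v = g (window n 2 v)" if "v \<in> affine_sym n" for v
  proof -
    have "(THE u. u \<in> affine_sym n \<and> window n 2 u = window n 2 v) = v"
      by (rule the_equality) (use that window_inj[OF assms(1) _ that] in blast)+
    then show ?thesis by (simp add: g_def)
  qed
  obtain W K where WK: "finite W" "W \<subseteq> affine_sym n" "finite K"
    "\<And>x g X C. finite C \<Longrightarrow> K \<subseteq> C \<Longrightarrow>
     (\<And>v. v\<in>W \<Longrightarrow> lookup X v = g (window n 1 v)) \<Longrightarrow>
     lookup (h_series n x X) w =
     (\<Sum>c\<in>C. line x (window n 0 w) c (\<lambda>os c'. if c' = c - int n then g os else 0))"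
    using line_sum_subsets[OF assms, of 0] unfolding lookup_h_series by auto
  have "\<forall>v\<in>W. \<exists>K. finite K \<and> (\<forall>x C. finite C \<longrightarrow> K \<subseteq> C \<longrightarrow>
     lookup (h_series n x X) v =
     (\<Sum>c\<in>C. line x (window n 1 v) c (\<lambda>os c'. if c' = c - int n then g os else 0)))"
  proof
    fix v assume "v \<in> W"
    then have v: "v \<in> affine_sym n" using WK(2) by blast
    obtain W' K' where "finite K'" "W' \<subseteq> affine_sym n" "\<And>x g X C. finite C \<Longrightarrow> K' \<subseteq> C \<Longrightarrow>
     (\<And>v. v\<in>W' \<Longrightarrow> lookup X v = g (window n 2 v)) \<Longrightarrow>
     lookup (h_series n x X) v =
     (\<Sum>c\<in>C. line x (window n 1 v) c (\<lambda>os c'. if c' = c - int n then g os else 0))"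
      using line_sum_subsets[OF assms(1) v, of 1] unfolding lookup_h_series by auto
    then show "\<exists>K. finite K \<and> (\<forall>x C. finite C \<longrightarrow> K \<subseteq> C \<longrightarrow>
     lookup (h_series n x X) v =
     (\<Sum>c\<in>C. line x (window n 1 v) c (\<lambda>os c'. if c' = c - int n then g os else 0)))"
      using g by (intro exI[of _ K']) blast
  qed
  then obtain Kv where "\<forall>v\<in>W. finite (Kv v) \<and> (\<forall>x C. finite C \<longrightarrow> Kv v \<subseteq> C \<longrightarrow>
     lookup (h_series n x X) v =
     (\<Sum>c\<in>C. line x (window n 1 v) c (\<lambda>os c'. if c' = c - int n then g os else 0)))"
    by (rule bchoice[THEN exE])
  then have Kv: "\<And>v. v \<in> W \<Longrightarrow> finite (Kv v)" "\<And>v x C. v \<in> W \<Longrightarrow> finite C \<Longrightarrow> Kv v \<subseteq> C \<Longrightarrow>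
     lookup (h_series n x X) v =
     (\<Sum>c\<in>C. line x (window n 1 v) c (\<lambda>os c'. if c' = c - int n then g os else 0))"
    by blast+
  show ?thesis unfolding g_def[symmetric]
  proof (intro exI[of _ "K \<union> (\<Union>v\<in>W. Kv v)"] conjI allI impI)
    show "finite (K \<union> (\<Union>v\<in>W. Kv v))" using WK Kv by blast
    fix C x y assume C: "finite C" "K \<union> (\<Union>v\<in>W. Kv v) \<subseteq> C"
    \<comment> \<open>The inner series as a function of the row alone. It represents that series on
      \<open>W\<close>, which is all that the outer line asks for.\<close>
    let ?g1 = "\<lambda>os. \<Sum>d\<in>C. line y os d (\<lambda>os' d'. if d' = d - int n then g os' else 0)"
    have "lookup (h_series n x (h_series n y X)) w =
      (\<Sum>c\<in>C. line x (window n 0 w) c (\<lambda>os c'. if c' = c - int n then ?g1 os else 0))"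
      using C Kv(2) by (intro WK(4)) blast+
    also have "\<dots> = (\<Sum>c\<in>C. line x (window n 0 w) c (\<lambda>os c'. \<Sum>d\<in>C. line y os d (\<lambda>os' d'. if d' = d - int n \<and> c' = c - int n then g os' else 0)))"
    proof (intro sum.cong refl arg_cong[of _ _ "line x (window n 0 w) _"] ext)
      fix c os c'
      show "(if c' = c - int n then ?g1 os else 0) = (\<Sum>d\<in>C. line y os d (\<lambda>os' d'. if d' = d - int n \<and> c' = c - int n then g os' else 0))"
        by (cases "c' = c - int n") (simp_all add: line_zero)
    qed
    also have "\<dots> = (\<Sum>c\<in>C. \<Sum>d\<in>C. two_lines x y (window n 0 w) d c (\<lambda>os d' c'. if d' = d - int n \<and> c' = c - int n then g os else 0))"
      by (simp add: line_sum two_lines_def)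
    also have "\<dots> = line_trace (int n) C x y (window n 0 w) g"
      unfolding line_trace_def by (rule sum.swap)
    finally show "lookup (h_series n x (h_series n y X)) w = line_trace (int n) C x y (window n 0 w) g" .
  qed
qed

lemma word_act_not_affine:
  assumes "2 \<le> n" "set is \<subseteq> {..<n}" "is \<noteq> []" "w \<notin> affine_sym n"
  shows "lookup (word_act n is X) w = 0"
proof (cases "is")
  case (Cons i js)
  then show ?thesis using lookup_word_act_Cons[OF assms(1), of i js X w] assms by (simp add: is_desc_def)
qed (use assms in simp)

lemma h_act_not_affine:
  assumes "2 \<le> n" "0 < k" "w \<notin> affine_sym n"
  shows "lookup (h_act n k X) w = 0"
  unfolding h_act_def lookup_sum
proof (intro sum.neutral ballI)
  fix A assume "A \<in> {A. A \<subset> {..<n} \<and> card A = k}"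
  then have A: "A \<subset> {..<n}" "A \<noteq> {}" using assms(2) by auto
  have "set (cyc_order n A) = A" by (rule set_cyc_order[OF assms(1) A(1)])
  then show "lookup (word_act n (cyc_order n A) X) w = 0"
    using A assms by (intro word_act_not_affine) auto
qed

lemma h_series_commute:
  assumes "2 \<le> n" "w \<in> affine_sym n"
  shows "lookup (h_series n x (h_series n y X)) w = lookup (h_series n y (h_series n x X)) w"
proof -
  obtain K where K: "finite K" and T: "\<And>C x y. finite C \<Longrightarrow> K \<subseteq> C \<Longrightarrow>
    lookup (h_series n x (h_series n y X)) w =
    line_trace (int n) C x y (window n 0 w) (\<lambda>os. lookup X (THE v. v \<in> affine_sym n \<and> window n 2 v = os))"
    using h_series_trace[OF assms] by meson
  show ?thesis unfolding T[OF K order_refl] by (rule line_trace_commute[OF K])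
qed

lemma lookup_h_series_h_act:
  assumes "2 \<le> n"
  shows "lookup (h_series n x X) w = (\<Sum>k\<le>n. lookup (h_act n k X) w * x ^ k)"
proof -
  let ?P = "{A. A \<subset> {..<n}}"
  have "card ` ?P \<subseteq> {..n}" using card_mono[of "{..<n}"] by force
  then have "lookup (h_series n x X) w = (\<Sum>k\<le>n. \<Sum>A\<in>{A\<in>?P. card A = k}. x ^ card A * lookup (word_act n (cyc_order n A) X) w)"
    unfolding lookup_h_series by (subst sum.group) (simp_all add: finite_proper_subsets)
  also have "\<dots> = (\<Sum>k\<le>n. lookup (h_act n k X) w * x ^ k)"
    by (simp add: h_act_def lookup_sum sum_distrib_left sum_distrib_right mult.commute)
  finally show ?thesis .
qed

lemma lookup_h_act_sum:
  assumes "2 \<le> n" "finite S" "\<And>w. lookup Y w = (\<Sum>k\<in>S. c k * lookup (f k) w)"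
  shows "lookup (h_act n k Y) w = (\<Sum>j\<in>S. c j * lookup (h_act n k (f j)) w)"
  unfolding h_act_def lookup_sum lookup_word_act_sum[OF assms] sum_distrib_left by (rule sum.swap)

lemma h_act_commute:
  assumes "2 \<le> n"
  shows "h_act n i (h_act n j X) = h_act n j (h_act n i X)"
\<comment> \<open>h_0 is the identity also on coefficients outside the group, whereas h_k with k > 0
  has none there; hence the separate case.\<close>
proof (cases "i = 0 \<or> j = 0")
  case True
  then show ?thesis using h_act_0[OF assms] by auto
next
  case False
  show ?thesis
  proof (rule poly_mapping_eqI)
    fix w
    let ?a = "\<lambda>i j. lookup (h_act n i (h_act n j X)) w"
    have nested: "lookup (h_series n x (h_series n y X)) w = (\<Sum>i\<le>n. (\<Sum>j\<le>n. ?a i j * y ^ j) * x ^ i)" for x y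
    proof -
      have "lookup (h_act n i (h_series n y X)) w = (\<Sum>j\<le>n. y ^ j * ?a i j)" for i
        by (rule lookup_h_act_sum[OF assms]) (auto simp: lookup_h_series_h_act[OF assms] mult.commute)
      then show ?thesis unfolding lookup_h_series_h_act[OF assms, of x] by (simp add: mult.commute)
    qed
    have zero: "h_act n k Y = 0" if "n < k" for k Y
    proof -
      have "card A < n" if "A \<subset> {..<n}" for A using psubset_card_mono[OF _ that] by simp
      then have "\<not> (A \<subset> {..<n} \<and> card A = k)" for A using that by (metis less_asym')
      then have "{A. A \<subset> {..<n} \<and> card A = k} = {}" by blast
      then show ?thesis by (simp only: h_act_def sum.empty)
    qed
    have h0: "h_act n k 0 = 0" for k by (simp add: h_act_def word_act_zero[OF assms])
    show "?a i j = ?a j i"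
    proof (cases "w \<in> affine_sym n")
      case aff: True
      show ?thesis
      proof (cases "i \<le> n \<and> j \<le> n")
        case True
        have "(\<Sum>i\<le>n. (\<Sum>j\<le>n. ?a i j * y ^ j) * x ^ i) = (\<Sum>i\<le>n. (\<Sum>j\<le>n. ?a j i * y ^ j) * x ^ i)" for x y
        proof -
          have "(\<Sum>i\<le>n. (\<Sum>j\<le>n. ?a i j * y ^ j) * x ^ i) = (\<Sum>i\<le>n. (\<Sum>j\<le>n. ?a i j * x ^ j) * y ^ i)"
            unfolding nested[symmetric] by (rule h_series_commute[OF assms aff])
          also have "\<dots> = (\<Sum>i\<le>n. (\<Sum>j\<le>n. ?a j i * y ^ j) * x ^ i)"
            unfolding sum_distrib_right by (subst sum.swap) (simp add: mult_ac)
          finally show ?thesis .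
        qed
        \<comment> \<open>Both sides are polynomials that agree for all complex x and y: compare
          coefficients first in x, then in y.\<close>
        then have "(\<Sum>j\<le>n. ?a i j * y ^ j) = (\<Sum>j\<le>n. ?a j i * y ^ j)" for y
          using polyfun_eq_coeffs[of "\<lambda>i. \<Sum>j\<le>n. ?a i j * y ^ j" n "\<lambda>i. \<Sum>j\<le>n. ?a j i * y ^ j"] True by blast
        then show ?thesis using polyfun_eq_coeffs[of "?a i" n "\<lambda>j. ?a j i"] True by blast
      next
        case False
        then show ?thesis using zero h0 by (metis not_le)
      qed
    next
      case nonaff: False
      then show ?thesis using h_act_not_affine[OF assms] False by simp
    qed
  qed
qed

section \<open>Exponent multisets\<close>

definition exponents :: "('v \<Rightarrow>\<^sub>0 nat) \<Rightarrow> nat multiset" where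
  "exponents m = image_mset (lookup m) (mset_set (keys m))"

text \<open>Adjacent swaps bring the required head to the front; the prefix \<open>zs\<close> lets
  the induction keep it fixed afterwards.\<close>

lemma list_fun_mset:
  assumes swap: "\<And>xs a b ys. \<Phi> (xs @ [a, b] @ ys) = \<Phi> (xs @ [b, a] @ ys)"
  shows "mset xs = mset ys \<Longrightarrow> \<Phi> (zs @ xs) = \<Phi> (zs @ ys)"
proof (induction xs arbitrary: ys zs)
  case (Cons a xs)
  have "a \<in> set ys" using Cons.prems by (metis list.set_intros(1) mset_eq_setD)
  then obtain us vs where ys: "ys = us @ a # vs" by (meson split_list)
  have front: "\<Phi> (zs @ us @ a # vs) = \<Phi> (zs @ a # us @ vs)" for vs
  proof (induction us arbitrary: vs rule: rev_induct)
    case (snoc b us)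
    show ?case using swap[of "zs @ us" b a vs] snoc[of "b # vs"] by simp
  qed simp
  have "\<Phi> ((zs @ [a]) @ xs) = \<Phi> ((zs @ [a]) @ us @ vs)"
    by (rule Cons.IH) (use Cons.prems ys in simp)
  then show ?case using front ys by simp
qed simp

text \<open>The common device for both families: the symmetry of the affine Stanley functions and of
  the Schur functions is reduced to one adjacent swap and one trailing zero.\<close>

lemma list_fun_nonzero_mset:
  assumes swap: "\<And>xs a b ys. \<Phi> (xs @ [a, b] @ ys) = \<Phi> (xs @ [b, a] @ ys)"
    and zero: "\<And>xs. \<Phi> (xs @ [0::nat]) = \<Phi> xs"
    and "filter_mset (\<lambda>k. k \<noteq> 0) (mset xs) = filter_mset (\<lambda>k. k \<noteq> 0) (mset ys)"
  shows "\<Phi> xs = \<Phi> ys"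
proof -
  have zeros: "\<Phi> (xs @ replicate k 0) = \<Phi> xs" for xs k
  proof (induction k)
    case (Suc k)
    then show ?case using zero[of "xs @ replicate k 0"] by (simp add: replicate_append_same[symmetric])
  qed simp
  have rm: "\<Phi> xs = \<Phi> (filter (\<lambda>k. k \<noteq> 0) xs)" for xs
  proof -
    have "mset (filter (\<lambda>k. k \<noteq> 0) xs @ replicate (count_list xs 0) 0) = mset xs"
      by (induction xs) auto
    then have "\<Phi> ([] @ filter (\<lambda>k. k \<noteq> 0) xs @ replicate (count_list xs 0) 0) = \<Phi> ([] @ xs)"
      by (rule list_fun_mset[of \<Phi>, OF swap])
    then show ?thesis using zeros by simp
  qed
  have "\<Phi> ([] @ filter (\<lambda>k. k \<noteq> 0) xs) = \<Phi> ([] @ filter (\<lambda>k. k \<noteq> 0) ys)"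
    by (rule list_fun_mset[of \<Phi>, OF swap]) (use assms(3) in simp)
  then show ?thesis using rm[of xs] rm[of ys] by simp
qed

lemma exponents_map:
  assumes "distinct ks" "keys m \<subseteq> set ks"
  shows "exponents m = filter_mset (\<lambda>k. k \<noteq> 0) (mset (map (lookup m) ks))"
proof -
  have "filter_mset (\<lambda>k. k \<noteq> 0) (mset (map (lookup m) ks))
     = image_mset (lookup m) (filter_mset (\<lambda>k. lookup m k \<noteq> 0) (mset_set (set ks)))"
    by (simp add: filter_mset_image_mset mset_set_set[OF assms(1)])
  also have "filter_mset (\<lambda>k. lookup m k \<noteq> 0) (mset_set (set ks)) = mset_set (keys m)"
    using assms(2) by (subst filter_mset_mset_set) (auto simp: in_keys_iff intro: arg_cong[of _ _ mset_set])
  finally show ?thesis by (simp add: exponents_def)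
qed

lemma keys_degree: "keys m \<subseteq> {..<degree m}"
  using in_keys_less_degree by blast

lemma exponents_upt:
  "keys m \<subseteq> {..<D} \<Longrightarrow> exponents m = filter_mset (\<lambda>k. k \<noteq> 0) (mset (map (lookup m) [0..<D]))"
  by (rule exponents_map) auto

lemma lookup_nth_ge: "length xs \<le> i \<Longrightarrow> lookup (Poly_Mapping.nth xs) i = 0"
  by (simp add: nth_default_def)

lemma keys_nth_subset: "keys (Poly_Mapping.nth xs) \<subseteq> {..<length xs}"
  by (auto simp: nth_default_def in_keys_iff simp del: keys_nth split: if_splits)

lemma exponents_nth: "exponents (Poly_Mapping.nth xs) = filter_mset (\<lambda>k. k \<noteq> 0) (mset xs)"
proof -
  have "map (lookup (Poly_Mapping.nth xs)) [0..<length xs] = xs"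
    by (rule nth_equalityI) (auto simp: nth_default_def)
  then show ?thesis using exponents_upt[OF keys_nth_subset[of xs]] by simp
qed

lemma exponents_map_key:
  assumes "inj \<sigma>" "keys m \<subseteq> range \<sigma>"
  shows "exponents (map_key \<sigma> m) = exponents m"
proof -
  have k: "keys (map_key \<sigma> m) = \<sigma> -` keys m" by (rule keys_map_key[OF assms(1)])
  have "image_mset \<sigma> (mset_set (\<sigma> -` keys m)) = mset_set (keys m)"
    using image_mset_mset_set[of \<sigma> "\<sigma> -` keys m"] assms by (simp add: inj_on_subset image_vimage_eq Int_absorb2)
  then have "image_mset (lookup m) (image_mset \<sigma> (mset_set (\<sigma> -` keys m))) = exponents m"
    by (simp add: exponents_def)
  then show ?thesis unfolding exponents_def k by (simp add: map_key.rep_eq[OF assms(1)] multiset.map_comp)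
qed

section \<open>Symmetry as dependence on the exponents\<close>

definition exponent_invariant :: "nat series \<Rightarrow> bool" where
  "exponent_invariant f \<longleftrightarrow> (\<forall>m m'. exponents m = exponents m' \<longrightarrow> f m = f m')"

lemma exponent_invariantI:
  assumes "\<And>m. f m = \<Phi> (map (lookup m) [0..<degree m])"
    and "\<And>xs a b ys. \<Phi> (xs @ [a, b] @ ys) = \<Phi> (xs @ [b, a] @ ys)"
    and "\<And>xs. \<Phi> (xs @ [0::nat]) = \<Phi> xs"
  shows "exponent_invariant f"
  unfolding exponent_invariant_def
proof (intro allI impI)
  fix m m' :: "nat \<Rightarrow>\<^sub>0 nat"
  assume "exponents m = exponents m'"
  then have "\<Phi> (map (lookup m) [0..<degree m]) = \<Phi> (map (lookup m') [0..<degree m'])"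
    by (intro list_fun_nonzero_mset[of \<Phi>, OF assms(2,3)]) (simp_all add: exponents_upt[OF keys_degree])
  then show "f m = f m'" by (simp add: assms(1))
qed

text \<open>In one direction transpositions of neighbouring variables provide the swaps; in the
  other, an injective renaming that covers the support keeps the multiset of exponents.\<close>

lemma symmetric_iff: "symmetric f \<longleftrightarrow> exponent_invariant f"
proof
  assume inv: "exponent_invariant f"
  show "symmetric f" unfolding symmetric_def
  proof (intro allI impI ext)
    fix \<sigma> :: "nat \<Rightarrow> nat" and m assume "bij \<sigma>"
    then have "exponents (map_key \<sigma> m) = exponents m"
      by (intro exponents_map_key) (auto simp: bij_is_inj bij_is_surj)
    then have "f (map_key \<sigma> m) = f m" using inv unfolding exponent_invariant_def by blast
    then show "rename \<sigma> f m = f m" using \<open>bij \<sigma>\<close> by (simp add: rename_def bij_is_surj)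
  qed
next
  assume sym: "symmetric f"
  show "exponent_invariant f"
  proof (rule exponent_invariantI[of _ "\<lambda>xs. f (Poly_Mapping.nth xs)"])
    fix xs ys :: "nat list" and a b :: nat
    define t where "t = (\<lambda>k. if k = length xs then Suc (length xs) else if k = Suc (length xs) then length xs else k)"
    have "t \<circ> t = id" by (auto simp: t_def)
    then have bij: "bij t" using o_bij by blast
    have lk: "lookup (map_key t M) k = lookup M (t k)" for M :: "nat \<Rightarrow>\<^sub>0 nat" and k
      by (simp add: map_key.rep_eq[OF bij_is_inj[OF bij]])
    have "map_key t (Poly_Mapping.nth (xs @ [a, b] @ ys)) = Poly_Mapping.nth (xs @ [b, a] @ ys)"
    proof (rule poly_mapping_eqI)
      fix k
      consider "k < length xs" | "k = length xs" | "k = Suc (length xs)" | "k > Suc (length xs)" by linarith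
      then show "lookup (map_key t (Poly_Mapping.nth (xs @ [a, b] @ ys))) k
        = lookup (Poly_Mapping.nth (xs @ [b, a] @ ys)) k"
        unfolding lk
      proof cases
        case 4
        then obtain j where "k = Suc (Suc (length xs + j))" by (metis add_Suc_right less_iff_Suc_add add_Suc)
        then have tk: "t k = k" and "k = length xs + (j + 2)" by (simp_all add: t_def)
        then show "lookup (Poly_Mapping.nth (xs @ [a, b] @ ys)) (t k)
          = lookup (Poly_Mapping.nth (xs @ [b, a] @ ys)) k"
          unfolding tk by (simp add: nth_default_def nth_append)
      qed (simp_all add: t_def nth_default_def nth_append)
    qed
    moreover have "f (Poly_Mapping.nth (xs @ [a, b] @ ys)) = f (map_key t (Poly_Mapping.nth (xs @ [a, b] @ ys)))"
    proof -
      have "rename t f = f" using sym bij unfolding symmetric_def by blast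
      moreover have "rename t f M = f (map_key t M)" for M using bij by (simp add: rename_def bij_is_surj)
      ultimately show ?thesis by metis
    qed
    ultimately show "f (Poly_Mapping.nth (xs @ [a, b] @ ys)) = f (Poly_Mapping.nth (xs @ [b, a] @ ys))" by simp
  next
    fix xs :: "nat list"
    show "f (Poly_Mapping.nth (xs @ [0])) = f (Poly_Mapping.nth xs)" using nth_trailing_zeros[of xs 1] by simp
  qed (simp add: nth_idem)
qed

section \<open>Partitions and interlacing\<close>

text \<open>A partition is encoded by the exponent vector with the parts as entries.\<close>

definition is_part :: "(nat \<Rightarrow>\<^sub>0 nat) \<Rightarrow> bool" where
  "is_part la \<longleftrightarrow> (\<forall>i. lookup la (Suc i) \<le> lookup la i)"

lemma is_part_mono: "is_part la \<Longrightarrow> i \<le> j \<Longrightarrow> lookup la j \<le> lookup la i"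
  unfolding is_part_def by (rule lift_Suc_antimono_le[of "lookup la"]) auto

lemma nth_partitions: "bij_betw Poly_Mapping.nth partitions {la. is_part la}"
proof -
  have ntz: "no_trailing ((=) 0) ls" if "ls \<in> partitions" for ls
  proof -
    have "last ls \<noteq> 0" if "ls \<noteq> []" using last_in_set[OF that] \<open>ls \<in> partitions\<close> unfolding partitions_def by (metis (mono_tags, lifting) mem_Collect_eq)
    then show ?thesis by (simp add: no_trailing_unfold)
  qed
  have "inj_on Poly_Mapping.nth partitions"
    by (rule inj_onI) (metis ntz nth_eq_iff strip_while_idem_iff)
  moreover have "is_part (Poly_Mapping.nth ls)" if "ls \<in> partitions" for ls
    unfolding is_part_def
  proof
    fix i
    show "lookup (Poly_Mapping.nth ls) (Suc i) \<le> lookup (Poly_Mapping.nth ls) i"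
      using that sorted_wrt_nth_less[of "(\<ge>)" ls i "Suc i"] by (simp add: nth_default_def partitions_def)
  qed
  moreover have "la \<in> Poly_Mapping.nth ` partitions" if la: "is_part la" for la
  proof
    let ?ls = "map (lookup la) [0..<degree la]"
    show "la = Poly_Mapping.nth ?ls" by (simp add: nth_idem)
    have "lookup la i \<noteq> 0" if "i < degree la" for i
    proof -
      have "degree la - 1 \<in> keys la" using that by (intro degree_greater_zero_in_keys) simp
      then have "0 < lookup la (degree la - 1)" by (simp add: in_keys_iff)
      also have "\<dots> \<le> lookup la i" using that by (intro is_part_mono[OF la]) simp
      finally show ?thesis by simp
    qed
    moreover have "sorted_wrt (\<ge>) ?ls"
      by (auto simp: sorted_wrt_iff_nth_less intro: is_part_mono[OF la])
    ultimately show "?ls \<in> partitions" by (fastforce simp: partitions_def)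
  qed
  ultimately show ?thesis by (auto simp: bij_betw_def)
qed

lemma mono_degree_superset:
  assumes "finite S" "keys m \<subseteq> S"
  shows "mono_degree m = (\<Sum>k\<in>S. lookup m k)"
  unfolding mono_degree_def by (rule sum.mono_neutral_left) (use assms in \<open>auto simp: in_keys_iff\<close>)

lemma mono_degree_add [simp]: "mono_degree (a + b) = mono_degree a + mono_degree b"
proof -
  let ?S = "keys a \<union> keys b"
  have "keys (a + b) \<subseteq> ?S" by (rule Poly_Mapping.keys_add)
  then show ?thesis by (simp add: mono_degree_superset[of ?S] lookup_add sum.distrib)
qed

lemma mono_degree_single [simp]: "mono_degree (single k v) = v"
  by (simp add: mono_degree_def)

lemma mono_degree_0 [simp]: "mono_degree 0 = 0"
  by (simp add: mono_degree_def)

lemma mono_degree_eq_0: "mono_degree m = 0 \<longleftrightarrow> m = 0"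
proof
  assume "mono_degree m = 0"
  then show "m = 0" by (intro poly_mapping_eqI) (auto simp: mono_degree_def in_keys_iff)
qed simp

text \<open>The difference of \<open>la\<close> and \<open>nu\<close> is a horizontal strip: no
  column contains two of its boxes. The two chains of inequalities already make both vectors
  partitions.\<close>

definition interlace :: "(nat \<Rightarrow>\<^sub>0 nat) \<Rightarrow> (nat \<Rightarrow>\<^sub>0 nat) \<Rightarrow> bool" where
  "interlace la nu \<longleftrightarrow> (\<forall>i. lookup nu i \<le> lookup la i \<and>
     lookup la (Suc i) \<le> lookup nu i)"

definition hstrips :: "nat \<Rightarrow> (nat \<Rightarrow>\<^sub>0 nat) \<Rightarrow> (nat \<Rightarrow>\<^sub>0 nat) set" where
  "hstrips a la = {nu. interlace la nu \<and> mono_degree la = mono_degree nu + a}"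

lemma interlace_part: "interlace la nu \<Longrightarrow> is_part la" "interlace la nu \<Longrightarrow> is_part nu"
  unfolding interlace_def is_part_def by (meson le_trans)+

lemma finite_below: "finite {nu :: 'v \<Rightarrow>\<^sub>0 nat. \<forall>i. lookup nu i \<le> lookup la i}"
proof -
  let ?S = "{nu :: 'v \<Rightarrow>\<^sub>0 nat. \<forall>i. lookup nu i \<le> lookup la i}"
  let ?F = "\<lambda>nu. restrict (lookup nu) (keys la)"
  have "inj_on ?F ?S"
  proof (rule inj_onI, rule poly_mapping_eqI)
    fix a b k assume ab: "a \<in> ?S" "b \<in> ?S" "?F a = ?F b"
    show "lookup a k = lookup b k"
    proof (cases "k \<in> keys la")
      case True then show ?thesis using ab(3) by (metis restrict_apply')
    next
      case False
      then have "lookup la k = 0" by (simp add: in_keys_iff)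
      then show ?thesis using ab(1,2) by (metis (mono_tags, lifting) le_zero_eq mem_Collect_eq)
    qed
  qed
  moreover have "?F ` ?S \<subseteq> (\<Pi>\<^sub>E k\<in>keys la. {..lookup la k})" by auto
  moreover have "finite (\<Pi>\<^sub>E k\<in>keys la. {..lookup la k})" by (intro finite_PiE) auto
  ultimately show ?thesis using finite_imageD finite_subset by blast
qed

lemma finite_hstrips: "finite (hstrips a la)"
  by (rule finite_subset[OF _ finite_below[of la]]) (auto simp: hstrips_def interlace_def)

lemma finite_add_decomp: "finite {(a, b). a + b = (m :: 'v \<Rightarrow>\<^sub>0 nat)}"
proof (rule finite_subset)
  show "{(a, b). a + b = m} \<subseteq> {nu. \<forall>i. lookup nu i \<le> lookup m i} \<times> {nu. \<forall>i. lookup nu i \<le> lookup m i}"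
    by (auto simp: lookup_add)
qed (simp add: finite_below)

lemma poly_mapping_of_fun:
  fixes f :: "nat \<Rightarrow> nat"
  assumes "\<And>i. f i \<le> lookup la i"
  obtains nu where "lookup nu = f"
proof -
  have "{i. f i \<noteq> 0} \<subseteq> keys la"   proof
    fix i assume "i \<in> {i. f i \<noteq> 0}"
    then show "i \<in> keys la" using assms[of i] by (simp add: in_keys_iff)
  qed
  then have "finite {i. f i \<noteq> 0}" by (rule finite_subset) simp
  then show ?thesis using that[of "Abs_poly_mapping f"] by simp
qed

section \<open>Schur functions\<close>

definition diagram :: "(nat \<Rightarrow>\<^sub>0 nat) \<Rightarrow> (nat \<times> nat) set" where
  "diagram la = {(r, c). c < lookup la r}"

definition tableaux :: "(nat \<Rightarrow>\<^sub>0 nat) \<Rightarrow> (nat \<Rightarrow>\<^sub>0 nat) \<Rightarrow> (nat \<times> nat \<Rightarrow> nat) set" where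
  "tableaux la m = {T \<in> diagram la \<rightarrow>\<^sub>E UNIV.
     (\<forall>r c. (r, c) \<in> diagram la \<longrightarrow> (r, c + 1) \<in> diagram la \<longrightarrow> T (r, c) \<le> T (r, c + 1)) \<and>
     (\<forall>r c. (r, c) \<in> diagram la \<longrightarrow> (r + 1, c) \<in> diagram la \<longrightarrow> T (r, c) < T (r + 1, c)) \<and>
     (\<forall>k. lookup m k = card {p \<in> diagram la. T p = k})}"

definition schur_fun :: "(nat \<Rightarrow>\<^sub>0 nat) \<Rightarrow> nat series" where
  "schur_fun la m = of_nat (card (tableaux la m))"

lemma diagram_nth: "diagram (Poly_Mapping.nth ls) = cells ls"
  by (auto simp: diagram_def cells_def nth_default_def split: if_splits)

lemma schur_eq: "schur ls = schur_fun (Poly_Mapping.nth ls)"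
proof
  fix m
  have "{T \<in> ssyt ls. \<forall>k. lookup m k = card {p \<in> cells ls. T p = k}} = tableaux (Poly_Mapping.nth ls) m"
    unfolding tableaux_def ssyt_def diagram_nth by blast
  then show "schur ls m = schur_fun (Poly_Mapping.nth ls) m" by (simp add: schur_def schur_fun_def)
qed

lemma diagram_Sigma: "diagram la = Sigma (keys la) (\<lambda>r. {..<lookup la r})"
  by (auto simp: diagram_def in_keys_iff)

lemma finite_diagram [simp]: "finite (diagram la)"
  by (simp add: diagram_Sigma)

lemma card_diagram: "card (diagram la) = mono_degree la"
  by (simp add: diagram_Sigma mono_degree_def)

lemma diagram_inj: "diagram la = diagram mu \<Longrightarrow> la = mu"
proof (rule poly_mapping_eqI)
  fix r assume "diagram la = diagram mu"
  then have "{c. (r, c) \<in> diagram la} = {c. (r, c) \<in> diagram mu}" by simp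
  then have "{..<lookup la r} = {..<lookup mu r}" by (auto simp: diagram_def lessThan_def)
  then show "lookup la r = lookup mu r" by simp
qed

lemma tableaux_entry:
  assumes "T \<in> tableaux la m" "p \<in> diagram la" shows "T p \<in> keys m"
proof -
  have "finite {q \<in> diagram la. T q = T p}" by simp
  then have "card {q \<in> diagram la. T q = T p} \<noteq> 0" using assms(2) unfolding card_eq_0_iff by blast
  then show ?thesis using assms(1) by (simp add: tableaux_def in_keys_iff)
qed

lemma finite_tableaux: "finite (tableaux la m)"
proof (rule finite_subset)
  show "tableaux la m \<subseteq> (\<Pi>\<^sub>E p\<in>diagram la. keys m)"
  proof
    fix T assume T: "T \<in> tableaux la m"
    then have "T \<in> extensional (diagram la)" by (simp add: tableaux_def PiE_def)
    then show "T \<in> (\<Pi>\<^sub>E p\<in>diagram la. keys m)" using tableaux_entry[OF T] by (simp add: PiE_def)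
  qed
qed (simp add: finite_PiE)

lemma tableaux_degree:
  assumes "T \<in> tableaux la m" shows "mono_degree la = mono_degree m"
proof -
  have "card (diagram la) = card (\<Union>k\<in>keys m. {p \<in> diagram la. T p = k})"
    using tableaux_entry[OF assms] by (intro arg_cong[of _ _ card]) auto
  also have "\<dots> = (\<Sum>k\<in>keys m. card {p \<in> diagram la. T p = k})"
    by (rule card_UN_disjoint) auto
  also have "\<dots> = mono_degree m" using assms by (simp add: tableaux_def mono_degree_def)
  finally show ?thesis by (simp add: card_diagram)
qed

lemma schur_fun_degree: "schur_fun la m \<noteq> 0 \<Longrightarrow> mono_degree la = mono_degree m"
  using tableaux_degree by (auto simp: schur_fun_def card_eq_0_iff)

lemma schur_fun_zero: "schur_fun la 0 = (if la = 0 then 1 else 0)"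
proof (cases "la = 0")
  case True
  have "diagram 0 = {}" by (simp add: diagram_def)
  then have "tableaux 0 0 = {\<lambda>_. undefined}" by (auto simp: tableaux_def)
  then show ?thesis using True by (simp add: schur_fun_def)
next
  case False
  then have "mono_degree la \<noteq> 0" by (simp add: mono_degree_eq_0)
  then have "tableaux la 0 = {}" using tableaux_degree[of _ la 0] by auto
  then show ?thesis using False by (simp add: schur_fun_def)
qed

lemma downward_closed_lessThan:
  fixes S :: "nat set"
  assumes "finite S" "\<And>i j. j \<in> S \<Longrightarrow> i < j \<Longrightarrow> i \<in> S"
  shows "S = {..<card S}"
proof (cases "S = {}")
  case False
  have "S = {..Max S}"
  proof
    show "{..Max S} \<subseteq> S" using assms(2) Max_in[OF assms(1) False] by (auto simp: le_less)
  qed (use assms(1) in auto)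
  then show ?thesis by (metis card_atMost lessThan_Suc_atMost)
qed simp

text \<open>The cells with entries other than the largest letter \<open>d\<close> form a diagram, and the cells with
  entry \<open>d\<close> a horizontal strip.\<close>

lemma schur_fun_last:
  assumes la: "is_part la" and m: "keys m \<subseteq> {..<d}"
  shows "schur_fun la (m + single d a) = (\<Sum>nu\<in>hstrips a la. schur_fun nu m)"
proof -
  let ?M = "m + single d a"
  define TT where "TT nu = {T \<in> tableaux la ?M. {p \<in> diagram la. T p < d} = diagram nu}" for nu
  have md: "lookup m k = 0" if "d \<le> k" for k using m that by (metis in_keys_iff lessThan_iff not_le subsetD)
  have Mk: "lookup ?M k = (if k = d then a else lookup m k)" for k
    using md[of d] by (simp add: lookup_add lookup_single when_def)
  have entry_le: "T p \<le> d" if "T \<in> tableaux la ?M" "p \<in> diagram la" for T p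
  proof (rule ccontr)
    assume "\<not> T p \<le> d"
    then show False using tableaux_entry[OF that] Mk[of "T p"] md[of "T p"] by (simp add: in_keys_iff)
  qed
  have card_split: "card (diagram la) = card {p \<in> diagram la. T p < d} + card {p \<in> diagram la. T p = d}" if "\<And>p. p \<in> diagram la \<Longrightarrow> T p \<le> d" for T
  proof -
    have "diagram la = {p \<in> diagram la. T p < d} \<union> {p \<in> diagram la. T p = d}" using that by (auto simp: le_less)
    then have "card (diagram la) = card ({p \<in> diagram la. T p < d} \<union> {p \<in> diagram la. T p = d})" by (rule arg_cong)
    also have "\<dots> = card {p \<in> diagram la. T p < d} + card {p \<in> diagram la. T p = d}"
      by (rule card_Un_disjoint) auto
    finally show ?thesis .
  qed
  have cover: "\<exists>nu\<in>hstrips a la. T \<in> TT nu" if T: "T \<in> tableaux la ?M" for T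
  proof -
    let ?S = "\<lambda>r. {c. c < lookup la r \<and> T (r, c) < d}"
    have row: "T (r, c) \<le> T (r, Suc c)" if "Suc c < lookup la r" for r c
      using T that by (simp add: tableaux_def diagram_def)
    have rows: "T (r, c) \<le> T (r, c')" if "c \<le> c'" "c' < lookup la r" for r c c'
      using that by (induction c' rule: dec_induct) (use row le_trans Suc_lessD in blast)+
    \<comment> \<open>Rows increase weakly, so the entries below \<open>d\<close> fill an initial
      segment of each row, whose length becomes the row of \<open>nu\<close>.\<close>
    have S: "?S r = {..<card (?S r)}" for r
    proof (rule downward_closed_lessThan)
      fix i j assume "j \<in> ?S r" "i < j"
      then show "i \<in> ?S r" using rows[of i j r] by simp
    qed simp
    obtain nu where nu: "lookup nu = (\<lambda>r. card (?S r))"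
      by (rule poly_mapping_of_fun[of "\<lambda>r. card (?S r)" la])
         (use card_mono[of "{..<lookup la _}" "?S _"] in auto)
    have cell: "(r, c) \<in> diagram nu \<longleftrightarrow> (r, c) \<in> diagram la \<and> T (r, c) < d" for r c
      using S[of r] by (auto simp: diagram_def nu)
    then have eq: "{p \<in> diagram la. T p < d} = diagram nu" by auto
    have "interlace la nu" unfolding interlace_def
    proof (intro allI conjI)
      fix i
      show "lookup nu i \<le> lookup la i"
        using cell[of i] by (auto simp: diagram_def not_less dest: leD intro: leI)
      \<comment> \<open>The box above a box of row i + 1 has a strictly smaller entry, hence one
        below \<open>d\<close>, and so belongs to \<open>nu\<close>.\<close>
      show "lookup la (Suc i) \<le> lookup nu i"
      proof (rule ccontr)
        assume no: "\<not> ?thesis"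
        define c where "c = lookup nu i"
        have c: "(Suc i, c) \<in> diagram la" using no by (simp add: diagram_def c_def)
        then have c': "(i, c) \<in> diagram la" using la unfolding is_part_def diagram_def by (auto intro: less_le_trans)
        then have "T (i, c) < T (Suc i, c)" using T c by (simp add: tableaux_def)
        then have "T (i, c) < d" using entry_le[OF T c] by simp
        then have "(i, c) \<in> diagram nu" using cell c' by simp
        then show False by (simp add: diagram_def c_def)
      qed
    qed
    moreover have "mono_degree la = mono_degree nu + a"
    proof -
      have "card {p \<in> diagram la. T p = d} = a" using T Mk[of d] by (simp add: tableaux_def)
      then show ?thesis using card_split[of T] entry_le[OF T] by (simp add: eq card_diagram)
    qed
    ultimately show ?thesis using T eq by (auto simp: hstrips_def TT_def)
  qed
  have card_TT: "card (TT nu) = card (tableaux nu m)" if nu: "nu \<in> hstrips a la" for nu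
  proof -
    have sub: "diagram nu \<subseteq> diagram la" using nu by (force simp: hstrips_def interlace_def diagram_def intro: less_le_trans)
    have above: "(r, c) \<in> diagram nu" if "(Suc r, c) \<in> diagram la" for r c
      using nu that by (auto simp: hstrips_def interlace_def diagram_def intro: less_le_trans)
    \<comment> \<open>The inverse of the restriction fills the strip with the letter
      \<open>d\<close>.\<close>
    define ext where "ext U = restrict (\<lambda>p. if p \<in> diagram nu then U p else d) (diagram la)" for U
    have "bij_betw (\<lambda>T. restrict T (diagram nu)) (TT nu) (tableaux nu m)"
    proof (rule bij_betw_byWitness[of _ ext])
      show "\<forall>T\<in>TT nu. ext (restrict T (diagram nu)) = T"
      proof
        fix T assume T: "T \<in> TT nu"
        then have T': "T \<in> tableaux la ?M" "{p \<in> diagram la. T p < d} = diagram nu" by (auto simp: TT_def)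
        show "ext (restrict T (diagram nu)) = T"
        proof
          fix p
          show "ext (restrict T (diagram nu)) p = T p"
          proof (cases "p \<in> diagram la")
            case True
            have "p \<in> diagram nu \<longleftrightarrow> T p < d" using T'(2) True by blast
            then show ?thesis using entry_le[OF T'(1) True] True by (cases "p \<in> diagram nu") (simp_all add: ext_def)
          next
            case False
            moreover have "T \<in> extensional (diagram la)" using T'(1) by (simp add: tableaux_def PiE_def)
            ultimately have "T p = undefined" using extensional_arb by metis
            then show ?thesis using False by (simp add: ext_def)
          qed
        qed
      qed
      show "\<forall>U\<in>tableaux nu m. restrict (ext U) (diagram nu) = U"
      proof
        fix U assume "U \<in> tableaux nu m"
        then have "U \<in> extensional (diagram nu)" by (auto simp: tableaux_def PiE_def)
        then show "restrict (ext U) (diagram nu) = U" using sub by (auto simp: ext_def restrict_def extensional_def fun_eq_iff)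
      qed
      show "(\<lambda>T. restrict T (diagram nu)) ` TT nu \<subseteq> tableaux nu m"
      proof
        fix U assume "U \<in> (\<lambda>T. restrict T (diagram nu)) ` TT nu"
        then obtain T where T: "T \<in> tableaux la ?M" "{p \<in> diagram la. T p < d} = diagram nu" "U = restrict T (diagram nu)" by (auto simp: TT_def)
        have "lookup m k = card {p \<in> diagram nu. restrict T (diagram nu) p = k}" for k
        proof (cases "k < d")
          case True
          have "{p \<in> diagram nu. restrict T (diagram nu) p = k} = {p \<in> diagram la. T p = k}" using T(2) True by auto
          then show ?thesis using T(1) True Mk[of k] by (simp add: tableaux_def)
        next
          case False
          then have "{p \<in> diagram nu. restrict T (diagram nu) p = k} = {}" using T(2) by auto
          then show ?thesis using md False by (metis card.empty not_le)
        qed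
        then show "U \<in> tableaux nu m" using T(1) sub unfolding T(3) by (simp add: tableaux_def subset_iff)
      qed
      show "ext ` tableaux nu m \<subseteq> TT nu"
      proof
        fix T assume "T \<in> ext ` tableaux nu m"
        then obtain U where U: "U \<in> tableaux nu m" "T = ext U" by blast
        have Ud: "U p < d" if "p \<in> diagram nu" for p using tableaux_entry[OF U(1) that] m by auto
        have T_nu: "T p = U p" if "p \<in> diagram nu" for p using that sub by (auto simp: U(2) ext_def)
        have T_d: "T p = d" if "p \<in> diagram la" "p \<notin> diagram nu" for p using that by (simp add: U(2) ext_def)
        have lt: "{p \<in> diagram la. T p < d} = diagram nu"
        proof (intro equalityI subsetI)
          fix p assume "p \<in> {p \<in> diagram la. T p < d}"
          then show "p \<in> diagram nu" using T_d[of p] by (cases "p \<in> diagram nu") auto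
        next
          fix p assume "p \<in> diagram nu"
          then show "p \<in> {p \<in> diagram la. T p < d}" using T_nu[of p] Ud[of p] sub by auto
        qed
        have T_le: "T p \<le> d" if "p \<in> diagram la" for p using T_nu T_d Ud that by (metis le_less)
        have content: "lookup ?M k = card {p \<in> diagram la. T p = k}" for k
        proof -
          consider "k < d" | "k = d" | "k > d" by linarith
          then show ?thesis
          proof cases
            case 1
            have "{p \<in> diagram la. T p = k} = {p \<in> diagram nu. U p = k}"
            proof (intro equalityI subsetI)
              fix p assume "p \<in> {p \<in> diagram la. T p = k}"
              then show "p \<in> {p \<in> diagram nu. U p = k}" using 1 T_d[of p] T_nu[of p] by (cases "p \<in> diagram nu") auto
            next
              fix p assume "p \<in> {p \<in> diagram nu. U p = k}"
              then show "p \<in> {p \<in> diagram la. T p = k}" using T_nu[of p] sub by auto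
            qed
            then show ?thesis using U(1) 1 Mk[of k] by (simp add: tableaux_def)
          next
            case 2
            have "card (diagram la) = card (diagram nu) + card {p \<in> diagram la. T p = d}" using card_split[of T] T_le lt by simp
            then show ?thesis using nu 2 Mk[of d] by (simp add: card_diagram hstrips_def)
          next
            case 3
            then have "{p \<in> diagram la. T p = k} = {}" using T_le by fastforce
            then show ?thesis using Mk[of k] md[of k] 3 by (metis card.empty less_imp_le less_irrefl)
          qed
        qed
        have rows: "T (r, c) \<le> T (r, c + 1)" if "(r, c) \<in> diagram la" "(r, c + 1) \<in> diagram la" for r c
        proof (cases "(r, c + 1) \<in> diagram nu")
          case True
          then have "(r, c) \<in> diagram nu" by (simp add: diagram_def)
          then show ?thesis using True U(1) T_nu by (simp add: tableaux_def)
        next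
          case False
          then show ?thesis using T_le that T_d by simp
        qed
        have cols: "T (r, c) < T (r + 1, c)" if "(r + 1, c) \<in> diagram la" for r c
        proof -
          have rc: "(r, c) \<in> diagram nu" using above that by simp
          show ?thesis
          proof (cases "(r + 1, c) \<in> diagram nu")
            case True
            then show ?thesis using rc U(1) T_nu by (simp add: tableaux_def)
          next
            case False
            then show ?thesis using rc that T_d T_nu Ud by simp
          qed
        qed
        have "T \<in> diagram la \<rightarrow>\<^sub>E UNIV" by (simp add: U(2) ext_def)
        then have "T \<in> tableaux la ?M" using rows cols content by (simp add: tableaux_def)
        then show "T \<in> TT nu" using lt by (simp add: TT_def)
      qed
    qed
    then show ?thesis by (rule bij_betw_same_card)
  qed
  have "tableaux la ?M = (\<Union>nu\<in>hstrips a la. TT nu)" using cover by (auto simp: TT_def)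
  moreover have "card (\<Union>nu\<in>hstrips a la. TT nu) = (\<Sum>nu\<in>hstrips a la. card (TT nu))"
  proof (rule card_UN_disjoint[OF finite_hstrips])
    show "\<forall>nu\<in>hstrips a la. finite (TT nu)" using finite_tableaux by (simp add: TT_def)
    show "\<forall>nu\<in>hstrips a la. \<forall>nu'\<in>hstrips a la. nu \<noteq> nu' \<longrightarrow> TT nu \<inter> TT nu' = {}"
      using diagram_inj by (auto simp: TT_def)
  qed
  ultimately show ?thesis using card_TT by (simp add: schur_fun_def)
qed

lemma nth_snoc: "Poly_Mapping.nth (xs @ [a]) = Poly_Mapping.nth xs + single (length xs) a"
  by (rule poly_mapping_eqI) (auto simp: lookup_add lookup_single when_def nth_default_def nth_append)

lemma nth_snoc_zero: "Poly_Mapping.nth (xs @ [0 :: nat]) = Poly_Mapping.nth xs"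
  using nth_trailing_zeros[of xs 1] by simp

lemma schur_fun_snoc:
  "is_part la \<Longrightarrow> schur_fun la (Poly_Mapping.nth (xs @ [a])) = (\<Sum>nu\<in>hstrips a la. schur_fun nu (Poly_Mapping.nth xs))"
  unfolding nth_snoc by (rule schur_fun_last[OF _ keys_nth_subset])

lemma hstrips_part: "nu \<in> hstrips a la \<Longrightarrow> is_part nu"
  using interlace_part by (auto simp: hstrips_def)

text \<open>The entries of a partition between \<open>la\<close> and \<open>rho\<close> range independently over intervals;
  reflecting all these intervals exchanges the sizes of the two strips.\<close>

definition reflect :: "(nat \<Rightarrow>\<^sub>0 nat) \<Rightarrow> (nat \<Rightarrow>\<^sub>0 nat) \<Rightarrow> (nat \<Rightarrow>\<^sub>0 nat) \<Rightarrow> nat \<Rightarrow> nat" where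
  "reflect la rho nu i = min (lookup la i) (case i of 0 \<Rightarrow> lookup la 0 | Suc j \<Rightarrow> lookup rho j)
     + max (lookup la (Suc i)) (lookup rho i) - lookup nu i"

lemma reflect_bounds:
  assumes "interlace la nu" "interlace nu rho"
  shows "max (lookup la (Suc i)) (lookup rho i) \<le> lookup nu i"
    "lookup nu i \<le> min (lookup la i) (case i of 0 \<Rightarrow> lookup la 0 | Suc j \<Rightarrow> lookup rho j)"
  using assms by (auto simp: interlace_def split: nat.splits)

text \<open>This is the Bender-Knuth involution seen on the middle partition of the chain
  \<open>rho\<close>, \<open>nu\<close>, \<open>la\<close>. The upper bound of row i + 1 is the
  minimum, and the lower bound of row i the maximum, of the same pair
  \<open>lookup la (i + 1)\<close>, \<open>lookup rho i\<close>; hence all bounds together add up to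
  the sizes of \<open>la\<close> and \<open>rho\<close>.\<close>

lemma reflect_spec:
  assumes "interlace la nu" "interlace nu rho"
  shows "\<exists>nu'. lookup nu' = reflect la rho nu \<and> interlace la nu' \<and> interlace nu' rho \<and>
    mono_degree nu + mono_degree nu' = mono_degree la + mono_degree rho \<and> reflect la rho nu' = lookup nu"
proof -
  note b = reflect_bounds[OF assms]
  let ?u = "\<lambda>i. min (lookup la i) (case i of 0 \<Rightarrow> lookup la 0 | Suc j \<Rightarrow> lookup rho j)"
  let ?l = "\<lambda>i. max (lookup la (Suc i)) (lookup rho i)"
  have r: "reflect la rho nu i \<le> ?u i" "?l i \<le> reflect la rho nu i" "lookup nu i + reflect la rho nu i = ?u i + ?l i" for i
    using b[of i] unfolding reflect_def by linarith+
  have "reflect la rho nu i \<le> lookup la i" for i using r(1)[of i] by simp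
  then obtain nu' where nu': "lookup nu' = reflect la rho nu" by (rule poly_mapping_of_fun)
  have "interlace la nu'" "interlace nu' rho"
    unfolding interlace_def nu' using r(1,2) by (auto simp: le_max_iff_disj) (metis min.bounded_iff nat.case(2) max.bounded_iff)+
  moreover have "reflect la rho nu' = lookup nu"
  proof
    fix i show "reflect la rho nu' i = lookup nu i"
      unfolding reflect_def[of la rho nu'] nu' using r(3)[of i] by linarith
  qed
  moreover have "mono_degree nu + mono_degree nu' = mono_degree la + mono_degree rho"
  proof -
    define N where "N = Suc (Max (keys la \<union> keys rho \<union> keys nu \<union> keys nu' \<union> {0}))"
    let ?K = "keys la \<union> keys rho \<union> keys nu \<union> keys nu' \<union> {0}"
    have "k < N" if "k \<in> ?K" for k using Max_ge[of ?K k] that by (simp add: N_def less_Suc_eq_le)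
    then have sub: "keys la \<subseteq> {..<N}" "keys rho \<subseteq> {..<N}" "keys nu \<subseteq> {..<N}" "keys nu' \<subseteq> {..<N}"
      by blast+
    have laN: "lookup la N = 0" using sub(1) by (auto simp: in_keys_iff)
    have "(\<Sum>i<N. ?u i) + (\<Sum>i<N. ?l i) = (\<Sum>i<N. lookup la i) + (\<Sum>i<N. lookup rho i)"
    proof -
      have u: "(\<Sum>i<Suc K. ?u i) + (\<Sum>i<K. ?l i) = (\<Sum>i<Suc K. lookup la i) + (\<Sum>i<K. lookup rho i)" for K
      proof (induction K)
        case (Suc K)
        have "?u (Suc K) + ?l K = lookup la (Suc K) + lookup rho K" by simp
        then show ?case using Suc unfolding sum.lessThan_Suc[of _ "Suc K"] sum.lessThan_Suc[of ?l] sum.lessThan_Suc[of "lookup rho"] by linarith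
      qed simp
      obtain K where K: "N = Suc K" by (simp add: N_def)
      \<comment> \<open>\<open>N\<close> lies beyond all rows, so the last lower bound, which has no
        upper bound to pair with, is just the entry of \<open>rho\<close>.\<close>
      have "?l K = lookup rho K" using laN by (simp add: K)
      then show ?thesis using u[of K] unfolding K by simp
    qed
    moreover have "(\<Sum>i<N. lookup nu i) + (\<Sum>i<N. lookup nu' i) = (\<Sum>i<N. ?u i) + (\<Sum>i<N. ?l i)"
      unfolding sum.distrib[symmetric] nu' r(3) ..
    ultimately show ?thesis using sub by (simp add: mono_degree_superset[of "{..<N}"])
  qed
  ultimately show ?thesis using nu' by blast
qed

text \<open>Reflecting the middle partition pairs the chains for the two orders of removal. For
  Schur functions this is the swap of two neighbouring variables.\<close>

lemma hstrips_commute: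
  "(\<Sum>nu\<in>hstrips b la. \<Sum>rho\<in>hstrips a nu. F rho) = (\<Sum>nu\<in>hstrips a la. \<Sum>rho\<in>hstrips b nu. (F rho :: complex))"
proof -
  define R where "R = (\<lambda>(nu, rho). (Abs_poly_mapping (reflect la rho nu), rho))"
  have R: "R p \<in> Sigma (hstrips a' la) (hstrips b') \<and> R (R p) = p \<and> snd (R p) = snd p"
    if "p \<in> Sigma (hstrips b' la) (hstrips a')" for p a' b'
  proof -
    obtain nu rho where p: "p = (nu, rho)" by fastforce
    have h: "interlace la nu" "interlace nu rho" "mono_degree la = mono_degree nu + b'" "mono_degree nu = mono_degree rho + a'"
      using that by (auto simp: p hstrips_def)
    obtain nu' where nu': "lookup nu' = reflect la rho nu" "interlace la nu'" "interlace nu' rho"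
      "mono_degree nu + mono_degree nu' = mono_degree la + mono_degree rho" "reflect la rho nu' = lookup nu"
      using reflect_spec[OF h(1,2)] by blast
    have "R p = (nu', rho)" unfolding p R_def by (simp add: nu'(1)[symmetric] lookup_inverse)
    moreover have "R (nu', rho) = p" unfolding p R_def by (simp add: nu'(5) lookup_inverse)
    ultimately show ?thesis using nu' h by (auto simp: hstrips_def p)
  qed
  have "(\<Sum>(nu, rho)\<in>Sigma (hstrips b la) (hstrips a). F rho) = (\<Sum>(nu, rho)\<in>Sigma (hstrips a la) (hstrips b). F rho)"
    by (rule sum.reindex_bij_witness[of _ R R]) (use R in \<open>auto simp: case_prod_beta\<close>)
  then show ?thesis by (simp add: sum.Sigma finite_hstrips)
qed

section \<open>Symmetry of the Schur functions\<close>

lemma schur_fun_swap: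
  assumes "is_part la"
  shows "schur_fun la (Poly_Mapping.nth (xs @ [a, b] @ ys)) = schur_fun la (Poly_Mapping.nth (xs @ [b, a] @ ys))"
  using assms
proof (induction ys arbitrary: la rule: rev_induct)
  case Nil
  have "schur_fun la (Poly_Mapping.nth ((xs @ [a]) @ [b])) = (\<Sum>nu\<in>hstrips b la. \<Sum>rho\<in>hstrips a nu. schur_fun rho (Poly_Mapping.nth xs))" for a b
    unfolding schur_fun_snoc[OF Nil] by (intro sum.cong refl schur_fun_snoc hstrips_part)
  then show ?case using hstrips_commute[where F = "\<lambda>rho. schur_fun rho (Poly_Mapping.nth xs)"] by simp
next
  case (snoc y ys)
  show ?case
    using schur_fun_snoc[OF snoc.prems, of "xs @ [a, b] @ ys" y] schur_fun_snoc[OF snoc.prems, of "xs @ [b, a] @ ys" y]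
      snoc.IH[OF hstrips_part] by simp
qed

lemma schur_fun_invariant:
  assumes "is_part la" shows "exponent_invariant (schur_fun la)"
  by (rule exponent_invariantI[of _ "\<lambda>xs. schur_fun la (Poly_Mapping.nth xs)"])
     (use schur_fun_swap[OF assms] in \<open>simp_all add: nth_idem nth_snoc_zero\<close>)

section \<open>Multiplication by the first Schur function\<close>

definition up_set :: "(nat \<Rightarrow>\<^sub>0 nat) \<Rightarrow> (nat \<Rightarrow>\<^sub>0 nat) set" where
  "up_set mu = {la. is_part la \<and> (\<exists>i. la = mu + single i 1)}"

text \<open>Adding a box is the transpose of removing one; the adjointness of s_1 and its dual
  operator rests on this relation.\<close>

lemma up_set_hstrips:
  assumes "is_part la" "is_part mu"
  shows "la \<in> up_set mu \<longleftrightarrow> mu \<in> hstrips 1 la"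
proof
  assume "la \<in> up_set mu"
  then obtain i where i: "la = mu + single i 1" by (auto simp: up_set_def)
  have lk: "lookup la j = lookup mu j + (if i = j then 1 else 0)" for j
    by (simp add: i lookup_add lookup_single when_def)
  have "interlace la mu" unfolding interlace_def
  proof (intro allI conjI)
    fix j
    show "lookup la (Suc j) \<le> lookup mu j"
      using assms[unfolded is_part_def, rule_format, of j] lk[of j] lk[of "Suc j"] by (auto split: if_splits)
  qed (simp add: lk)
  then show "mu \<in> hstrips 1 la" by (simp add: hstrips_def i)
next
  assume h: "mu \<in> hstrips 1 la"
  have le: "lookup mu j \<le> lookup la j" for j using h by (simp add: hstrips_def interlace_def)
  have add: "mu + (la - mu) = la" by (rule poly_mapping_eqI) (simp add: lookup_add lookup_minus le)
  then have "mono_degree mu + mono_degree (la - mu) = mono_degree mu + 1" using h mono_degree_add[of mu "la - mu"] by (simp add: hstrips_def)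
  then have 1: "mono_degree (la - mu) = 1" by simp
  then obtain i where "i \<in> keys (la - mu)" by (fastforce simp: mono_degree_def)
  define e where "e = la - mu"
  have e: "single i 1 + (e - single i 1) = e"
    using \<open>i \<in> _\<close> by (intro poly_mapping_eqI) (auto simp: lookup_add lookup_minus lookup_single when_def e_def[symmetric] in_keys_iff)
  then have "mono_degree (e - single i 1) = 0"
    using 1 mono_degree_add[of "single i 1" "e - single i 1"] by (simp add: e_def[symmetric])
  then have "e = single i 1" using e by (simp add: mono_degree_eq_0)
  then show "la \<in> up_set mu" using add assms by (auto simp: up_set_def e_def)
qed

lemma single_Suc_0_eq [simp]: "single i (Suc 0) = single j (Suc 0) \<longleftrightarrow> i = j"
  by (metis lookup_single_eq lookup_single_not_eq nat.distinct(1))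

lemma inj_add_single: "inj (\<lambda>i. mu + single i (1::nat))"
  by (simp add: inj_on_def)

lemma finite_up_set:
  assumes "is_part mu" shows "finite (up_set mu)"
proof (rule finite_subset)
  show "up_set mu \<subseteq> (\<lambda>i. mu + single i 1) ` {..degree mu}"
  proof
    fix la assume "la \<in> up_set mu"
    then obtain i where la: "is_part la" "la = mu + single i 1" by (auto simp: up_set_def)
    have "i \<le> degree mu"
    proof (rule ccontr)
      assume "\<not> ?thesis"
      then have "lookup la (degree mu) = 0" "lookup la i \<noteq> 0" "degree mu \<le> i"
        by (auto simp: la lookup_add beyond_degree_lookup_zero lookup_single when_def)
      then show False using is_part_mono[OF la(1)] by (metis le_zero_eq)
    qed
    then show "la \<in> (\<lambda>i. mu + single i 1) ` {..degree mu}" using la by auto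
  qed
qed simp

text \<open>The local rule of the Robinson-Schensted correspondence: adding a box to \<open>mu\<close> and then removing
  a horizontal strip, versus removing first.\<close>

lemma pieri_local:
  assumes mu: "is_part mu"
  shows "(\<Sum>la\<in>up_set mu. \<Sum>nu\<in>hstrips a la. F nu) =
    (\<Sum>rho\<in>hstrips a mu. \<Sum>nu\<in>up_set rho. F nu) + (if 0 < a then \<Sum>nu\<in>hstrips (a - 1) mu. F nu else (0::complex))"
proof -
  let ?l = lookup
  let ?e = "\<lambda>i. single i (1::nat)"
  \<comment> \<open>Both double sums are indexed by a row i and the final \<open>nu\<close>: in
    \<open>R\<close> the box is first added to row i of \<open>mu\<close>, in \<open>L\<close> it is
    added last, in row i of \<open>nu\<close>. \<open>N\<close> collects the shapes of the extra
    term.\<close>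
  define R where "R = {(i, nu). interlace (mu + ?e i) nu \<and> mono_degree mu + 1 = mono_degree nu + a}"
  define L where "L = {(i, nu). is_part nu \<and> 0 < ?l nu i \<and> interlace mu (nu - ?e i) \<and> mono_degree mu + 1 = mono_degree nu + a}"
  define N where "N = {nu. interlace mu nu \<and> mono_degree mu + 1 = mono_degree nu + a}"
  have lmu: "?l (mu + ?e i) j = ?l mu j + (if i = j then 1 else 0)" for i j by (simp add: lookup_add lookup_single when_def)
  have lnu: "?l (nu - ?e i) j = ?l nu j - (if i = j then 1 else 0)" for nu i j by (simp add: lookup_minus lookup_single when_def)
  have sub_add: "nu - ?e i + ?e i = nu" if "0 < ?l nu i" for nu i
    by (rule poly_mapping_eqI) (use that in \<open>auto simp: lookup_add lookup_minus lookup_single when_def\<close>)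
  have "(\<Sum>la\<in>up_set mu. \<Sum>nu\<in>hstrips a la. F nu) = (\<Sum>(la, nu)\<in>Sigma (up_set mu) (hstrips a). F nu)"
    by (simp add: sum.Sigma finite_hstrips finite_up_set[OF mu])
  also have "Sigma (up_set mu) (hstrips a) = (\<lambda>(i, nu). (mu + ?e i, nu)) ` R"
    using interlace_part by (auto simp: R_def up_set_def hstrips_def image_iff)
  also have "(\<Sum>(la, nu)\<in>(\<lambda>(i, nu). (mu + ?e i, nu)) ` R. F nu) = (\<Sum>(i, nu)\<in>R. F nu)"
    by (subst sum.reindex) (use inj_add_single[of mu] in \<open>auto simp: inj_on_def case_prod_unfold\<close>)
  finally have RR: "(\<Sum>la\<in>up_set mu. \<Sum>nu\<in>hstrips a la. F nu) = (\<Sum>(i, nu)\<in>R. F nu)" .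
  have "(\<Sum>rho\<in>hstrips a mu. \<Sum>nu\<in>up_set rho. F nu) = (\<Sum>(rho, nu)\<in>Sigma (hstrips a mu) up_set. F nu)"
    by (simp add: sum.Sigma finite_hstrips finite_up_set hstrips_part)
  also have "Sigma (hstrips a mu) up_set = (\<lambda>(i, nu). (nu - ?e i, nu)) ` L"
  proof (intro equalityI subsetI)
    fix p assume "p \<in> Sigma (hstrips a mu) up_set"
    then obtain rho i where p: "p = (rho, rho + ?e i)" "rho \<in> hstrips a mu" "is_part (rho + ?e i)" by (auto simp: up_set_def)
    then have "(i, rho + ?e i) \<in> L" by (auto simp: L_def hstrips_def lookup_add)
    then show "p \<in> (\<lambda>(i, nu). (nu - ?e i, nu)) ` L" using p(1) by (auto simp: image_iff intro!: bexI[of _ "(i, rho + ?e i)"])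
  next
    fix p assume "p \<in> (\<lambda>(i, nu). (nu - ?e i, nu)) ` L"
    then obtain i nu where p: "p = (nu - ?e i, nu)" "(i, nu) \<in> L" by auto
    then have "nu - ?e i + ?e i = nu" using sub_add by (auto simp: L_def)
    moreover from this have "mono_degree nu = mono_degree (nu - ?e i) + 1" by (metis mono_degree_add mono_degree_single)
    ultimately show "p \<in> Sigma (hstrips a mu) up_set" using p by (auto simp: L_def hstrips_def up_set_def intro: exI[of _ i])
  qed
  also have "(\<Sum>(rho, nu)\<in>(\<lambda>(i, nu). (nu - ?e i, nu)) ` L. F nu) = (\<Sum>(i, nu)\<in>L. F nu)"
  proof (subst sum.reindex)
    have "i = j" if "0 < ?l nu i" "0 < ?l nu j" "nu - ?e i = nu - ?e j" for i j nu
    proof (rule ccontr)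
      assume "i \<noteq> j"
      then have "?l (nu - ?e j) i = ?l nu i" using lnu[of nu j i] by simp
      then show False using that lnu[of nu i i] by simp
    qed
    then show "inj_on (\<lambda>(i, nu). (nu - ?e i, nu)) L" by (auto simp: inj_on_def L_def)
  qed (simp add: case_prod_unfold)
  finally have LL: "(\<Sum>rho\<in>hstrips a mu. \<Sum>nu\<in>up_set rho. F nu) = (\<Sum>(i, nu)\<in>L. F nu)" .
  have NN: "(if 0 < a then \<Sum>nu\<in>hstrips (a - 1) mu. F nu else 0) = (\<Sum>nu\<in>N. F nu)"
  proof (cases "0 < a")
    case True
    then have "hstrips (a - 1) mu = N" by (auto simp: hstrips_def N_def)
    then show ?thesis using True by simp
  next
    case False
    have "mono_degree nu \<le> mono_degree mu" if "interlace mu nu" for nu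
    proof -
      have "mono_degree nu = (\<Sum>k\<in>keys mu \<union> keys nu. ?l nu k)" by (rule mono_degree_superset) auto
      also have "\<dots> \<le> (\<Sum>k\<in>keys mu \<union> keys nu. ?l mu k)" using that by (intro sum_mono) (simp add: interlace_def)
      also have "\<dots> = mono_degree mu" by (rule mono_degree_superset[symmetric]) auto
      finally show ?thesis .
    qed
    then have "N = {}" using False by (fastforce simp: N_def)
    then show ?thesis using False by simp
  qed
  \<comment> \<open>If \<open>nu\<close> interlaces with \<open>mu\<close> itself, row i + 1 is
    admissible for \<open>R\<close> exactly when row i is for \<open>L\<close>. Row 0 is always
    admissible for \<open>R\<close>; it is left over and gives \<open>N\<close>.\<close>
  have R_in: "interlace (mu + ?e i) nu \<longleftrightarrow> (case i of 0 \<Rightarrow> True | Suc j \<Rightarrow> ?l mu i < ?l nu j)" if "interlace mu nu" for i nu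
    using that unfolding interlace_def lmu by (cases i) (auto split: if_splits intro: le_SucI)
  have L_in: "is_part nu \<and> 0 < ?l nu i \<and> interlace mu (nu - ?e i) \<longleftrightarrow> ?l mu (Suc i) < ?l nu i" if "interlace mu nu" for i nu
    using that interlace_part(2)[OF that] unfolding interlace_def lnu by (auto split: if_splits simp: less_eq_Suc_le) (metis diff_le_self le_trans Suc_le_eq Suc_pred' le_less_trans not_le)+
  \<comment> \<open>Otherwise \<open>nu\<close> exceeds \<open>mu\<close> in row i alone, by one
    box, and adding this box before or after the removal of the strip comes to the same.\<close>
  have out: "interlace (mu + ?e i) nu \<longleftrightarrow> is_part nu \<and> 0 < ?l nu i \<and> interlace mu (nu - ?e i)" if "\<not> interlace mu nu" for i nu
  proof
    assume r: "interlace (mu + ?e i) nu"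
    have nu: "is_part nu" by (rule interlace_part(2)[OF r])
    have r1: "?l nu j \<le> ?l mu j + (if i = j then 1 else 0)" "?l mu (Suc j) + (if i = Suc j then 1 else 0) \<le> ?l nu j" for j
      using r unfolding interlace_def lmu by auto
    have "?l nu i = ?l mu i + 1"
    proof (rule ccontr)
      assume "?l nu i \<noteq> ?l mu i + 1"
      then have "interlace mu nu" unfolding interlace_def using r1 by (metis add.right_neutral add_leD1 le_SucE Suc_eq_plus1)
      then show False using that by simp
    qed
    moreover have "interlace mu (nu - ?e i)" unfolding interlace_def lnu
    proof (intro allI conjI)
      fix j
      show "?l nu j - (if i = j then 1 else 0) \<le> ?l mu j" using r1(1)[of j] by auto
      show "?l mu (Suc j) \<le> ?l nu j - (if i = j then 1 else 0)"
        using r1(2)[of j] \<open>?l nu i = _\<close> mu by (auto simp: is_part_def split: if_splits)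
    qed
    ultimately show "is_part nu \<and> 0 < ?l nu i \<and> interlace mu (nu - ?e i)" using nu by simp
  next
    assume l: "is_part nu \<and> 0 < ?l nu i \<and> interlace mu (nu - ?e i)"
    have l1: "?l nu j - (if i = j then 1 else 0) \<le> ?l mu j" "?l mu (Suc j) \<le> ?l nu j - (if i = j then 1 else 0)" for j
      using l unfolding interlace_def lnu by auto
    have eq: "?l nu i = ?l mu i + 1"
    proof (rule ccontr)
      assume ne: "?l nu i \<noteq> ?l mu i + 1"
      have "?l nu j \<le> ?l mu j" "?l mu (Suc j) \<le> ?l nu j" for j
        using l1[of j] ne by (auto split: if_splits)
      then have "interlace mu nu" unfolding interlace_def by blast
      then show False using that by simp
    qed
    show "interlace (mu + ?e i) nu" unfolding interlace_def lmu
    proof (intro allI conjI)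
      fix j
      show "?l nu j \<le> ?l mu j + (if i = j then 1 else 0)" using l1(1)[of j] by (auto split: if_splits)
      show "?l mu (Suc j) + (if i = Suc j then 1 else 0) \<le> ?l nu j"
        using l1(2)[of j] eq l[THEN conjunct1, unfolded is_part_def, rule_format, of j] by (auto split: if_splits)
    qed
  qed
  have R_split: "R = (\<lambda>nu. (0, nu)) ` N \<union> (\<lambda>(i, nu). (if interlace mu nu then Suc i else i, nu)) ` L"
  proof (intro equalityI subsetI)
    fix p assume p: "p \<in> R"
    obtain i nu where pi: "p = (i, nu)" by fastforce
    show "p \<in> (\<lambda>nu. (0, nu)) ` N \<union> (\<lambda>(i, nu). (if interlace mu nu then Suc i else i, nu)) ` L"
    proof (cases "interlace mu nu")
      case True
      show ?thesis
      proof (cases i)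
        case 0 then show ?thesis using p pi True by (auto simp: R_def N_def)
      next
        case (Suc j)
        then have "(j, nu) \<in> L" using p pi True R_in[OF True] L_in[OF True] by (auto simp: R_def L_def)
        then show ?thesis using pi Suc True by (auto simp: image_iff intro!: bexI[of _ "(j, nu)"])
      qed
    next
      case False
      then have "(i, nu) \<in> L" using p pi out[OF False] by (auto simp: R_def L_def)
      then show ?thesis using pi False by (auto simp: image_iff intro!: bexI[of _ "(i, nu)"])
    qed
  next
    fix p assume "p \<in> (\<lambda>nu. (0, nu)) ` N \<union> (\<lambda>(i, nu). (if interlace mu nu then Suc i else i, nu)) ` L"
    then consider nu where "p = (0, nu)" "nu \<in> N" | i nu where "p = (if interlace mu nu then Suc i else i, nu)" "(i, nu) \<in> L" by auto
    then show "p \<in> R"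
    proof cases
      case 1 then show ?thesis using R_in[of nu 0] by (auto simp: R_def N_def)
    next
      case 2
      then show ?thesis using R_in[of nu "Suc i"] L_in[of nu i] out[of nu i] by (cases "interlace mu nu") (auto simp: R_def L_def)
    qed
  qed
  have finR: "finite R"
  proof -
    have "finite (Sigma (up_set mu) (hstrips a))" by (intro finite_SigmaI finite_up_set[OF mu] finite_hstrips)
    then have "finite ((\<lambda>(i, nu). (mu + ?e i, nu)) ` R)"
      using \<open>Sigma (up_set mu) (hstrips a) = (\<lambda>(i, nu). (mu + ?e i, nu)) ` R\<close> by simp
    then show ?thesis by (rule finite_imageD) (use inj_add_single[of mu] in \<open>auto simp: inj_on_def\<close>)
  qed
  have "(\<Sum>(i, nu)\<in>R. F nu) = (\<Sum>(i, nu)\<in>(\<lambda>nu. (0::nat, nu)) ` N. F nu)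
     + (\<Sum>(i, nu)\<in>(\<lambda>(i, nu). (if interlace mu nu then Suc i else i, nu)) ` L. F nu)"
    unfolding R_split by (rule sum.union_disjoint) (use finR R_split in \<open>auto simp: N_def split: if_splits\<close>)
  also have "(\<Sum>(i, nu)\<in>(\<lambda>nu. (0::nat, nu)) ` N. F nu) = (\<Sum>nu\<in>N. F nu)"
    by (subst sum.reindex) (auto simp: inj_on_def)
  also have "(\<Sum>(i, nu)\<in>(\<lambda>(i, nu). (if interlace mu nu then Suc i else i, nu)) ` L. F nu) = (\<Sum>(i, nu)\<in>L. F nu)"
    by (subst sum.reindex) (auto simp: inj_on_def case_prod_unfold split: if_splits)
  finally show ?thesis unfolding RR LL NN by (simp add: add.commute)
qed

lemma schur_one: "schur [1] m = (if \<exists>k. m = single k 1 then 1 else 0)"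
proof -
  let ?d = "{(0::nat, 0::nat)}"
  have d: "cells [1] = ?d" by (auto simp: cells_def)
  have T: "{T \<in> ssyt [1]. \<forall>k. lookup m k = card {p \<in> cells [1]. T p = k}} =
    {T \<in> ?d \<rightarrow>\<^sub>E UNIV. m = single (T (0, 0)) 1}"
  proof -
    have "(\<forall>k. lookup m k = card {p \<in> ?d. T p = k}) \<longleftrightarrow> m = single (T (0, 0)) 1" for T
    proof -
      have "card {p \<in> ?d. T p = k} = lookup (single (T (0, 0)) 1) k" for k
      proof -
        have "{p \<in> ?d. T p = k} = (if T (0, 0) = k then ?d else {})" by auto
        then show ?thesis by (simp add: lookup_single when_def)
      qed
      then show ?thesis by (auto intro: poly_mapping_eqI)
    qed
    then show ?thesis unfolding ssyt_def d by auto
  qed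
  show ?thesis
  proof (cases "\<exists>k. m = single k 1")
    case True
    then obtain k where k: "m = single k 1" by blast
    have "{T \<in> ?d \<rightarrow>\<^sub>E UNIV. m = single (T (0, 0)) 1} = {restrict (\<lambda>_. k) ?d}"
    proof (intro equalityI subsetI)
      fix T assume "T \<in> {T \<in> ?d \<rightarrow>\<^sub>E UNIV. m = single (T (0, 0)) 1}"
      then have "T \<in> extensional ?d" "T (0, 0) = k" by (auto simp: k PiE_def)
      then show "T \<in> {restrict (\<lambda>_. k) ?d}" by (auto simp: extensional_def restrict_def fun_eq_iff)
    qed (auto simp: k)
    then show ?thesis using True T by (simp add: schur_def)
  next
    case False
    then have "{T \<in> ?d \<rightarrow>\<^sub>E UNIV. m = single (T (0, 0)) 1} = {}" by auto
    then show ?thesis using False T unfolding schur_def by (simp only: card.empty of_nat_0 if_False)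
  qed
qed

lemma series_mult_schur_one:
  "series_mult (schur [1]) f m = (\<Sum>k\<in>keys m. f (m - single k 1))"
proof -
  let ?e = "\<lambda>k. single k (1::nat)"
  let ?P = "{(a, b). a + b = m}"
  have e: "?e k + (m - ?e k) = m" if "k \<in> keys m" for k
    by (rule poly_mapping_eqI) (use that in \<open>auto simp: lookup_add lookup_minus lookup_single when_def in_keys_iff\<close>)
  have "series_mult (schur [1]) f m = (\<Sum>(a, b)\<in>?P. schur [1] a * f b)" by (simp add: series_mult_def)
  also have "\<dots> = (\<Sum>(a, b)\<in>(\<lambda>k. (?e k, m - ?e k)) ` keys m. schur [1] a * f b)"
  proof (rule sum.mono_neutral_right[OF finite_add_decomp])
    show "(\<lambda>k. (?e k, m - ?e k)) ` keys m \<subseteq> ?P" using e by auto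
    show "\<forall>p\<in>?P - (\<lambda>k. (?e k, m - ?e k)) ` keys m. (case p of (a, b) \<Rightarrow> schur [1] a * f b) = 0"
    proof (clarify, rule ccontr)
      fix a b assume ab: "(a, b) \<notin> (\<lambda>k. (?e k, a + b - ?e k)) ` keys (a + b)" "m = a + b" "schur [1] a * f b \<noteq> 0"
      then obtain k where k: "a = ?e k" by (auto simp: schur_one[unfolded One_nat_def] split: if_splits)
      have "k \<in> keys (a + b)" by (simp add: k in_keys_iff lookup_add)
      moreover have "a + b - ?e k = b" by (simp add: k)
      ultimately show False using ab(1) k by (auto simp: image_iff)
    qed
  qed
  also have "\<dots> = (\<Sum>k\<in>keys m. f (m - ?e k))"
    by (subst sum.reindex) (use inj_add_single[of 0] in \<open>auto simp: inj_on_def schur_one[unfolded One_nat_def]\<close>)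
  finally show ?thesis .
qed

text \<open>Multiplication by s_1 lowers one exponent of the monomial at a time. Induction on the
  number of variables: splitting off the strip of the last variable reduces the claim to the local
  rule, whose extra term is the case where the last exponent is the one lowered.\<close>

lemma pieri_one:
  assumes "is_part mu"
  shows "series_mult (schur [1]) (schur_fun mu) m = (\<Sum>la\<in>up_set mu. schur_fun la m)"
proof -
  let ?e = "\<lambda>k. single k (1::nat)"
  have "(\<Sum>k\<in>keys m. schur_fun mu (m - ?e k)) = (\<Sum>la\<in>up_set mu. schur_fun la m)" if "keys m \<subseteq> {..<d}" for d
    using that assms
  proof (induction d arbitrary: m mu)
    case 0
    then have m: "m = 0" by simp
    have "schur_fun la 0 = 0" if "la \<in> up_set mu" for la
    proof -
      have "mono_degree la \<noteq> 0" using that by (auto simp: up_set_def)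
      then show ?thesis by (auto simp: schur_fun_zero)
    qed
    then show ?case by (simp add: m)
  next
    case (Suc d)
    define a where "a = lookup m d"
    define m' where "m' = Poly_Mapping.update d 0 m"
    have m: "m = m' + single d a"
      by (rule poly_mapping_eqI) (auto simp: m'_def a_def lookup_add lookup_single when_def update.rep_eq)
    have km': "keys m' \<subseteq> {..<d}" using Suc.prems(1) by (auto simp: m'_def keys_update less_Suc_eq subset_iff)
    have keys_m: "keys m = keys m' \<union> (if 0 < a then {d} else {})"
      by (auto simp: m'_def a_def keys_update in_keys_iff)
    have dm': "d \<notin> keys m'" using km' by auto
    have 1: "schur_fun mu (m - ?e k) = (\<Sum>rho\<in>hstrips a mu. schur_fun rho (m' - ?e k))" if k: "k \<in> keys m'" for k
    proof -
      have "k \<noteq> d" using km' k by auto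
      then have eq: "m - ?e k = (m' - ?e k) + single d a"
        using k by (intro poly_mapping_eqI) (auto simp: m lookup_add lookup_minus lookup_single when_def in_keys_iff)
      have "keys (m' - ?e k) \<subseteq> {..<d}" using km' by (auto simp: in_keys_iff lookup_minus subset_iff)
      then show ?thesis unfolding eq by (rule schur_fun_last[OF Suc.prems(2)])
    qed
    have 2: "schur_fun mu (m - ?e d) = (\<Sum>rho\<in>hstrips (a - 1) mu. schur_fun rho m')" if "0 < a"
    proof -
      have "m - ?e d = m' + single d (a - 1)"
        by (intro poly_mapping_eqI) (use dm' in \<open>auto simp: m lookup_add lookup_minus lookup_single when_def in_keys_iff\<close>)
      then show ?thesis using schur_fun_last[OF Suc.prems(2) km'] by simp
    qed
    have "(\<Sum>k\<in>keys m. schur_fun mu (m - ?e k)) = (\<Sum>k\<in>keys m'. schur_fun mu (m - ?e k))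
       + (if 0 < a then schur_fun mu (m - ?e d) else 0)"
      using dm' by (simp add: keys_m)
    also have "\<dots> = (\<Sum>rho\<in>hstrips a mu. \<Sum>k\<in>keys m'. schur_fun rho (m' - ?e k))
       + (if 0 < a then \<Sum>rho\<in>hstrips (a - 1) mu. schur_fun rho m' else 0)"
      using 1 2 by (simp add: sum.swap[of _ "keys m'"])
    also have "\<dots> = (\<Sum>rho\<in>hstrips a mu. \<Sum>nu\<in>up_set rho. schur_fun nu m')
       + (if 0 < a then \<Sum>rho\<in>hstrips (a - 1) mu. schur_fun rho m' else 0)"
      using Suc.IH[OF km' hstrips_part] by simp
    also have "\<dots> = (\<Sum>la\<in>up_set mu. \<Sum>nu\<in>hstrips a la. schur_fun nu m')"
      by (rule pieri_local[OF Suc.prems(2), symmetric])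
    also have "\<dots> = (\<Sum>la\<in>up_set mu. schur_fun la m)"
      unfolding m by (intro sum.cong refl schur_fun_last[symmetric] km') (auto simp: up_set_def)
    finally show ?case .
  qed
  then show ?thesis using keys_degree series_mult_schur_one by metis
qed

section \<open>The Schur basis and the Hall inner product\<close>

text \<open>The statistic usually called n(lambda), with rows numbered from 0. It plays the part of
  the dominance order: it is additive over boxes, so it can be followed strip by strip, and it makes
  the Schur functions unitriangular.\<close>

definition row_stat :: "(nat \<Rightarrow>\<^sub>0 nat) \<Rightarrow> nat" where
  "row_stat la = (\<Sum>i\<in>keys la. i * lookup la i)"

lemma row_stat_superset:
  assumes "finite S" "keys m \<subseteq> S"
  shows "row_stat m = (\<Sum>k\<in>S. k * lookup m k)"
  unfolding row_stat_def by (rule sum.mono_neutral_left) (use assms in \<open>auto simp: in_keys_iff\<close>)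

lemma row_stat_add: "row_stat (a + b) = row_stat a + row_stat b"
proof -
  let ?S = "keys a \<union> keys b"
  have "keys (a + b) \<subseteq> ?S" by (rule Poly_Mapping.keys_add)
  then show ?thesis by (simp add: row_stat_superset[of ?S] lookup_add sum.distrib algebra_simps)
qed

lemma row_stat_single: "row_stat (single r v) = r * v"
  by (simp add: row_stat_def)

text \<open>A strip added to a shape with at most r rows lies in rows 0 to r, so each of its boxes
  contributes at most r, and equality forces all of them into row r.\<close>

lemma hstrips_row_stat:
  assumes nu: "nu \<in> hstrips a la" "keys nu \<subseteq> {..<r}"
  shows "keys la \<subseteq> {..<Suc r}" "row_stat la \<le> row_stat nu + r * a"
    "row_stat la = row_stat nu + r * a \<Longrightarrow> la = nu + single r a"
proof -
  have il: "lookup nu i \<le> lookup la i" "lookup la (Suc i) \<le> lookup nu i" for i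
    using nu(1) by (auto simp: hstrips_def interlace_def)
  show keys: "keys la \<subseteq> {..<Suc r}"
  proof
    fix i assume i: "i \<in> keys la"
    show "i \<in> {..<Suc r}"
    proof (cases i)
      case (Suc j)
      then have "j \<in> keys nu" using i il(2)[of j] by (auto simp: in_keys_iff)
      then show ?thesis using nu(2) Suc by auto
    qed simp
  qed
  define e where "e = la - nu"
  have la: "la = nu + e" by (rule poly_mapping_eqI) (simp add: e_def lookup_add lookup_minus il)
  have ke: "keys e \<subseteq> {..<Suc r}" using keys by (auto simp: e_def in_keys_iff lookup_minus subset_iff)
  have a: "mono_degree e = a" using nu(1) by (simp add: hstrips_def la)
  have e1: "row_stat e = (\<Sum>k<Suc r. k * lookup e k)" "r * a = (\<Sum>k<Suc r. r * lookup e k)"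
    using ke a by (simp_all add: row_stat_superset[of "{..<Suc r}"] mono_degree_superset[of "{..<Suc r}"] sum_distrib_left[symmetric] del: sum.lessThan_Suc)
  have le: "row_stat e \<le> r * a" unfolding e1 by (intro sum_mono mult_right_mono) auto
  then show "row_stat la \<le> row_stat nu + r * a" by (simp add: la row_stat_add)
  assume "row_stat la = row_stat nu + r * a"
  then have eq: "(\<Sum>k<Suc r. k * lookup e k) = (\<Sum>k<Suc r. r * lookup e k)" by (simp add: la row_stat_add e1[symmetric] del: sum.lessThan_Suc)
  have mult_eq: "k * lookup e k = r * lookup e k" if "k < Suc r" for k
    by (rule sum_mono_inv[OF eq]) (use that in auto)
  have "lookup e k = 0" if "k < r" for k using mult_eq[of k] that by simp
  moreover have "lookup e k = 0" if "r < k" for k using ke that by (auto simp: in_keys_iff subset_iff)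
  ultimately have "e = single r (lookup e r)"
    by (intro poly_mapping_eqI) (metis lookup_single_eq lookup_single_not_eq nat_neq_iff)
  then have "e = single r a" using a by (metis mono_degree_single)
  then show "la = nu + single r a" by (simp add: la)
qed

text \<open>Peeling off the letters adds up the bounds for the strips. Equality in total forces
  equality in each strip, and the shape is then rebuilt row by row as the exponent vector.\<close>

lemma schur_fun_row_stat:
  assumes "is_part la" "schur_fun la (Poly_Mapping.nth xs) \<noteq> 0"
  shows "keys la \<subseteq> {..<length xs} \<and> row_stat la \<le> row_stat (Poly_Mapping.nth xs) \<and>
    (row_stat la = row_stat (Poly_Mapping.nth xs) \<longrightarrow> la = Poly_Mapping.nth xs)"
  using assms
proof (induction xs arbitrary: la rule: rev_induct)
  case Nil
  then have "la = 0" by (simp add: schur_fun_zero split: if_splits)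
  then show ?case by simp
next
  case (snoc a xs)
  from snoc.prems(2) obtain nu where nu: "nu \<in> hstrips a la" "schur_fun nu (Poly_Mapping.nth xs) \<noteq> 0"
    unfolding schur_fun_snoc[OF snoc.prems(1)] by (rule sum.not_neutral_contains_not_neutral)
  have IH: "keys nu \<subseteq> {..<length xs}" "row_stat nu \<le> row_stat (Poly_Mapping.nth xs)"
    "row_stat nu = row_stat (Poly_Mapping.nth xs) \<Longrightarrow> nu = Poly_Mapping.nth xs"
    using snoc.IH[OF hstrips_part[OF nu(1)] nu(2)] by auto
  note st = hstrips_row_stat[OF nu(1) IH(1)]
  have n: "row_stat (Poly_Mapping.nth (xs @ [a])) = row_stat (Poly_Mapping.nth xs) + length xs * a"
    by (simp add: nth_snoc row_stat_add row_stat_single)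
  show ?case
  proof (intro conjI impI)
    show "keys la \<subseteq> {..<length (xs @ [a])}" using st(1) by simp
    show "row_stat la \<le> row_stat (Poly_Mapping.nth (xs @ [a]))" using st(2) IH(2) n by simp
    assume "row_stat la = row_stat (Poly_Mapping.nth (xs @ [a]))"
    then have "row_stat la = row_stat nu + length xs * a" "row_stat nu = row_stat (Poly_Mapping.nth xs)"
      using st(2) IH(2) n by linarith+
    then show "la = Poly_Mapping.nth (xs @ [a])" using st(3) IH(3) by (simp add: nth_snoc)
  qed
qed

lemma schur_fun_diag_nth:
  assumes "is_part (Poly_Mapping.nth xs)"
  shows "schur_fun (Poly_Mapping.nth xs) (Poly_Mapping.nth xs) = 1"
  using assms
proof (induction xs rule: rev_induct)
  case Nil
  show ?case by (simp add: schur_fun_zero)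
next
  case (snoc a xs)
  let ?la = "Poly_Mapping.nth (xs @ [a])" and ?nu = "Poly_Mapping.nth xs"
  have n: "row_stat ?la = row_stat ?nu + length xs * a" by (simp add: nth_snoc row_stat_add row_stat_single)
  have lk: "lookup ?la i = (if i < length xs then lookup ?nu i else if i = length xs then a else 0)" for i
    by (auto simp: nth_default_def nth_append)
  have il: "interlace ?la ?nu" unfolding interlace_def
  proof (intro allI conjI)
    fix i
    show "lookup ?nu i \<le> lookup ?la i" unfolding lk by (auto simp: lookup_nth_ge simp del: lookup_nth)
    show "lookup ?la (Suc i) \<le> lookup ?nu i"
      using snoc.prems[unfolded is_part_def, rule_format, of i] lk[of i] lk[of "Suc i"] by (auto split: if_splits)
  qed
  then have mem: "?nu \<in> hstrips a ?la" by (simp add: hstrips_def nth_snoc)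
  have "schur_fun ?la ?la = (\<Sum>nu\<in>hstrips a ?la. schur_fun nu ?nu)" by (rule schur_fun_snoc[OF snoc.prems])
  also have "\<dots> = (\<Sum>nu\<in>{?nu}. schur_fun nu ?nu)"
  proof (rule sum.mono_neutral_right[OF finite_hstrips])
    show "\<forall>nu\<in>hstrips a ?la - {?nu}. schur_fun nu ?nu = 0"
    proof (intro ballI, rule ccontr)
      fix nu assume nu: "nu \<in> hstrips a ?la - {?nu}" "schur_fun nu ?nu \<noteq> 0"
      have s: "keys nu \<subseteq> {..<length xs}" "row_stat nu \<le> row_stat ?nu" "row_stat nu = row_stat ?nu \<Longrightarrow> nu = ?nu"
        using schur_fun_row_stat[OF hstrips_part nu(2)] nu(1) by blast+
      have "row_stat ?la \<le> row_stat nu + length xs * a" using nu(1) by (intro hstrips_row_stat(2)[OF _ s(1)]) simp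
      then show False using n s nu(1) by simp
    qed
  qed (use mem in simp)
  also have "\<dots> = 1" using snoc.IH[OF interlace_part(2)[OF il]] by simp
  finally show ?case .
qed

lemma schur_fun_triangular: "is_part la \<Longrightarrow> schur_fun la m \<noteq> 0 \<Longrightarrow> la = m \<or> row_stat la < row_stat m"
  using schur_fun_row_stat[of la "map (lookup m) [0..<degree m]"] by (auto simp: nth_idem)

lemma schur_fun_diag: "is_part la \<Longrightarrow> schur_fun la la = 1"
  using schur_fun_diag_nth[of "map (lookup la) [0..<degree la]"] by (simp add: nth_idem)

lemma degree_le_mono_degree:
  assumes "is_part la" shows "degree la \<le> mono_degree la"
proof -
  have pos: "1 \<le> lookup la i" if "i < degree la" for i
  proof -
    have "degree la - 1 \<in> keys la" using that by (intro degree_greater_zero_in_keys) simp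
    then have "1 \<le> lookup la (degree la - 1)" by (simp add: in_keys_iff)
    also have "\<dots> \<le> lookup la i" using that by (intro is_part_mono[OF assms]) simp
    finally show ?thesis .
  qed
  have "(\<Sum>i<degree la. 1) \<le> (\<Sum>i<degree la. lookup la i)" using pos by (intro sum_mono) simp
  then show ?thesis using mono_degree_superset[OF _ keys_degree, of la] by simp
qed

lemma finite_parts: "finite {la. is_part la \<and> mono_degree la \<le> d}"
proof (rule finite_subset)
  show "{la. is_part la \<and> mono_degree la \<le> d} \<subseteq> Poly_Mapping.nth ` {xs. set xs \<subseteq> {..d} \<and> length xs \<le> d}"
  proof
    fix la assume la: "la \<in> {la. is_part la \<and> mono_degree la \<le> d}"
    let ?xs = "map (lookup la) [0..<degree la]"
    have "lookup la i \<le> d" for i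
    proof (cases "i \<in> keys la")
      case True
      then have "lookup la i \<le> mono_degree la" unfolding mono_degree_def by (intro member_le_sum) auto
      then show ?thesis using la by simp
    qed (simp add: in_keys_iff)
    then have "?xs \<in> {xs. set xs \<subseteq> {..d} \<and> length xs \<le> d}" using la degree_le_mono_degree[of la] by auto
    moreover have "la = Poly_Mapping.nth ?xs" by (simp add: nth_idem)
    ultimately show "la \<in> Poly_Mapping.nth ` {xs. set xs \<subseteq> {..d} \<and> length xs \<le> d}" by blast
  qed
qed (intro finite_imageI finite_lists_length_le, simp)

text \<open>Triangular elimination: shapes enter in weakly increasing order of
  \<open>row_stat\<close>, so a new Schur function does not disturb the equations already solved and
  has coefficient 1 in its own.\<close>

lemma schur_fun_solve:
  assumes "finite P" "\<And>la. la \<in> P \<Longrightarrow> is_part la"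
  shows "\<exists>c. \<forall>mu\<in>P. \<phi> mu = (\<Sum>la\<in>P. c la * schur_fun la mu)"
  using assms
proof (induction P rule: finite_ranking_induct[where f = row_stat])
  case (insert x S)
  show ?case
  proof (cases "x \<in> S")
    case True
    then show ?thesis using insert by (simp add: insert_absorb)
  next
    case False
    obtain c where c: "\<And>mu. mu \<in> S \<Longrightarrow> \<phi> mu = (\<Sum>la\<in>S. c la * schur_fun la mu)" using insert by auto
    define c' where "c' = c(x := \<phi> x - (\<Sum>la\<in>S. c la * schur_fun la x))"
    have x: "schur_fun x mu = 0" if "mu \<in> S" for mu
    proof (rule ccontr)
      assume "schur_fun x mu \<noteq> 0"
      then have "x = mu \<or> row_stat x < row_stat mu" using schur_fun_triangular insert.prems by simp
      then show False using insert.hyps(2)[OF that] that False by auto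
    qed
    have S: "(\<Sum>la\<in>S. c' la * schur_fun la mu) = (\<Sum>la\<in>S. c la * schur_fun la mu)" for mu
      by (rule sum.cong) (use False in \<open>auto simp: c'_def\<close>)
    have "\<phi> mu = (\<Sum>la\<in>insert x S. c' la * schur_fun la mu)" if "mu \<in> insert x S" for mu
    proof (cases "mu = x")
      case True
      then show ?thesis using False insert.hyps(1) insert.prems by (simp add: S schur_fun_diag) (simp add: c'_def)
    next
      case neq: False
      then show ?thesis using False insert.hyps(1) that x c by (simp add: S)
    qed
    then show ?thesis by blast
  qed
qed simp

section \<open>Expansions in Schur functions\<close>

definition expansion :: "nat series \<Rightarrow> ((nat \<Rightarrow>\<^sub>0 nat) \<Rightarrow> complex) \<Rightarrow> bool" where
  "expansion f c \<longleftrightarrow> finite {la. c la \<noteq> 0} \<and> (\<forall>la. c la \<noteq> 0 \<longrightarrow> is_part la) \<and>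
     f = (\<lambda>m. \<Sum>la | c la \<noteq> 0. c la * schur_fun la m)"

lemma expansion_superset:
  assumes "expansion f c" "finite P" "{la. c la \<noteq> 0} \<subseteq> P"
  shows "f m = (\<Sum>la\<in>P. c la * schur_fun la m)"
proof -
  have "f m = (\<Sum>la | c la \<noteq> 0. c la * schur_fun la m)" using assms(1) unfolding expansion_def by metis
  also have "\<dots> = (\<Sum>la\<in>P. c la * schur_fun la m)" by (rule sum.mono_neutral_left) (use assms in auto)
  finally show ?thesis .
qed

lemma expansionI:
  assumes "finite P" "\<And>la. c la \<noteq> 0 \<Longrightarrow> la \<in> P \<and> is_part la" "\<And>m. f m = (\<Sum>la\<in>P. c la * schur_fun la m)"
  shows "expansion f c"
proof -
  have sub: "{la. c la \<noteq> 0} \<subseteq> P" using assms(2) by auto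
  have "f m = (\<Sum>la | c la \<noteq> 0. c la * schur_fun la m)" for m
    unfolding assms(3) by (rule sum.mono_neutral_right) (use assms(1) sub in auto)
  then show ?thesis using finite_subset[OF sub assms(1)] assms(2) by (auto simp: expansion_def)
qed

lemma expansion_schur: "is_part la \<Longrightarrow> expansion (schur_fun la) (\<lambda>mu. if mu = la then 1 else 0)"
  by (rule expansionI[of "{la}"]) (auto split: if_splits)

lemma expansion_linear:
  assumes "expansion f c" "expansion g d"
  shows "expansion (\<lambda>m. f m + z * g m) (\<lambda>la. c la + z * d la)"
proof (rule expansionI[of "{la. c la \<noteq> 0} \<union> {la. d la \<noteq> 0}"])
  let ?P = "{la. c la \<noteq> 0} \<union> {la. d la \<noteq> 0}"
  show fin: "finite ?P" using assms by (simp add: expansion_def)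
  show "la \<in> ?P \<and> is_part la" if "c la + z * d la \<noteq> 0" for la
  proof -
    have "c la \<noteq> 0 \<or> d la \<noteq> 0" using that by auto
    then show ?thesis using assms by (auto simp: expansion_def)
  qed
  fix m
  have "f m = (\<Sum>la\<in>?P. c la * schur_fun la m)" by (rule expansion_superset[OF assms(1) fin]) auto
  moreover have "g m = (\<Sum>la\<in>?P. d la * schur_fun la m)" by (rule expansion_superset[OF assms(2) fin]) auto
  ultimately show "f m + z * g m = (\<Sum>la\<in>?P. (c la + z * d la) * schur_fun la m)"
    by (simp add: sum_distrib_left sum.distrib algebra_simps)
qed

text \<open>Evaluate at a shape of minimal \<open>row_stat\<close> in the support; by triangularity
  no other shape contributes there.\<close>

lemma expansion_zero:
  assumes "expansion (\<lambda>m. 0) c" shows "c = (\<lambda>la. 0)"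
proof (rule ccontr)
  assume "c \<noteq> (\<lambda>la. 0)"
  let ?P = "{la. c la \<noteq> 0}"
  have P: "finite ?P" "?P \<noteq> {}" using assms \<open>c \<noteq> _\<close> by (auto simp: expansion_def)
  define x where "x = arg_min_on row_stat ?P"
  have x: "x \<in> ?P" "\<And>la. la \<in> ?P \<Longrightarrow> \<not> row_stat la < row_stat x"
    using arg_min_if_finite[OF P, of row_stat] by (auto simp: x_def)
  have "0 = (\<Sum>la\<in>?P. c la * schur_fun la x)" by (rule expansion_superset[OF assms P(1)]) simp
  also have "\<dots> = (\<Sum>la\<in>{x}. c la * schur_fun la x)"
  proof (rule sum.mono_neutral_right[OF P(1)])
    show "\<forall>la\<in>?P - {x}. c la * schur_fun la x = 0"
    proof
      fix la assume la: "la \<in> ?P - {x}"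
      then have "is_part la" using assms by (auto simp: expansion_def)
      then show "c la * schur_fun la x = 0" using schur_fun_triangular[of la x] x(2)[of la] la by auto
    qed
  qed (use x in simp)
  also have "\<dots> = c x" using x(1) assms by (simp add: schur_fun_diag expansion_def)
  finally show False using x(1) by simp
qed

lemma expansion_unique:
  assumes "expansion f c" "expansion f d" shows "c = d"
proof -
  have "expansion (\<lambda>m. f m + (- 1) * f m) (\<lambda>la. c la + (- 1) * d la)" by (rule expansion_linear[OF assms])
  then have "(\<lambda>la. c la + (- 1) * d la) = (\<lambda>la. 0)" by (intro expansion_zero) simp
  then show ?thesis by (auto simp: fun_eq_iff)
qed

lemma exists_part_exponents: "\<exists>la. is_part la \<and> exponents la = exponents m"
proof -
  define xs where "xs = rev (sorted_list_of_multiset (exponents m))"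
  have "mset xs = exponents m" by (simp add: xs_def)
  moreover have "filter_mset (\<lambda>k. k \<noteq> 0) (exponents m) = exponents m"
  proof (rule multiset_eqI)
    fix k
    have "0 \<notin># exponents m" by (auto simp: exponents_def in_keys_iff)
    then show "count (filter_mset (\<lambda>k. k \<noteq> 0) (exponents m)) k = count (exponents m) k" by (simp add: not_in_iff)
  qed
  moreover have "is_part (Poly_Mapping.nth xs)" unfolding is_part_def
  proof
    fix i
    have "sorted_wrt (\<ge>) xs" using sorted_sorted_list_of_multiset[of "exponents m"] by (simp add: xs_def sorted_wrt_rev)
    then show "lookup (Poly_Mapping.nth xs) (Suc i) \<le> lookup (Poly_Mapping.nth xs) i"
      using sorted_wrt_nth_less[of "(\<ge>)" xs i "Suc i"] by (simp add: nth_default_def)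
  qed
  ultimately show ?thesis using exponents_nth[of xs] by metis
qed

lemma expansion_Sym:
  assumes "expansion f c" shows "f \<in> Sym"
proof -
  let ?P = "{la. c la \<noteq> 0}"
  have P: "finite ?P" "\<And>la. la \<in> ?P \<Longrightarrow> is_part la" using assms by (auto simp: expansion_def)
  have f: "f m = (\<Sum>la\<in>?P. c la * schur_fun la m)" for m by (rule expansion_superset[OF assms P(1)]) simp
  have "exponent_invariant f" unfolding exponent_invariant_def
  proof (intro allI impI)
    fix m m' :: "nat \<Rightarrow>\<^sub>0 nat" assume "exponents m = exponents m'"
    then have "schur_fun la m = schur_fun la m'" if "la \<in> ?P" for la
      using schur_fun_invariant[OF P(2)[OF that]] unfolding exponent_invariant_def by blast
    then show "f m = f m'" unfolding f by (intro sum.cong) simp_all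
  qed
  moreover have "mono_degree m \<le> (\<Sum>la\<in>?P. mono_degree la)" if "f m \<noteq> 0" for m
  proof -
    have "(\<Sum>la\<in>?P. c la * schur_fun la m) \<noteq> 0" using that by (simp only: f not_False_eq_True)
    then obtain la where la: "la \<in> ?P" "c la * schur_fun la m \<noteq> 0" by (rule sum.not_neutral_contains_not_neutral)
    then have "mono_degree m = mono_degree la" using schur_fun_degree[of la m] by simp
    also have "\<dots> \<le> (\<Sum>la\<in>?P. mono_degree la)" by (rule member_le_sum) (use la P in auto)
    finally show ?thesis .
  qed
  ultimately show ?thesis by (auto simp: Sym_def symmetric_iff)
qed

text \<open>A symmetric function is determined by its coefficients at partitions. Up to its degree
  these are finitely many, and the triangular system yields a combination with the same
  coefficients.\<close>

lemma Sym_expansion: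
  assumes "f \<in> Sym" shows "\<exists>c. expansion f c"
proof -
  obtain d where d: "\<And>m. f m \<noteq> 0 \<Longrightarrow> mono_degree m \<le> d" and inv: "exponent_invariant f"
    using assms by (auto simp: Sym_def symmetric_iff)
  let ?P = "{la. is_part la \<and> mono_degree la \<le> d}"
  obtain c0 where c0: "\<And>mu. mu \<in> ?P \<Longrightarrow> f mu = (\<Sum>la\<in>?P. c0 la * schur_fun la mu)"
    using schur_fun_solve[OF finite_parts[of d], of f] by auto
  define c where "c la = (if la \<in> ?P then c0 la else 0)" for la
  define g where "g m = (\<Sum>la\<in>?P. c la * schur_fun la m)" for m
  have g: "expansion g c"
    by (rule expansionI[of ?P]) (auto simp: c_def g_def finite_parts split: if_splits)
  have "exponent_invariant g" using expansion_Sym[OF g] by (simp add: Sym_def symmetric_iff)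
  have "f m = g m" for m
  proof -
    obtain la where la: "is_part la" "exponents la = exponents m" using exists_part_exponents by blast
    have "f la = g la"
    proof (cases "mono_degree la \<le> d")
      case True
      have "g la = (\<Sum>mu\<in>?P. c0 mu * schur_fun mu la)" unfolding g_def by (intro sum.cong refl) (simp add: c_def)
      then show ?thesis using c0[of la] la True by simp
    next
      case False
      then have "schur_fun mu la = 0" if "mu \<in> ?P" for mu using schur_fun_degree[of mu la] that by auto
      then have "g la = 0" by (simp add: g_def)
      then show ?thesis using d[of la] False by auto
    qed
    then show ?thesis using inv \<open>exponent_invariant g\<close> la(2) unfolding exponent_invariant_def by metis
  qed
  then have "f = g" by blast
  then show ?thesis using g by blast
qed

definition schur_coeffs :: "nat series \<Rightarrow> (nat \<Rightarrow>\<^sub>0 nat) \<Rightarrow> complex" where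
  "schur_coeffs f = (SOME c. expansion f c)"

lemma expansion_schur_coeffs: "f \<in> Sym \<Longrightarrow> expansion f (schur_coeffs f)"
  unfolding schur_coeffs_def using Sym_expansion by (rule someI_ex)

lemma schur_coeffs_eq: "expansion f c \<Longrightarrow> schur_coeffs f = c"
  using expansion_unique expansion_schur_coeffs expansion_Sym by blast

lemma Sym_linear: "f \<in> Sym \<Longrightarrow> g \<in> Sym \<Longrightarrow> (\<lambda>m. f m + z * g m) \<in> Sym"
  using expansion_Sym expansion_linear expansion_schur_coeffs by blast

lemma Sym_zero: "(\<lambda>m. 0) \<in> Sym"
  by (rule expansion_Sym[of _ "\<lambda>la. 0"]) (simp add: expansion_def)

section \<open>The Hall form\<close>

lemma schur_partition:
  assumes "ls \<in> partitions"
  shows "schur ls = schur_fun (Poly_Mapping.nth ls)" "is_part (Poly_Mapping.nth ls)"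
  using assms nth_partitions by (auto simp: schur_eq bij_betw_def)

lemma part_schur:
  assumes "is_part la" obtains ls where "ls \<in> partitions" "la = Poly_Mapping.nth ls"
  using assms nth_partitions unfolding bij_betw_def by blast

lemma hall_form_exists: "\<exists>B. is_hall_form B"
proof -
  define B where "B f g = (\<Sum>la | schur_coeffs f la \<noteq> 0. schur_coeffs f la * schur_coeffs g la)" for f g
  have B: "B f g = (\<Sum>la\<in>P. c la * d la)" if "expansion f c" "expansion g d" "finite P" "{la. c la \<noteq> 0} \<subseteq> P" for f g c d P
    unfolding B_def schur_coeffs_eq[OF that(1)] schur_coeffs_eq[OF that(2)]
    by (rule sum.mono_neutral_left) (use that in auto)
  have "is_hall_form B" unfolding is_hall_form_def
  proof (intro conjI ballI allI)
    fix f g h z assume "f \<in> Sym" "g \<in> Sym" "h \<in> Sym"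
    then have e: "expansion f (schur_coeffs f)" "expansion g (schur_coeffs g)" "expansion h (schur_coeffs h)"
      by (simp_all add: expansion_schur_coeffs)
    let ?P = "{la. schur_coeffs f la \<noteq> 0} \<union> {la. schur_coeffs g la \<noteq> 0} \<union> {la. schur_coeffs h la \<noteq> 0}"
    have fin: "finite ?P" using e by (simp add: expansion_def)
    note l = expansion_linear[OF e(1,2), of z]
    show "B (\<lambda>m. f m + z * g m) h = B f h + z * B g h"
      by (subst B[OF l e(3) fin], force, subst B[OF e(1,3) fin], force, subst B[OF e(2,3) fin], force)
         (simp add: sum_distrib_left sum.distrib algebra_simps)
    show "B h (\<lambda>m. f m + z * g m) = B h f + z * B h g"
      by (subst B[OF e(3) l fin], force, subst B[OF e(3,1) fin], force, subst B[OF e(3,2) fin], force)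
         (simp add: sum_distrib_left sum.distrib algebra_simps)
  next
    fix ls ms assume p: "ls \<in> partitions" "ms \<in> partitions"
    have eq: "Poly_Mapping.nth ls = Poly_Mapping.nth ms \<longleftrightarrow> ls = ms"
      using p nth_partitions by (auto simp: bij_betw_def inj_on_def)
    show "B (schur ls) (schur ms) = (if ls = ms then 1 else 0)"
      unfolding schur_partition(1)[OF p(1)] schur_partition(1)[OF p(2)]
      by (subst B[OF expansion_schur[OF schur_partition(2)[OF p(1)]] expansion_schur[OF schur_partition(2)[OF p(2)]], of "{Poly_Mapping.nth ls}"])
         (auto simp: eq split: if_splits)
  qed
  then show ?thesis by blast
qed

lemma hall_form: "is_hall_form hall"
  unfolding hall_def using hall_form_exists by (rule someI_ex)

lemma hall_schur:
  assumes "is_part la" "is_part mu" shows "hall (schur_fun la) (schur_fun mu) = (if la = mu then 1 else 0)"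
proof -
  obtain ls ms where l: "ls \<in> partitions" "la = Poly_Mapping.nth ls" "ms \<in> partitions" "mu = Poly_Mapping.nth ms"
    using part_schur assms by metis
  have "ls = ms \<longleftrightarrow> la = mu" using l nth_partitions by (auto simp: bij_betw_def inj_on_def)
  then show ?thesis using hall_form l schur_partition(1) unfolding is_hall_form_def by metis
qed

lemma schur_fun_Sym: "is_part la \<Longrightarrow> schur_fun la \<in> Sym"
  using expansion_Sym expansion_schur by blast

lemma hall_linear:
  assumes "f \<in> Sym" "g \<in> Sym" "h \<in> Sym"
  shows "hall (\<lambda>m. f m + z * g m) h = hall f h + z * hall g h" "hall h (\<lambda>m. f m + z * g m) = hall h f + z * hall h g"
  using hall_form assms unfolding is_hall_form_def by blast+

lemma hall_zero:
  assumes "h \<in> Sym" shows "hall (\<lambda>m. 0) h = 0" "hall h (\<lambda>m. 0) = 0"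
  using hall_linear[OF Sym_zero Sym_zero assms, of 1] by simp_all

lemma hall_sum:
  assumes "finite P" "\<And>la. la \<in> P \<Longrightarrow> is_part la" "h \<in> Sym"
  shows "(\<lambda>m. \<Sum>la\<in>P. c la * schur_fun la m) \<in> Sym \<and>
    hall (\<lambda>m. \<Sum>la\<in>P. c la * schur_fun la m) h = (\<Sum>la\<in>P. c la * hall (schur_fun la) h) \<and>
    hall h (\<lambda>m. \<Sum>la\<in>P. c la * schur_fun la m) = (\<Sum>la\<in>P. c la * hall h (schur_fun la))"
  using assms(1,2)
proof (induction P rule: finite_induct)
  case empty
  then show ?case using Sym_zero hall_zero[OF assms(3)] by simp
next
  case (insert x P)
  let ?g = "\<lambda>m. \<Sum>la\<in>P. c la * schur_fun la m"
  have IH: "?g \<in> Sym" "hall ?g h = (\<Sum>la\<in>P. c la * hall (schur_fun la) h)" "hall h ?g = (\<Sum>la\<in>P. c la * hall h (schur_fun la))"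
    using insert by auto
  have x: "schur_fun x \<in> Sym" using insert.prems schur_fun_Sym by simp
  have eq: "(\<lambda>m. \<Sum>la\<in>insert x P. c la * schur_fun la m) = (\<lambda>m. ?g m + c x * schur_fun x m)"
    using insert.hyps by (simp add: add.commute)
  show ?case unfolding eq using Sym_linear[OF IH(1) x, of "c x"] hall_linear[OF IH(1) x assms(3), of "c x"] IH(2,3) insert.hyps
    by (simp add: add.commute)
qed

text \<open>\<open>hall\<close> is some chosen form; bilinearity and orthonormality determine it on
  \<open>Sym\<close>, whichever one was chosen.\<close>

lemma hall_expansion:
  assumes "expansion f c" "expansion g d" "finite P" "{la. c la \<noteq> 0} \<subseteq> P"
  shows "hall f g = (\<Sum>la\<in>P. c la * d la)"
proof -
  let ?C = "{la. c la \<noteq> 0}" and ?D = "{la. d la \<noteq> 0}"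
  have C: "finite ?C" "\<And>la. la \<in> ?C \<Longrightarrow> is_part la" "f = (\<lambda>m. \<Sum>la\<in>?C. c la * schur_fun la m)"
    using assms(1) by (auto simp: expansion_def)
  have D: "finite ?D" "\<And>la. la \<in> ?D \<Longrightarrow> is_part la" "g = (\<lambda>m. \<Sum>la\<in>?D. d la * schur_fun la m)"
    using assms(2) by (auto simp: expansion_def)
  have "hall f g = (\<Sum>la\<in>?C. c la * hall (schur_fun la) g)"
    by (subst C(3)) (use hall_sum[OF C(1,2) expansion_Sym[OF assms(2)], of c] in blast)
  also have "\<dots> = (\<Sum>la\<in>?C. c la * d la)"
  proof (rule sum.cong[OF refl])
    fix la assume la: "la \<in> ?C"
    have "hall (schur_fun la) g = (\<Sum>mu\<in>?D. d mu * hall (schur_fun la) (schur_fun mu))"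
      by (subst D(3)) (use hall_sum[OF D(1,2) schur_fun_Sym[OF C(2)[OF la]], of d] in blast)
    also have "\<dots> = (\<Sum>mu\<in>?D. if la = mu then d mu else 0)"
      by (rule sum.cong) (use hall_schur[OF C(2)[OF la] D(2)] in auto)
    also have "\<dots> = d la" using D(1) by simp
    finally show "c la * hall (schur_fun la) g = c la * d la" by simp
  qed
  also have "\<dots> = (\<Sum>la\<in>P. c la * d la)" by (rule sum.mono_neutral_left) (use assms in auto)
  finally show ?thesis .
qed

text \<open>Pairing with a Schur function reads off the corresponding coefficient.\<close>

lemma hall_nondegenerate:
  assumes "f \<in> Sym" "g \<in> Sym" "\<And>h. h \<in> Sym \<Longrightarrow> hall f h = hall g h"
  shows "f = g"
proof -
  have coeff: "hall f (schur_fun la) = schur_coeffs f la" if "f \<in> Sym" "is_part la" for f la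
  proof -
    note e = expansion_schur_coeffs[OF that(1)]
    let ?P = "{mu. schur_coeffs f mu \<noteq> 0} \<union> {la}"
    have "hall f (schur_fun la) = (\<Sum>mu\<in>?P. schur_coeffs f mu * (if mu = la then 1 else 0))"
      by (rule hall_expansion[OF e expansion_schur[OF that(2)]]) (use e in \<open>auto simp: expansion_def\<close>)
    also have "\<dots> = (\<Sum>mu\<in>?P. if mu = la then schur_coeffs f la else 0)" by (intro sum.cong refl) simp
    also have "\<dots> = schur_coeffs f la" using e unfolding expansion_def by (subst sum.delta) auto
    finally show ?thesis .
  qed
  note e = expansion_schur_coeffs[OF assms(1)] expansion_schur_coeffs[OF assms(2)]
  have "schur_coeffs f la = schur_coeffs g la" for la
  proof (cases "is_part la")
    case True
    then show ?thesis using coeff assms schur_fun_Sym by metis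
  next
    case False
    then show ?thesis using e by (metis expansion_def)
  qed
  then have "schur_coeffs f = schur_coeffs g" by blast
  then show ?thesis using e unfolding expansion_def by metis
qed

text \<open>By symmetry, the coefficient of \<open>y\<close> in the expansion of \<open>f\<close> in the alphabet
  \<open>x\<^sub>1, x\<^sub>2, \<dots>, y\<close> is obtained with any variable not in the monomial as \<open>y\<close>.\<close>

definition linear_coeff :: "nat series \<Rightarrow> nat series" where
  "linear_coeff f m = f (m + single (degree m) 1)"

section \<open>The adjoint of multiplication by s_1\<close>

lemma expansion_linear_coeff:
  assumes "expansion f c" "finite P" "{la. c la \<noteq> 0} \<subseteq> P" "\<And>la. la \<in> P \<Longrightarrow> is_part la"
  shows "expansion (linear_coeff f) (\<lambda>nu. \<Sum>la\<in>P. if nu \<in> hstrips 1 la then c la else 0)"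
proof (rule expansionI[of "\<Union>la\<in>P. hstrips 1 la"])
  show fin: "finite (\<Union>la\<in>P. hstrips 1 la)" using assms(2) finite_hstrips by blast
  fix nu assume "(\<Sum>la\<in>P. if nu \<in> hstrips 1 la then c la else 0) \<noteq> 0"
  then obtain la where "la \<in> P" "(if nu \<in> hstrips 1 la then c la else 0) \<noteq> 0"
    by (rule sum.not_neutral_contains_not_neutral)
  then have "la \<in> P" "nu \<in> hstrips 1 la" by (simp_all split: if_splits)
  then show "nu \<in> (\<Union>la\<in>P. hstrips 1 la) \<and> is_part nu" using hstrips_part by blast
next
  fix m
  let ?Q = "\<Union>la\<in>P. hstrips 1 la"
  have fin: "finite ?Q" using assms(2) finite_hstrips by blast
  have "linear_coeff f m = (\<Sum>la\<in>P. c la * schur_fun la (m + single (degree m) 1))"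
    unfolding linear_coeff_def by (rule expansion_superset[OF assms(1-3)])
  also have "\<dots> = (\<Sum>la\<in>P. \<Sum>nu\<in>?Q. (if nu \<in> hstrips 1 la then c la else 0) * schur_fun nu m)"
  proof (rule sum.cong[OF refl])
    fix la assume la: "la \<in> P"
    have "schur_fun la (m + single (degree m) 1) = (\<Sum>nu\<in>hstrips 1 la. schur_fun nu m)"
      by (rule schur_fun_last[OF assms(4)[OF la] keys_degree])
    also have "\<dots> = (\<Sum>nu\<in>?Q. if nu \<in> hstrips 1 la then schur_fun nu m else 0)"
      using la by (subst sum.inter_restrict[OF fin, symmetric]) (auto intro: sum.cong)
    finally have eq: "schur_fun la (m + single (degree m) 1) =
      (\<Sum>nu\<in>?Q. if nu \<in> hstrips 1 la then schur_fun nu m else 0)" .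
    show "c la * schur_fun la (m + single (degree m) 1) =
      (\<Sum>nu\<in>?Q. (if nu \<in> hstrips 1 la then c la else 0) * schur_fun nu m)"
      unfolding eq sum_distrib_left by (intro sum.cong refl) simp
  qed
  also have "\<dots> = (\<Sum>nu\<in>?Q. (\<Sum>la\<in>P. if nu \<in> hstrips 1 la then c la else 0) * schur_fun nu m)"
    by (subst sum.swap) (simp add: sum_distrib_right)
  finally show "linear_coeff f m = (\<Sum>nu\<in>?Q. (\<Sum>la\<in>P. if nu \<in> hstrips 1 la then c la else 0) * schur_fun nu m)" .
qed

lemma expansion_mult_schur_one:
  assumes "expansion h d" "finite R" "{mu. d mu \<noteq> 0} \<subseteq> R" "\<And>mu. mu \<in> R \<Longrightarrow> is_part mu"
  shows "expansion (series_mult (schur [1]) h) (\<lambda>la. \<Sum>mu\<in>R. if la \<in> up_set mu then d mu else 0)"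
proof (rule expansionI[of "\<Union>mu\<in>R. up_set mu"])
  show fin: "finite (\<Union>mu\<in>R. up_set mu)" using assms(2,4) finite_up_set by blast
  fix la assume "(\<Sum>mu\<in>R. if la \<in> up_set mu then d mu else 0) \<noteq> 0"
  then obtain mu where "mu \<in> R" "(if la \<in> up_set mu then d mu else 0) \<noteq> 0"
    by (rule sum.not_neutral_contains_not_neutral)
  then have "mu \<in> R" "la \<in> up_set mu" by (simp_all split: if_splits)
  then show "la \<in> (\<Union>mu\<in>R. up_set mu) \<and> is_part la" by (auto simp: up_set_def)
next
  fix m
  let ?Q = "\<Union>mu\<in>R. up_set mu"
  have fin: "finite ?Q" using assms(2,4) finite_up_set by blast
  have "series_mult (schur [1]) h m = (\<Sum>k\<in>keys m. \<Sum>mu\<in>R. d mu * schur_fun mu (m - single k 1))"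
    unfolding series_mult_schur_one by (intro sum.cong refl expansion_superset[OF assms(1-3)])
  also have "\<dots> = (\<Sum>mu\<in>R. d mu * series_mult (schur [1]) (schur_fun mu) m)"
    unfolding series_mult_schur_one sum_distrib_left by (rule sum.swap)
  also have "\<dots> = (\<Sum>mu\<in>R. \<Sum>la\<in>?Q. (if la \<in> up_set mu then d mu else 0) * schur_fun la m)"
  proof (rule sum.cong[OF refl])
    fix mu assume mu: "mu \<in> R"
    have "series_mult (schur [1]) (schur_fun mu) m = (\<Sum>la\<in>up_set mu. schur_fun la m)" by (rule pieri_one[OF assms(4)[OF mu]])
    also have "\<dots> = (\<Sum>la\<in>?Q. if la \<in> up_set mu then schur_fun la m else 0)"
      using mu by (subst sum.inter_restrict[OF fin, symmetric]) (auto intro: sum.cong)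
    finally have eq: "series_mult (schur [1]) (schur_fun mu) m = (\<Sum>la\<in>?Q. if la \<in> up_set mu then schur_fun la m else 0)" .
    show "d mu * series_mult (schur [1]) (schur_fun mu) m = (\<Sum>la\<in>?Q. (if la \<in> up_set mu then d mu else 0) * schur_fun la m)"
      unfolding eq sum_distrib_left by (intro sum.cong refl) simp
  qed
  also have "\<dots> = (\<Sum>la\<in>?Q. (\<Sum>mu\<in>R. if la \<in> up_set mu then d mu else 0) * schur_fun la m)"
    by (subst sum.swap) (simp add: sum_distrib_right)
  finally show "series_mult (schur [1]) h m = (\<Sum>la\<in>?Q. (\<Sum>mu\<in>R. if la \<in> up_set mu then d mu else 0) * schur_fun la m)" .
qed

text \<open>In the Schur basis the two operators have transposed matrices: one removes a box, the
  other adds one.\<close>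

lemma linear_coeff_adjoint:
  assumes "f \<in> Sym" "h \<in> Sym"
  shows "linear_coeff f \<in> Sym" "hall (linear_coeff f) h = hall f (series_mult (schur [1]) h)"
proof -
  define c where "c = schur_coeffs f"
  define d where "d = schur_coeffs h"
  let ?P = "{la. c la \<noteq> 0}" and ?R = "{mu. d mu \<noteq> 0}"
  have c: "expansion f c" and d: "expansion h d" unfolding c_def d_def using assms by (simp_all add: expansion_schur_coeffs)
  have P: "finite ?P" "\<And>la. la \<in> ?P \<Longrightarrow> is_part la" and R: "finite ?R" "\<And>mu. mu \<in> ?R \<Longrightarrow> is_part mu"
    using c d by (auto simp: expansion_def)
  let ?cd = "\<lambda>nu. \<Sum>la\<in>?P. if nu \<in> hstrips 1 la then c la else 0"
  have ec: "expansion (linear_coeff f) ?cd" by (rule expansion_linear_coeff[OF c P(1) subset_refl P(2)])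
  have ed: "expansion (series_mult (schur [1]) h) (\<lambda>la. \<Sum>mu\<in>?R. if la \<in> up_set mu then d mu else 0)"
    by (rule expansion_mult_schur_one[OF d R(1) subset_refl R(2)])
  show "linear_coeff f \<in> Sym" by (rule expansion_Sym[OF ec])
  let ?Q = "{nu. ?cd nu \<noteq> 0} \<union> ?R"
  have fQ: "finite ?Q" using ec R(1) by (simp add: expansion_def)
  have "hall (linear_coeff f) h = (\<Sum>nu\<in>?Q. ?cd nu * d nu)" by (rule hall_expansion[OF ec d fQ]) auto
  also have "\<dots> = (\<Sum>nu\<in>?R. ?cd nu * d nu)" by (rule sum.mono_neutral_right[OF fQ]) auto
  also have "\<dots> = (\<Sum>nu\<in>?R. \<Sum>la\<in>?P. if nu \<in> hstrips 1 la then c la * d nu else 0)"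
    unfolding sum_distrib_right by (intro sum.cong refl) simp
  also have "\<dots> = (\<Sum>la\<in>?P. \<Sum>nu\<in>?R. if nu \<in> hstrips 1 la then c la * d nu else 0)" by (rule sum.swap)
  also have "\<dots> = (\<Sum>la\<in>?P. \<Sum>nu\<in>?R. if la \<in> up_set nu then c la * d nu else 0)"
    by (intro sum.cong refl) (use up_set_hstrips P(2) R(2) in auto)
  also have "\<dots> = (\<Sum>la\<in>?P. c la * (\<Sum>mu\<in>?R. if la \<in> up_set mu then d mu else 0))"
    unfolding sum_distrib_left by (intro sum.cong refl) simp
  also have "\<dots> = hall f (series_mult (schur [1]) h)" by (rule hall_expansion[OF c ed P(1) subset_refl, symmetric])
  finally show "hall (linear_coeff f) h = hall f (series_mult (schur [1]) h)" .
qed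

lemma s1_perp_linear_coeff:
  assumes "f \<in> Sym" shows "s1_perp f = linear_coeff f"
  unfolding s1_perp_def
proof (rule the_equality)
  show "linear_coeff f \<in> Sym \<and> (\<forall>h\<in>Sym. hall (linear_coeff f) h = hall f (series_mult (schur [1]) h))"
    using linear_coeff_adjoint assms by blast
  fix g assume "g \<in> Sym \<and> (\<forall>h\<in>Sym. hall g h = hall f (series_mult (schur [1]) h))"
  then show "g = linear_coeff f" using linear_coeff_adjoint assms by (intro hall_nondegenerate) auto
qed

section \<open>Affine Stanley symmetric functions\<close>

abbreviation stanley_list :: "nat \<Rightarrow> (int \<Rightarrow> int) \<Rightarrow> nat list \<Rightarrow> complex" where
  "stanley_list n w xs \<equiv> lookup (h_prod n xs (single id 1)) w"

lemma stanley_list_swap: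
  assumes "3 \<le> n" shows "stanley_list n w (xs @ [a, b] @ ys) = stanley_list n w (xs @ [b, a] @ ys)"
proof -
  have "2 \<le> n" using assms by simp
  then show ?thesis by (simp add: h_prod_def h_act_commute[of n b a])
qed

lemma stanley_list_zero:
  assumes "3 \<le> n" shows "stanley_list n w (xs @ [0]) = stanley_list n w xs"
  using assms h_act_0[of n] by (simp add: h_prod_def)

text \<open>The coefficient may be computed from any list with the right nonzero entries. This sorts
  a monomial of the joint, interleaved alphabet into x first and y afterwards, and puts an extra
  variable at the end.\<close>

lemma affine_stanley_exponents:
  assumes "3 \<le> n" "exponents m = filter_mset (\<lambda>k. k \<noteq> 0) (mset xs)"
  shows "affine_stanley n w m = stanley_list n w xs"
  unfolding affine_stanley_h_prod[OF assms(1)]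
  by (rule list_fun_nonzero_mset[of "stanley_list n w", OF stanley_list_swap[OF assms(1)] stanley_list_zero[OF assms(1)]])
     (simp only: exponents_upt[OF keys_degree, symmetric] assms(2))

lemma word_act_homogeneous:
  assumes "2 \<le> n" "set is \<subseteq> {..<n}" "\<And>w. w \<in> affine_sym n \<Longrightarrow> lookup X w \<noteq> 0 \<Longrightarrow> len n w = d"
    "w \<in> affine_sym n" "lookup (word_act n is X) w \<noteq> 0"
  shows "len n w = d + length is"
  using assms(2,4,5)
proof (induction "is" arbitrary: w)
  case Nil
  then show ?case using assms(3) by simp
next
  case (Cons i "is")
  have i: "i < n" using Cons.prems by simp
  have d: "is_desc n i w" "lookup (word_act n is X) (simple_refl n i \<circ> w) \<noteq> 0"
    using Cons.prems(3) lookup_word_act_Cons[OF assms(1) i, of "is" X w] by (auto split: if_splits)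
  have "simple_refl n i \<circ> w \<in> affine_sym n" using Cons.prems(2) assms(1) by (simp add: simple_refl_comp_affine_iff)
  then have "len n (simple_refl n i \<circ> w) = d + length is" using Cons.IH d(2) Cons.prems(1) by simp
  then show ?case using len_simple_refl[OF assms(1) i Cons.prems(2)] d(1) by simp
qed

text \<open>A generator raises the length by one on every basis vector that it does not kill, so
  \<open>affine_stanley n w\<close> is homogeneous of degree \<open>len n w\<close>; this gives the
  degree bound in \<open>Sym\<close>.\<close>

lemma h_prod_homogeneous:
  assumes "2 \<le> n" "w \<in> affine_sym n" "stanley_list n w xs \<noteq> 0"
  shows "len n w = sum_list xs"
  using assms(2,3)
proof (induction xs arbitrary: w rule: rev_induct)
  case Nil
  then have "w = id" unfolding h_prod_def by (simp add: lookup_single when_def split: if_splits)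
  then have "len n w = 0" by (simp only: len_id)
  then show ?case by simp
next
  case (snoc k xs)
  let ?X = "h_prod n xs (single id 1)"
  have "(\<Sum>A | A \<subset> {..<n} \<and> card A = k. lookup (word_act n (cyc_order n A) ?X) w) \<noteq> 0"
  proof -
    have "h_prod n (xs @ [k]) Z = h_act n k (h_prod n xs Z)" for Z by (simp add: h_prod_def)
    then show ?thesis using snoc.prems(2) unfolding h_act_def by (simp only: lookup_sum not_False_eq_True)
  qed
  then obtain A where "A \<in> {A. A \<subset> {..<n} \<and> card A = k}" and nz: "lookup (word_act n (cyc_order n A) ?X) w \<noteq> 0"
    by (rule sum.not_neutral_contains_not_neutral)
  then have A: "A \<subset> {..<n}" "card A = k" by auto
  have "set (cyc_order n A) = A" "distinct (cyc_order n A)"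
    using admissible_cyc_order[OF assms(1) A(1)] by (simp_all add: admissible_order_def)
  then have c: "set (cyc_order n A) \<subseteq> {..<n}" "length (cyc_order n A) = k"
    using A distinct_card[of "cyc_order n A"] by auto
  have "len n w = sum_list xs + length (cyc_order n A)"
    by (rule word_act_homogeneous[OF assms(1) c(1) _ snoc.prems(1) nz]) (rule snoc.IH; assumption)
  then show ?case by (simp add: c(2))
qed

lemma affine_stanley_Sym:
  assumes "3 \<le> n" "w \<in> affine_sym n" shows "affine_stanley n w \<in> Sym"
proof -
  have "exponent_invariant (affine_stanley n w)"
    by (rule exponent_invariantI[of _ "stanley_list n w", OF affine_stanley_h_prod[OF assms(1)] stanley_list_swap[OF assms(1)] stanley_list_zero[OF assms(1)]])
  moreover have "mono_degree m \<le> len n w" if "affine_stanley n w m \<noteq> 0" for m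
  proof -
    have "len n w = sum_list (map (lookup m) [0..<degree m])"
      by (rule h_prod_homogeneous) (use assms that in \<open>simp_all add: affine_stanley_h_prod\<close>)
    also have "\<dots> = mono_degree m"
      using mono_degree_superset[OF _ keys_degree, of m] by (simp add: sum_list_distinct_conv_sum_set atLeast0LessThan)
    finally show ?thesis by simp
  qed
  ultimately show ?thesis by (auto simp: Sym_def symmetric_iff)
qed

text \<open>A monomial in the joint alphabet splits in only one way into an x part and a y part, so
  a single term of the convolution survives.\<close>

lemma series_mult_in_x_in_y:
  "series_mult (in_x f) (in_y g) m = f (map_key Inl m) * g (map_key Inr m)"
proof -
  have fin: "finite {k. (lookup m k when P k) \<noteq> 0}" for P
    by (rule finite_subset[of _ "keys m"]) (auto simp: in_keys_iff when_def split: if_splits)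
  define a where "a = Abs_poly_mapping (\<lambda>k. lookup m k when isl k)"
  define b where "b = Abs_poly_mapping (\<lambda>k. lookup m k when \<not> isl k)"
  have a: "lookup a = (\<lambda>k. lookup m k when isl k)"
    and b: "lookup b = (\<lambda>k. lookup m k when \<not> isl k)"
    unfolding a_def b_def using fin by simp_all
  have ab: "a + b = m" by (rule poly_mapping_eqI) (simp add: lookup_add a b when_def)
  have keys: "keys c \<subseteq> range Inl \<longleftrightarrow> (\<forall>k. lookup c (Inr k) = 0)"
     "keys c \<subseteq> range Inr \<longleftrightarrow> (\<forall>k. lookup c (Inl k) = 0)" for c :: "nat + nat \<Rightarrow>\<^sub>0 nat"
    by (auto simp: subset_iff in_keys_iff image_iff) (metis sum.exhaust not_gr0)+
  have uniq: "a' = a \<and> b' = b" if "a' + b' = m" "in_x f a' * in_y g b' \<noteq> 0" for a' b'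
  proof -
    have "keys a' \<subseteq> range Inl" "keys b' \<subseteq> range Inr"
      using that(2) by (auto simp: in_x_def in_y_def rename_def split: if_splits)
    then have z: "lookup a' (Inr k) = 0" "lookup b' (Inl k) = 0" for k
      unfolding keys by blast+
    have "lookup a' k = lookup a k \<and> lookup b' k = lookup b k" for k
      using z that(1) by (cases k) (auto simp: a b lookup_add)
    then show ?thesis by (auto intro: poly_mapping_eqI)
  qed
  have "series_mult (in_x f) (in_y g) m = (\<Sum>(a, b)\<in>{(a, b)}. in_x f a * in_y g b)"
    unfolding series_mult_def
  proof (rule sum.mono_neutral_right[OF finite_add_decomp])
    show "{(a, b)} \<subseteq> {(a, b). a + b = m}" using ab by simp
    show "\<forall>p\<in>{(a, b). a + b = m} - {(a, b)}. (case p of (a, b) \<Rightarrow> in_x f a * in_y g b) = 0"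
    proof
      fix p assume p: "p \<in> {(a, b). a + b = m} - {(a, b)}"
      obtain a' b' where p': "p = (a', b')" by fastforce
      have "in_x f a' * in_y g b' = 0"
      proof (rule ccontr)
        assume "in_x f a' * in_y g b' \<noteq> 0"
        then have "a' = a \<and> b' = b" using uniq p p' by blast
        then show False using p p' by blast
      qed
      then show "(case p of (a, b) \<Rightarrow> in_x f a * in_y g b) = 0" using p' by simp
    qed
  qed
  also have "\<dots> = in_x f a * in_y g b" by simp
  also have "in_x f a = f (map_key Inl m)"
  proof -
    have "keys a \<subseteq> range Inl" unfolding keys by (simp add: a)
    moreover have "map_key Inl a = map_key Inl m"
      by (rule poly_mapping_eqI) (simp add: map_key.rep_eq a)
    ultimately show ?thesis by (simp add: in_x_def rename_def)
  qed
  also have "in_y g b = g (map_key Inr m)"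
  proof -
    have "keys b \<subseteq> range Inr" unfolding keys by (simp add: b)
    moreover have "map_key Inr b = map_key Inr m"
      by (rule poly_mapping_eqI) (simp add: map_key.rep_eq b)
    ultimately show ?thesis by (simp add: in_y_def rename_def)
  qed
  finally show ?thesis .
qed

lemma exponents_sum_type:
  fixes m :: "nat + nat \<Rightarrow>\<^sub>0 nat"
  shows "exponents m = exponents (map_key Inl m) + exponents (map_key Inr m)"
proof -
  let ?x = "map_key Inl m" and ?y = "map_key Inr m"
  have k: "keys m = Inl ` keys ?x \<union> Inr ` keys ?y"
  proof (intro equalityI subsetI)
    fix k assume "k \<in> keys m"
    then show "k \<in> Inl ` keys ?x \<union> Inr ` keys ?y"
      by (cases k) (auto simp: in_keys_iff map_key.rep_eq)
  qed (auto simp: in_keys_iff map_key.rep_eq)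
  have "mset_set (keys m) = image_mset Inl (mset_set (keys ?x)) + image_mset Inr (mset_set (keys ?y))"
    unfolding k by (subst mset_set_Union) (auto simp: image_mset_mset_set)
  then show ?thesis by (simp add: exponents_def multiset.map_comp comp_def map_key.rep_eq)
qed

lemma affine_stanley_in_xy:
  assumes "3 \<le> n" "w \<in> affine_sym n"
  shows "in_xy (affine_stanley n w) m = (\<Sum>(u, v)\<in>factorizations n w.
    series_mult (in_x (affine_stanley n v)) (in_y (affine_stanley n u)) m)"
proof -
  have n2: "2 \<le> n" using assms by simp
  let ?x = "map_key Inl m" and ?y = "map_key Inr m"
  let ?xs = "map (lookup ?x) [0..<degree ?x]"
  let ?ys = "map (lookup ?y) [0..<degree ?y]"
  have "exponents (map_key sum_decode m) = exponents m"
    by (rule exponents_map_key) (auto simp: inj_sum_decode surj_sum_decode)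
  also have "\<dots> = filter_mset (\<lambda>k. k \<noteq> 0) (mset (?xs @ ?ys))"
    unfolding exponents_sum_type[of m] exponents_upt[OF keys_degree, of ?x] exponents_upt[OF keys_degree, of ?y] by simp
  finally have "affine_stanley n w (map_key sum_decode m) = stanley_list n w (?xs @ ?ys)"
    by (rule affine_stanley_exponents[OF assms(1)])
  then have "in_xy (affine_stanley n w) m = stanley_list n w (?xs @ ?ys)"
    by (simp add: in_xy_def rename_def surj_sum_decode)
  also have "\<dots> = (\<Sum>(u, v)\<in>factorizations n w. affine_stanley n u ?y * affine_stanley n v ?x)"
    unfolding affine_stanley_h_prod[OF assms(1)] by (rule h_prod_append_factorizations[OF n2 assms(2)])
  finally show ?thesis by (simp add: series_mult_in_x_in_y mult.commute)
qed

lemma simple_refl_inject: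
  assumes "2 \<le> n" "i < n" "j < n" "simple_refl n i = simple_refl n j" shows "i = j"
proof -
  have "simple_refl n j (int i) = int i + 1" using simple_refl_eqs(1)[of n "int i" i] assms by simp
  then have "int n dvd int i - int j" unfolding simple_refl_alt by (auto split: if_splits)
  then show ?thesis using assms by (simp add: mod_eq_dvd_iff[symmetric])
qed

text \<open>The extra variable stands last in the list, so h_1, the sum of all u_i, acts last. The
  surviving terms are the left descents i of \<open>w\<close>, and \<open>v\<close> is
  \<open>w\<close> with that letter stripped.\<close>

lemma linear_coeff_affine_stanley:
  assumes "3 \<le> n" "w \<in> affine_sym n"
  shows "linear_coeff (affine_stanley n w) m = (\<Sum>v\<in>{v \<in> affine_sym n. (\<exists>i<n. w = simple_refl n i \<circ> v) \<and> len n w = len n v + 1}.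
    affine_stanley n v m)"
proof -
  have n2: "2 \<le> n" using assms by simp
  let ?xs = "map (lookup m) [0..<degree m]"
  let ?V = "{v \<in> affine_sym n. (\<exists>i<n. w = simple_refl n i \<circ> v) \<and> len n w = len n v + 1}"
  let ?s = "simple_refl n"
  note invol = simple_refl_comp_invol(2)[OF n2]
  have "m + single (degree m) 1 = Poly_Mapping.nth (?xs @ [1])"
    by (simp add: nth_snoc nth_idem)
  then have "linear_coeff (affine_stanley n w) m = stanley_list n w (?xs @ [1])"
    unfolding linear_coeff_def by (intro affine_stanley_exponents[OF assms(1)]) (simp only: exponents_nth)
  also have "\<dots> = (\<Sum>i<n. lookup (word_act n [i] (h_prod n ?xs (single id 1))) w)"
    using h_act_1[OF n2] by (simp add: h_prod_def lookup_sum)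
  also have "\<dots> = (\<Sum>i<n. if is_desc n i w then affine_stanley n (?s i \<circ> w) m else 0)"
    unfolding affine_stanley_h_prod[OF assms(1)]
    by (intro sum.cong refl, subst lookup_word_act_Cons[OF n2]) simp_all
  also have "\<dots> = (\<Sum>i | i < n \<and> is_desc n i w. affine_stanley n (?s i \<circ> w) m)"
    by (subst sum.inter_filter[symmetric]) (auto intro: sum.cong)
  also have "\<dots> = (\<Sum>v\<in>?V. affine_stanley n v m)"
  proof (rule sum.reindex_bij_betw)
    show "bij_betw (\<lambda>i. ?s i \<circ> w) {i. i < n \<and> is_desc n i w} ?V"
      unfolding bij_betw_def
    proof
      have surj: "surj w" using affine_symD(1)[OF assms(2)] by (rule bij_is_surj)
      show "inj_on (\<lambda>i. ?s i \<circ> w) {i. i < n \<and> is_desc n i w}"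
      proof (rule inj_onI)
        fix i j assume ij: "i \<in> {i. i < n \<and> is_desc n i w}" "j \<in> {i. i < n \<and> is_desc n i w}" "?s i \<circ> w = ?s j \<circ> w"
        then have "?s i = ?s j" using surj by (metis surj_fun_eq comp_apply)
        then show "i = j" using simple_refl_inject[OF n2] ij by blast
      qed
      show "(\<lambda>i. ?s i \<circ> w) ` {i. i < n \<and> is_desc n i w} = ?V"
      proof (intro equalityI subsetI)
        fix v assume "v \<in> (\<lambda>i. ?s i \<circ> w) ` {i. i < n \<and> is_desc n i w}"
        then obtain i where i: "i < n" "is_desc n i w" "v = ?s i \<circ> w" by blast
        have "v \<in> affine_sym n" unfolding i(3) using simple_refl_comp_affine_iff[OF n2] assms(2) by blast
        moreover have "w = ?s i \<circ> v" unfolding i(3) invol ..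
        moreover have "len n w = len n v + 1" using len_simple_refl[OF n2 i(1) assms(2)] i(2,3) by simp
        ultimately show "v \<in> ?V" using i(1) by blast
      next
        fix v assume "v \<in> ?V"
        then obtain i where i: "v \<in> affine_sym n" "i < n" "w = ?s i \<circ> v" "len n w = len n v + 1" by blast
        have v: "v = ?s i \<circ> w" unfolding i(3) invol ..
        have "is_desc n i w" using len_less_iff[OF n2 i(2), of w] i(4) unfolding v[symmetric] by simp
        then show "v \<in> (\<lambda>i. ?s i \<circ> w) ` {i. i < n \<and> is_desc n i w}" using i(2) v by blast
      qed
    qed
  qed
  finally show ?thesis .
qed

theorem theorem7p1:
  fixes n :: nat and w :: "int \<Rightarrow> int"
  assumes "3 \<le> n" and "w \<in> affine_sym n"
  shows "in_xy (affine_stanley n w) =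
           (\<lambda>m. \<Sum>(u, v)\<in>{(u, v). u \<in> affine_sym n \<and> v \<in> affine_sym n \<and> u \<circ> v = w \<and>
                                len n u + len n v = len n w}.
              series_mult (in_x (affine_stanley n v)) (in_y (affine_stanley n u)) m) \<and>
         s1_perp (affine_stanley n w) =
           (\<lambda>m. \<Sum>v\<in>{v \<in> affine_sym n. (\<exists>i<n. w = simple_refl n i \<circ> v) \<and>
                                len n w = len n v + 1}.
              affine_stanley n v m)"
  unfolding s1_perp_linear_coeff[OF affine_stanley_Sym[OF assms]]
  by (intro conjI ext linear_coeff_affine_stanley[OF assms] affine_stanley_in_xy[OF assms, unfolded factorizations_def])

end
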